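(* Let $G$ be a finite complex reflection group acting on $\mathbb C^d$, let $\Omega\subseteq\mathbb C^d$ be a bounded $G$-invariant domain, let $\boldsymbol\theta$ be a basic polynomial map associated to $G$, let $\widetilde\omega:\boldsymbol\theta(\Omega)\to(0,\infty)$ be continuous and let $\omega=\widetilde\omega\circ\boldsymbol\theta$. The weighted Bergman projections $P^\omega_\Omega:L^2_\omega(\Omega)\to\mathbb A^2_\omega(\Omega)$ and $P^{\widetilde\omega}_{\boldsymbol\theta(\Omega)}:L^2_{\widetilde\omega}(\boldsymbol\theta(\Omega))\to\mathbb A^2_{\widetilde\omega}(\boldsymbol\theta(\Omega))$ are related by $$P^\omega_\Omega\big(J_{\boldsymbol\theta}\,(\phi\circ\boldsymbol\theta)\big)=J_{\boldsymbol\theta}\,\big((P^{\widetilde\omega}_{\boldsymbol\theta(\Omega)}\phi)\circ\boldsymbol\theta\big),\qquad\phi\in L^2_{\widetilde\omega}(\boldsymbol\theta(\Omega)),$$ where $J_{\boldsymbol\theta}$ is the determinant of the complex Jacobian matrix of $\boldsymbol\theta$.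
   Context: A complex reflection on $\mathbb C^d$ is a linear map $\sigma$ of finite order in $GL(d,\mathbb C)$ such that $\mathrm{id}-\sigma$ has rank $1$. A finite complex reflection group is a finite subgroup $G\subset GL(d,\mathbb C)$ generated by complex reflections. $G$ acts on $\mathbb C^d$ by $\sigma\cdot\boldsymbol z=\sigma^{-1}\boldsymbol z$; a domain $\Omega$ is $G$-invariant if it is preserved by this action. A basic polynomial map associated to $G$ is $\boldsymbol\theta=(\theta_1,\dots,\theta_d):\mathbb C^d\to\mathbb C^d$, where $\theta_1,\dots,\theta_d$ are algebraically independent homogeneous polynomials with $\mathbb C[z_1,\dots,z_d]^G=\mathbb C[\theta_1,\dots,\theta_d]$ (these exist by the Chevalley–Shephard–Todd theorem). For a $G$-invariant domain $\Omega$, $\boldsymbol\theta(\Omega)$ is a domain. For a domain $D$ and a continuous weight $\nu:D\to(0,\infty)$, $L^2_\nu(D)=L^2(D,\nu\,dV)$, $\mathbb A^2_\nu(D)$ is its closed subspace of holomorphic functions, and the weighted Bergman projection $P^\nu_D:L^2_\nu(D)\to\mathbb A^2_\nu(D)$ is $(P^\nu_D\phi)(\boldsymbol z)=\int_D\phi(\boldsymbol w)\mathcal B_\nu(\boldsymbol z,\boldsymbol w)\nu(\boldsymbol w)\,dV(\boldsymbol w)$, where $\mathcal B_\nu$ is the reproducing kernel of $\mathbb A^2_\nu(D)$ (i.e. the orthogonal projection). $dV$ is Lebesgue measure normalized on $\Omega$; the same multiple of Lebesgue measure is used on $\boldsymbol\theta(\Omega)$. *)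

theory Defs
  imports
    "HOL-Analysis.Analysis"
    "HOL-Algebra.Generated_Groups"
    "HOL-Library.Poly_Mapping"
begin

section \<open>Complex reflection groups\<close>

definition general_linear :: "(complex^'d^'d) monoid" where
  "general_linear = \<lparr>carrier = {A. invertible A}, mult = (**), one = mat 1\<rparr>"

lemma general_linear_simps [simp]:
  "carrier general_linear = {A. invertible A}"
  "A \<otimes>\<^bsub>general_linear\<^esub> B = A ** B"
  "\<one>\<^bsub>general_linear\<^esub> = mat 1"
  by (simp_all add: general_linear_def)

lemma group_general_linear: "group (general_linear :: (complex^'d^'d) monoid)"
proof (rule groupI)
  fix A :: "complex^'d^'d"
  assume "A \<in> carrier general_linear"
  then obtain B where "A ** B = mat 1" "B ** A = mat 1"
    by (auto simp: invertible_def)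
  then show "\<exists>B\<in>carrier general_linear. B \<otimes>\<^bsub>general_linear\<^esub> A = \<one>\<^bsub>general_linear\<^esub>"
    by (auto simp: invertible_def)
qed (simp_all add: invertible_mult matrix_mul_assoc, simp add: invertible_def)

lemma inv_general_linear:
  assumes "invertible A"
  shows "inv\<^bsub>general_linear\<^esub> A = matrix_inv A"
proof -
  interpret group general_linear by (rule group_general_linear)
  have "A ** matrix_inv A = mat 1 \<and> matrix_inv A ** A = mat 1"
    using assms unfolding invertible_def matrix_inv_def by (rule someI_ex)
  then show ?thesis
    by (intro inv_equality) (use assms in \<open>auto simp: invertible_def\<close>)
qed

text \<open>The power below is the group power; the power of the type class on
  \<^typ>\<open>complex^'d^'d\<close> would be the entrywise one.\<close>

definition complex_reflection :: "complex^'d^'d \<Rightarrow> bool" where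
  "complex_reflection A \<longleftrightarrow>
     invertible A \<and> (\<exists>n::nat. 0 < n \<and> A [^]\<^bsub>general_linear\<^esub> n = mat 1) \<and> rank (mat 1 - A) = 1"

definition finite_complex_reflection_group :: "(complex^'d^'d) set \<Rightarrow> bool" where
  "finite_complex_reflection_group G \<longleftrightarrow>
     subgroup G general_linear \<and> finite G \<and>
     (\<exists>R. (\<forall>A\<in>R. complex_reflection A) \<and> G = generate general_linear R)"

definition act :: "complex^'d^'d \<Rightarrow> complex^'d \<Rightarrow> complex^'d" where
  "act A z = matrix_inv A *v z"

definition group_invariant :: "(complex^'d^'d) set \<Rightarrow> (complex^'d) set \<Rightarrow> bool" where
  "group_invariant G D \<longleftrightarrow> (\<forall>A\<in>G. act A ` D = D)"

section \<open>Polynomials in several variables\<close>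

text \<open>A polynomial in variables indexed by \<^typ>\<open>'d\<close> is a finitely supported map from exponent
  vectors to coefficients. Since the field of complex numbers is infinite, the polynomial ring is
  identified with the ring of polynomial functions.\<close>

type_synonym 'd cpoly = "('d \<Rightarrow>\<^sub>0 nat) \<Rightarrow>\<^sub>0 complex"

definition poly_eval :: "'d cpoly \<Rightarrow> complex^'d \<Rightarrow> complex" where
  "poly_eval p z =
     (\<Sum>m\<in>Poly_Mapping.keys p.
        Poly_Mapping.lookup p m * (\<Prod>i\<in>UNIV. (z $ i) ^ Poly_Mapping.lookup m i))"

definition homogeneous :: "'d::finite cpoly \<Rightarrow> bool" where
  "homogeneous p \<longleftrightarrow>
     (\<exists>k. \<forall>m\<in>Poly_Mapping.keys p. (\<Sum>i\<in>UNIV. Poly_Mapping.lookup m i) = k)"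

definition invariant_polynomials ::
    "(complex^'d^'d) set \<Rightarrow> (complex^'d \<Rightarrow> complex) set" where
  "invariant_polynomials G = {f \<in> range poly_eval. \<forall>A\<in>G. \<forall>z. f (act A z) = f z}"

definition basic_polynomial_map ::
    "(complex^'d^'d) set \<Rightarrow> (complex^'d \<Rightarrow> complex^'d) \<Rightarrow> bool" where
  "basic_polynomial_map G \<theta> \<longleftrightarrow>
     (\<forall>i. \<exists>p. homogeneous p \<and> (\<lambda>z. \<theta> z $ i) = poly_eval p) \<and>
     (\<forall>q. (\<forall>z. poly_eval q (\<theta> z) = 0) \<longrightarrow> q = 0) \<and>
     invariant_polynomials G = range (\<lambda>q z. poly_eval q (\<theta> z))"

definition complex_jacobian :: "(complex^'d \<Rightarrow> complex^'d) \<Rightarrow> complex^'d \<Rightarrow> complex" where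
  "complex_jacobian f z = det (\<chi> i j. deriv (\<lambda>t. f (z + t *s axis j 1) $ i) 0)"

section \<open>Weighted Bergman spaces and projections\<close>

definition holomorphic_several :: "(complex^'d \<Rightarrow> complex) \<Rightarrow> (complex^'d) set \<Rightarrow> bool" where
  "holomorphic_several f D \<longleftrightarrow>
     (\<forall>z\<in>D. \<exists>f'. (f has_derivative f') (at z) \<and> (\<forall>c v. f' (c *s v) = c * f' v))"

text \<open>The argument \<open>V\<close> below is the underlying volume measure, a multiple of Lebesgue measure.
  Elements of \<open>L\<^sup>2\<close> are represented by functions rather than by classes modulo null functions,
  and the values of these functions outside \<open>D\<close> are irrelevant.\<close>

definition weighted_measure ::
    "(complex^'d) measure \<Rightarrow> (complex^'d) set \<Rightarrow> (complex^'d \<Rightarrow> real) \<Rightarrow> (complex^'d) measure" where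
  "weighted_measure V D \<nu> = density (restrict_space V D) (\<lambda>z. ennreal (\<nu> z))"

definition L2 ::
    "(complex^'d) measure \<Rightarrow> (complex^'d) set \<Rightarrow> (complex^'d \<Rightarrow> real) \<Rightarrow> (complex^'d \<Rightarrow> complex) set" where
  "L2 V D \<nu> =
     {f \<in> borel_measurable (weighted_measure V D \<nu>).
        integrable (weighted_measure V D \<nu>) (\<lambda>z. (cmod (f z))\<^sup>2)}"

definition bergman_space ::
    "(complex^'d) measure \<Rightarrow> (complex^'d) set \<Rightarrow> (complex^'d \<Rightarrow> real) \<Rightarrow> (complex^'d \<Rightarrow> complex) set" where
  "bergman_space V D \<nu> = {f \<in> L2 V D \<nu>. holomorphic_several f D}"

definition reproducing_kernel ::
    "(complex^'d) measure \<Rightarrow> (complex^'d) set \<Rightarrow> (complex^'d \<Rightarrow> real) \<Rightarrow>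
     (complex^'d \<Rightarrow> complex^'d \<Rightarrow> complex) \<Rightarrow> bool" where
  "reproducing_kernel V D \<nu> K \<longleftrightarrow>
     (\<forall>w\<in>D. (\<lambda>z. K z w) \<in> bergman_space V D \<nu> \<and>
        (\<forall>f\<in>bergman_space V D \<nu>.
           f w = (LINT z|weighted_measure V D \<nu>. f z * cnj (K z w))))"

text \<open>The kernel is a function on \<open>D \<times> D\<close>; it is extended by zero so as to be unique as a total
  function.\<close>

definition bergman_kernel ::
    "(complex^'d) measure \<Rightarrow> (complex^'d) set \<Rightarrow> (complex^'d \<Rightarrow> real) \<Rightarrow>
     complex^'d \<Rightarrow> complex^'d \<Rightarrow> complex" where
  "bergman_kernel V D \<nu> =
     (THE K. reproducing_kernel V D \<nu> K \<and> (\<forall>z w. z \<notin> D \<or> w \<notin> D \<longrightarrow> K z w = 0))"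

definition bergman_projection ::
    "(complex^'d) measure \<Rightarrow> (complex^'d) set \<Rightarrow> (complex^'d \<Rightarrow> real) \<Rightarrow>
     (complex^'d \<Rightarrow> complex) \<Rightarrow> complex^'d \<Rightarrow> complex" where
  "bergman_projection V D \<nu> \<phi> z =
     (LINT w|weighted_measure V D \<nu>. \<phi> w * bergman_kernel V D \<nu> z w)"

definition normalized_lebesgue :: "(complex^'d) set \<Rightarrow> (complex^'d) measure" where
  "normalized_lebesgue \<Omega> = density lebesgue (\<lambda>_. 1 / emeasure lebesgue \<Omega>)"

end

theory Submission
  imports Defs "HOL-Complex_Analysis.Complex_Analysis"
begin

text \<open>Let \<open>n\<close> be the order of \<open>G\<close>, let \<open>J\<close> be the Jacobian determinant of \<open>\<theta>\<close>, and put
\<open>\<Gamma>\<psi> = J (\<psi> \<circ> \<theta>)\<close>; this is the function called \<open>lift \<psi>\<close> below.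

Two points of \<open>\<Omega>\<close> have the same image under \<open>\<theta>\<close> exactly when they lie in one \<open>G\<close>-orbit, and \<open>J\<close> does
not vanish at a point with trivial stabilizer. Away from a proper zero set \<open>{u. \<Delta> u = 0}\<close> of a
polynomial, \<open>\<theta>\<close> is therefore an \<open>n\<close>-sheeted local biholomorphism from \<open>\<Omega>\<close> onto \<open>\<theta>(\<Omega>)\<close>. The real
Jacobian determinant of a holomorphic map is the square of the modulus of the complex one, so a
change of variables gives
\<open>\<integral> |J|\<^sup>2 (F \<circ> \<theta>) \<omega> dV = n \<integral> F \<omega>' dV\<close>, where the integrals are over \<open>\<Omega>\<close> and \<open>\<theta>(\<Omega>)\<close> (lemmas
\<open>theta_pushforward\<close> and \<open>integral_pushforward\<close>). In particular \<open>\<Gamma>\<close> maps square integrable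
functions to square integrable functions.

The Bergman projection \<open>P \<phi>\<close> is the only element \<open>k\<close> of the Bergman space for which \<open>\<phi> - k\<close> is
orthogonal to that space. Since \<open>\<Gamma>\<close> also preserves holomorphy, the theorem \<open>P(\<Gamma>\<phi>) = \<Gamma>(P\<phi>)\<close> follows
once \<open>\<Gamma>\<close> is known to map the orthogonal complement of the Bergman space of \<open>\<theta>(\<Omega>)\<close> into the
orthogonal complement of the Bergman space of \<open>\<Omega>\<close>. This is the adjoint relation
\<open>\<langle>f, \<Gamma>\<psi>\<rangle> = n \<langle>h, \<psi>\<rangle>\<close> of lemma \<open>ex_bergman_adjoint_of_lift\<close>: for \<open>f\<close> in the Bergman space of \<open>\<Omega>\<close>, the function \<open>h\<close> is
the mean of \<open>f / J\<close> over the orbits, \<open>h (\<theta> z) = (1/n) \<Sum>_A f (A z) / J (A z)\<close>, and the relation is the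
change of variables above combined with the invariance of volume and weight under \<open>G\<close>.

A priori \<open>h\<close> is holomorphic only where \<open>\<Delta>\<close> does not vanish. The change of variables shows however
that it is square integrable, and a square integrable holomorphic function extends across the zero
set of a polynomial (lemma \<open>L2_extension\<close>): on almost every complex line in a suitable direction
the singularities are isolated and square integrable, hence removable, and Cauchy's formula on these
lines defines the extension. So \<open>h\<close> belongs to the Bergman space of \<open>\<theta>(\<Omega>)\<close>.

Behind this stand three further facts. The Bergman kernel exists, because
point evaluations are bounded by the mean value inequality and the Bergman space is complete (lemmas
\<open>evaluation_locally_bounded\<close>, \<open>bergman_complete\<close>, \<open>Riesz_representation\<close>). Orbits are separated and
nonvanishing of \<open>J\<close> is detected by averaging interpolation polynomials over \<open>G\<close> (lemmas
\<open>theta_separates_orbits\<close>, \<open>complex_jacobian_nonzero\<close>). Finally \<open>\<theta>(\<Omega>)\<close> is open, because \<open>\<theta>\<close> is proper and surjective and \<open>\<Omega>\<close> is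
a union of fibres (lemma \<open>open_theta_image\<close>).\<close>

section \<open>Averages over roots of unity and the mean value inequality\<close>

text \<open>Means over roots of unity take the place of integral means over circles. They are finite sums, so
they preserve holomorphy in a parameter, and they converge to the value at the centre.\<close>

definition root_mean :: "nat \<Rightarrow> (complex \<Rightarrow> complex) \<Rightarrow> complex" where
  "root_mean N g = (\<Sum>k<N. g (cis (2 * pi * real k / real N))) / of_nat N"

lemma sum_roots_of_unity_power:
  assumes "N > 0"
  shows "(\<Sum>k<N. cis (2 * pi * real k / real N) ^ j) = (if N dvd j then of_nat N else 0)"
proof -
  let ?q = "cis (2 * pi * real j / real N)"
  have eq: "cis (2 * pi * real k / real N) ^ j = ?q ^ k" for k
    unfolding Complex.DeMoivre by (simp add: mult.commute mult.left_commute)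
  have qN: "?q ^ N = 1"
    using assms by (simp add: Complex.DeMoivre cis_multiple_2pi)
  have q1: "?q = 1 \<longleftrightarrow> N dvd j"
  proof
    assume "?q = 1"
    then have "exp (\<i> * of_real (2 * pi * real j / real N)) = 1"
      by (simp add: cis_conv_exp)
    then obtain n :: int where "2 * pi * real j / real N = of_int (2 * n) * pi"
      unfolding exp_eq_1 by auto
    then have "real j = of_int n * real N"
      using assms by (simp add: field_simps)
    then have "int j = n * int N"
      by (metis of_int_eq_iff of_int_mult of_int_of_nat_eq)
    then show "N dvd j"
      by (metis dvd_triv_right int_dvd_int_iff)
  next
    assume "N dvd j"
    then obtain m where "j = N * m" ..
    then have "2 * pi * real j / real N = 2 * pi * real m" using assms by simp
    then show "?q = 1" by (metis cis_multiple_2pi Ints_of_nat)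
  qed
  show ?thesis
  proof (cases "N dvd j")
    case True
    then show ?thesis using q1 by (simp add: eq)
  next
    case False
    then have "?q \<noteq> 1" using q1 by simp
    then show ?thesis
      using geometric_sum[of ?q N] qN False by (simp add: eq)
  qed
qed

text \<open>The mean over the \<open>N\<close>-th roots of unity annihilates the monomials of the power series of \<open>g\<close> whose
exponent is not divisible by \<open>N\<close>. What remains besides \<open>g 0\<close> is bounded by the tail of an absolutely
convergent series.\<close>

lemma root_mean_tendsto:
  assumes hol: "g holomorphic_on ball 0 R" and R: "R > 1"
  shows "(\<lambda>N. root_mean N g) \<longlonglongrightarrow> g 0"
proof -
  define a where "a n = (deriv ^^ n) g 0 / fact n" for n
  have sums: "(\<lambda>n. a n * t ^ n) sums g t" if "cmod t < R" for t
    using holomorphic_power_series[OF hol, of t] that by (simp add: a_def)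
  have abs: "summable (\<lambda>n. cmod (a n))"
  proof -
    obtain s where s: "1 < s" "s < R" using R dense by blast
    have "summable (\<lambda>n. a n * of_real s ^ n)"
      using sums[of "of_real s"] s by (simp add: sums_iff)
    from powser_insidea[OF this, of 1] show ?thesis using s by simp
  qed
  have bound: "cmod (root_mean N g - g 0) \<le> suminf (\<lambda>n. cmod (a (n + N)))" if N: "N > 0" for N
  proof -
    have "(\<lambda>n. \<Sum>k<N. a n * cis (2 * pi * real k / real N) ^ n) sums
        (\<Sum>k<N. g (cis (2 * pi * real k / real N)))"
      by (intro sums_sum sums) (use R in simp)
    then have "(\<lambda>n. (\<Sum>k<N. a n * cis (2 * pi * real k / real N) ^ n) / of_nat N) sums root_mean N g"
      unfolding root_mean_def by (rule sums_divide)
    moreover have "(\<Sum>k<N. a n * cis (2 * pi * real k / real N) ^ n) / of_nat N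
        = (if N dvd n then a n else 0)" for n
      using sum_roots_of_unity_power[OF N, of n] N by (simp add: sum_distrib_left[symmetric])
    ultimately have S: "(\<lambda>n. if N dvd n then a n else 0) sums root_mean N g"
      by simp
    have "(\<lambda>n. if N dvd n + N then a (n + N) else 0) sums
        (root_mean N g - (\<Sum>n<N. if N dvd n then a n else 0))"
      using S sums_iff_shift'[of "\<lambda>n. if N dvd n then a n else 0" N "root_mean N g"] by simp
    moreover have "(\<Sum>n<N. if N dvd n then a n else 0) = a 0"
    proof -
      have "(\<Sum>n<N. if N dvd n then a n else 0) = (\<Sum>n\<in>{0}. if N dvd n then a n else 0)"
        using N by (intro sum.mono_neutral_right) (auto dest: dvd_imp_le)
      then show ?thesis by simp
    qed
    moreover have "a 0 = g 0" by (simp add: a_def)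
    ultimately have T: "(\<lambda>n. if N dvd n + N then a (n + N) else 0) sums (root_mean N g - g 0)"
      by simp
    have s2: "summable (\<lambda>n. cmod (a (n + N)))"
      using abs summable_iff_shift[of "\<lambda>n. cmod (a n)" N] by simp
    have "cmod (suminf (\<lambda>n. if N dvd n + N then a (n + N) else 0)) \<le> suminf (\<lambda>n. cmod (a (n + N)))"
      by (rule norm_suminf_le[OF _ s2]) auto
    then show ?thesis using T by (simp add: sums_iff)
  qed
  have "(\<lambda>N. suminf (\<lambda>n. cmod (a (n + N)))) \<longlonglongrightarrow> 0"
    using abs by (rule suminf_exist_split2)
  then have "(\<lambda>N. root_mean N g - g 0) \<longlonglongrightarrow> 0"
    by (rule Lim_null_comparison[rotated])
      (use bound in \<open>auto simp: eventually_sequentially intro!: exI[of _ 1]\<close>)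
  then show ?thesis by (simp add: LIM_zero_iff)
qed


lemma root_mean_square_le:
  assumes "N > 0"
  shows "(cmod (root_mean N g))\<^sup>2 \<le> (\<Sum>k<N. (cmod (g (cis (2 * pi * real k / real N))))\<^sup>2) / real N"
proof -
  let ?x = "\<lambda>k. cmod (g (cis (2 * pi * real k / real N)))"
  have "cmod (root_mean N g) \<le> (\<Sum>k<N. ?x k) / real N"
    unfolding root_mean_def norm_divide using assms
    by (auto intro!: divide_right_mono norm_sum)
  then have "(cmod (root_mean N g))\<^sup>2 \<le> ((\<Sum>k<N. ?x k) / real N)\<^sup>2"
    by (intro power_mono) auto
  also have "\<dots> = (\<Sum>k<N. ?x k)\<^sup>2 / (real N)\<^sup>2"
    by (simp add: power_divide)
  also have "\<dots> \<le> (real N * (\<Sum>k<N. (?x k)\<^sup>2)) / (real N)\<^sup>2"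
    using sum_squared_le_sum_of_squares[of ?x "{..<N}"] by (intro divide_right_mono) (auto simp: mult.commute)
  also have "\<dots> = (\<Sum>k<N. (?x k)\<^sup>2) / real N"
    using assms by (simp add: power2_eq_square)
  finally show ?thesis .
qed

text \<open>The value \<open>f z\<close> is the limit of the means of \<open>f\<close> over the rotated points \<open>z + \<zeta> v\<close> with \<open>\<zeta>\<close> an
\<open>N\<close>-th root of unity. Integrating the squares over \<open>v\<close>, each rotation preserves Lebesgue measure, so
Fatou's lemma gives the inequality. The scalar multiplication is a parameter because the lemma is
used both on the complex plane and on a complex vector space.\<close>

lemma square_mean_value_inequality:
  fixes f :: "'a::euclidean_space \<Rightarrow> complex" and rot :: "complex \<Rightarrow> 'a \<Rightarrow> 'a"
  assumes rot_meas [measurable]: "\<And>c. cmod c = 1 \<Longrightarrow> rot c \<in> borel_measurable borel"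
    and rot_lborel: "\<And>c. cmod c = 1 \<Longrightarrow> distr lborel borel (rot c) = lborel"
    and norm_rot: "\<And>c v. norm (rot c v) = cmod c * norm v"
    and cont: "continuous_on (ball z r) f"
    and hol: "\<And>v. norm v < r \<Longrightarrow> (\<lambda>t. f (z + rot t v)) holomorphic_on {t. cmod t * norm v < r}"
  shows "ennreal ((cmod (f z))\<^sup>2) * emeasure lborel (ball z r)
    \<le> (\<integral>\<^sup>+x. ennreal ((cmod (f x))\<^sup>2) * indicator (ball z r) x \<partial>lborel)"
proof -
  define F where "F v = ennreal ((cmod (f (z + v)))\<^sup>2) * indicator (ball 0 r) v" for v
  have [measurable]: "(\<lambda>x. f x * indicator (ball z r) x) \<in> borel_measurable borel"
  proof -
    have "(\<lambda>x. indicator (ball z r) x *\<^sub>R f x) \<in> borel_measurable borel"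
      using borel_measurable_continuous_on_indicator[OF _ cont] by simp
    moreover have "(\<lambda>x. indicator (ball z r) x *\<^sub>R f x) = (\<lambda>x. f x * indicator (ball z r) x)"
      by (auto simp: indicator_def)
    ultimately show ?thesis by simp
  qed
  have Feq: "F = (\<lambda>v. ennreal ((cmod (f (z + v) * indicator (ball z r) (z + v)))\<^sup>2))"
    by (auto simp: F_def indicator_def dist_norm)
  have F_meas [measurable]: "F \<in> borel_measurable borel"
    unfolding Feq by measurable
  define G where "G N v = ennreal ((cmod (root_mean N (\<lambda>t. f (z + rot t v))))\<^sup>2) * indicator (ball 0 r) v" for N v
  let ?c = "\<lambda>N k. cis (2 * pi * real k / real N)"
  have rotF: "(\<integral>\<^sup>+v. F (rot c v) \<partial>lborel) = (\<integral>\<^sup>+v. F v \<partial>lborel)" if c: "cmod c = 1" for c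
  proof -
    have "(\<integral>\<^sup>+v. F v \<partial>lborel) = (\<integral>\<^sup>+v. F v \<partial>distr lborel borel (rot c))"
      by (simp add: rot_lborel[OF c])
    also have "\<dots> = (\<integral>\<^sup>+v. F (rot c v) \<partial>lborel)"
      using rot_meas[OF c] by (subst nn_integral_distr) auto
    finally show ?thesis ..
  qed
  define S where "S N v = ennreal (1 / real N) * (\<Sum>k<N. F (rot (?c N k) v))" for N v
  have S_meas [measurable]: "S N \<in> borel_measurable borel" for N
    unfolding S_def by measurable
  have S_int: "(\<integral>\<^sup>+v. S N v \<partial>lborel) = (\<integral>\<^sup>+v. F v \<partial>lborel)" if N: "N > 0" for N
  proof -
    have [measurable]: "(\<lambda>v. F (rot (?c N k) v)) \<in> borel_measurable lborel" for k
      using rot_meas[of "?c N k"] by measurable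
    have "(\<integral>\<^sup>+v. S N v \<partial>lborel) = ennreal (1 / real N) * (\<Sum>k<N. (\<integral>\<^sup>+v. F (rot (?c N k) v) \<partial>lborel))"
      unfolding S_def by (simp add: nn_integral_cmult nn_integral_sum)
    also have "\<dots> = ennreal (1 / real N) * of_nat N * (\<integral>\<^sup>+v. F v \<partial>lborel)"
      by (simp add: rotF mult.assoc)
    also have "ennreal (1 / real N) * of_nat N = 1"
      using N by (simp add: ennreal_of_nat_eq_real_of_nat ennreal_mult[symmetric])
    finally show ?thesis by simp
  qed
  have G_le: "G N v \<le> S N v" if N: "N > 0" for N v
  proof (cases "norm v < r")
    case True
    have "(cmod (root_mean N (\<lambda>t. f (z + rot t v))))\<^sup>2 \<le> (1 / real N) * (\<Sum>k<N. (cmod (f (z + rot (?c N k) v)))\<^sup>2)"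
      using root_mean_square_le[OF N, of "\<lambda>t. f (z + rot t v)"] by simp
    then have "G N v \<le> ennreal ((1 / real N) * (\<Sum>k<N. (cmod (f (z + rot (?c N k) v)))\<^sup>2))"
      using True by (simp add: G_def ennreal_leI)
    also have "\<dots> = S N v"
      using True by (simp add: S_def F_def norm_rot ennreal_mult sum_nonneg del: times_divide_eq_left mult_1_left)
    finally show ?thesis .
  qed (simp add: G_def)
  have lim: "(\<lambda>N. root_mean N (\<lambda>t. f (z + rot t v))) \<longlonglongrightarrow> f z" if v: "norm v < r" for v
  proof -
    have r: "r > 0" using v norm_ge_zero[of v] by linarith
    obtain R where R: "R > 1" "R * norm v < r"
    proof (cases "v = 0")
      case True then show ?thesis using r that[of 2] by simp
    next
      case False
      then have "1 < r / norm v" using v by (simp add: field_simps)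
      then obtain R where "1 < R" "R < r / norm v" using dense by blast
      then show ?thesis using that[of R] False by (simp add: field_simps)
    qed
    have "(\<lambda>t. f (z + rot t v)) holomorphic_on ball 0 R"
    proof (rule holomorphic_on_subset[OF hol[OF v]])
      show "ball 0 R \<subseteq> {t. cmod t * norm v < r}"
        using R by (auto intro: le_less_trans[OF mult_right_mono[OF less_imp_le norm_ge_zero]])
    qed
    from root_mean_tendsto[OF this R(1)]
    have "(\<lambda>N. root_mean N (\<lambda>t. f (z + rot t v))) \<longlonglongrightarrow> f (z + rot 0 v)" by simp
    moreover have "rot 0 v = 0" using norm_rot[of 0 v] by simp
    ultimately show ?thesis by simp
  qed
  have le: "ennreal ((cmod (f z))\<^sup>2) * indicator (ball 0 r) v \<le> liminf (\<lambda>N. S N v)" for v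
  proof -
    have "(\<lambda>N. G N v) \<longlonglongrightarrow> ennreal ((cmod (f z))\<^sup>2) * indicator (ball 0 r) v"
    proof (cases "norm v < r")
      case True
      then show ?thesis unfolding G_def
        using lim[OF True] by (simp add: tendsto_ennrealI tendsto_power tendsto_norm)
    qed (simp add: G_def)
    then have "ennreal ((cmod (f z))\<^sup>2) * indicator (ball 0 r) v = liminf (\<lambda>N. G N v)"
      by (simp add: lim_imp_Liminf)
    also have "\<dots> \<le> liminf (\<lambda>N. S N v)"
      by (intro Liminf_mono) (auto simp: eventually_sequentially intro!: exI[of _ 1] G_le)
    finally show ?thesis .
  qed
  have "ennreal ((cmod (f z))\<^sup>2) * emeasure lborel (ball z r)
      = ennreal ((cmod (f z))\<^sup>2) * emeasure lborel (ball (0::'a) r)"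
  proof (cases "r \<ge> 0")
    case True
    then show ?thesis using emeasure_ball[of r z] emeasure_ball[of r "0::'a"] by simp
  next
    case False
    then have "ball z r = {}" "ball (0::'a) r = {}" by auto
    then show ?thesis by (simp only:)
  qed
  also have "\<dots> = (\<integral>\<^sup>+v. ennreal ((cmod (f z))\<^sup>2) * indicator (ball (0::'a) r) v \<partial>lborel)"
    by (simp add: nn_integral_cmult_indicator)
  also have "\<dots> \<le> (\<integral>\<^sup>+v. liminf (\<lambda>N. S N v) \<partial>lborel)"
    by (intro nn_integral_mono le)
  also have "\<dots> \<le> liminf (\<lambda>N. \<integral>\<^sup>+v. S N v \<partial>lborel)"
    by (intro nn_integral_liminf) measurable
  also have "\<dots> = liminf (\<lambda>N. \<integral>\<^sup>+v. F v \<partial>lborel)"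
    by (intro Liminf_eq) (auto simp: eventually_sequentially intro!: exI[of _ 1] S_int)
  also have "\<dots> = (\<integral>\<^sup>+v. F v \<partial>lborel)"
    by (simp add: Liminf_const)
  also have "\<dots> = (\<integral>\<^sup>+x. F (x - z) \<partial>lborel)"
  proof -
    have "(\<integral>\<^sup>+x. F (x - z) \<partial>lborel) = (\<integral>\<^sup>+x. F (x - z) \<partial>distr lborel borel ((+) z))"
      by (simp add: lborel_distr_plus)
    also have "\<dots> = (\<integral>\<^sup>+x. F x \<partial>lborel)"
      by (subst nn_integral_distr) auto
    finally show ?thesis ..
  qed
  also have "\<dots> = (\<integral>\<^sup>+x. ennreal ((cmod (f x))\<^sup>2) * indicator (ball z r) x \<partial>lborel)"
    by (intro nn_integral_cong) (auto simp: F_def indicator_def dist_norm norm_minus_commute)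
  finally show ?thesis .
qed

section \<open>Holomorphic functions of several variables\<close>

lemma norm_vector_smult: "norm (c *s v) = cmod c * norm (v :: complex^'d)"
proof -
  have "norm (c *s v) = L2_set (\<lambda>i. cmod c * cmod (v $ i)) UNIV"
    by (simp add: norm_vec_def norm_mult)
  also have "\<dots> = cmod c * norm v"
    by (simp add: norm_vec_def L2_set_right_distrib)
  finally show ?thesis .
qed

lemma bounded_linear_smult_left: "bounded_linear (\<lambda>t. t *s (v :: complex^'d))"
  by (rule bounded_linear_intro[where K = "norm v"])
    (simp_all add: vec_eq_iff algebra_simps norm_vector_smult)

lemma bounded_linear_smult_right: "bounded_linear (\<lambda>v. c *s (v :: complex^'d))"
  by (rule bounded_linear_intro[where K = "cmod c"])
    (simp_all add: vec_eq_iff algebra_simps norm_vector_smult)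

lemma continuous_on_smult [continuous_intros]:
  fixes g :: "'a::topological_space \<Rightarrow> complex^'d"
  assumes "continuous_on S f" "continuous_on S g"
  shows "continuous_on S (\<lambda>x. f x *s g x)"
  unfolding vector_scalar_mult_def
  by (intro continuous_on_vec_lambda continuous_on_mult assms continuous_on_component)

lemma holomorphic_severalD:
  assumes "holomorphic_several f D" "z \<in> D"
  shows "(f has_derivative frechet_derivative f (at z)) (at z)"
    and "frechet_derivative f (at z) (c *s v) = c * frechet_derivative f (at z) v"
proof -
  obtain f' where f': "(f has_derivative f') (at z)" "\<And>c v. f' (c *s v) = c * f' v"
    using assms unfolding holomorphic_several_def by blast
  then have "frechet_derivative f (at z) = f'"
    using frechet_derivative_at by metis
  with f' show "(f has_derivative frechet_derivative f (at z)) (at z)"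
    "frechet_derivative f (at z) (c *s v) = c * frechet_derivative f (at z) v"
    by simp_all
qed

lemma holomorphic_severalI:
  assumes "\<And>z. z \<in> D \<Longrightarrow> (f has_derivative f' z) (at z)"
    and "\<And>z c v. z \<in> D \<Longrightarrow> f' z (c *s v) = c * f' z v"
  shows "holomorphic_several f D"
  using assms unfolding holomorphic_several_def by blast

lemma holomorphic_several_subset:
  "holomorphic_several f D \<Longrightarrow> E \<subseteq> D \<Longrightarrow> holomorphic_several f E"
  unfolding holomorphic_several_def by blast

lemma holomorphic_several_continuous_on:
  "holomorphic_several f D \<Longrightarrow> continuous_on D f"
  by (meson continuous_at_imp_continuous_on has_derivative_continuous holomorphic_severalD(1))

lemma holomorphic_several_cong:
  assumes "open D" "\<And>z. z \<in> D \<Longrightarrow> f z = g z"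
  shows "holomorphic_several f D \<longleftrightarrow> holomorphic_several g D"
  using assms unfolding holomorphic_several_def
  by (metis (no_types, lifting) has_derivative_transform_within_open)

lemma holomorphic_several_const: "holomorphic_several (\<lambda>_. c) D"
  by (rule holomorphic_severalI[where f' = "\<lambda>_ _. 0"]) auto

lemma holomorphic_several_add:
  assumes "holomorphic_several f D" "holomorphic_several g D"
  shows "holomorphic_several (\<lambda>z. f z + g z) D"
  using holomorphic_severalD[OF assms(1)] holomorphic_severalD[OF assms(2)]
  by (intro holomorphic_severalI[where f' = "\<lambda>z v. frechet_derivative f (at z) v + frechet_derivative g (at z) v"]
    has_derivative_add) (auto simp: algebra_simps)

lemma holomorphic_several_mult:
  assumes "holomorphic_several f D" "holomorphic_several g D"
  shows "holomorphic_several (\<lambda>z. f z * g z) D"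
  using holomorphic_severalD[OF assms(1)] holomorphic_severalD[OF assms(2)]
  by (intro holomorphic_severalI[where f' = "\<lambda>z v. f z * frechet_derivative g (at z) v + frechet_derivative f (at z) v * g z"]
    has_derivative_mult) (auto simp: algebra_simps)

lemma holomorphic_several_cmult:
  "holomorphic_several f D \<Longrightarrow> holomorphic_several (\<lambda>z. c * f z) D"
  by (intro holomorphic_several_mult holomorphic_several_const)

lemma holomorphic_several_diff:
  assumes "holomorphic_several f D" "holomorphic_several g D"
  shows "holomorphic_several (\<lambda>z. f z - g z) D"
  using holomorphic_several_add[OF assms(1) holomorphic_several_cmult[OF assms(2), of "-1"]] by simp

lemma holomorphic_several_sum:
  "(\<And>i. i \<in> I \<Longrightarrow> holomorphic_several (f i) D) \<Longrightarrow> holomorphic_several (\<lambda>z. \<Sum>i\<in>I. f i z) D"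
  by (induction I rule: infinite_finite_induct)
    (auto intro: holomorphic_several_const holomorphic_several_add)

lemma holomorphic_several_compose:
  assumes f: "holomorphic_several f E"
    and g: "\<And>z. z \<in> D \<Longrightarrow> (g has_derivative g' z) (at z)"
    and g': "\<And>z c v. z \<in> D \<Longrightarrow> g' z (c *s v) = c *s g' z v"
    and sub: "g ` D \<subseteq> E"
  shows "holomorphic_several (\<lambda>z. f (g z)) D"
proof (rule holomorphic_severalI[where f' = "\<lambda>z v. frechet_derivative f (at (g z)) (g' z v)"])
  fix z assume z: "z \<in> D"
  then have gz: "g z \<in> E" using sub by blast
  show "((\<lambda>z. f (g z)) has_derivative (\<lambda>v. frechet_derivative f (at (g z)) (g' z v))) (at z)"
    using has_derivative_compose[OF g[OF z] holomorphic_severalD(1)[OF f gz]] .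
  show "frechet_derivative f (at (g z)) (g' z (c *s v)) = c * frechet_derivative f (at (g z)) (g' z v)" for c v
    by (simp add: g'[OF z] holomorphic_severalD(2)[OF f gz])
qed

lemma holomorphic_several_divide:
  assumes f: "holomorphic_several f D" and g: "holomorphic_several g D"
    and nz: "\<And>z. z \<in> D \<Longrightarrow> g z \<noteq> 0"
  shows "holomorphic_several (\<lambda>z. f z / g z) D"
proof -
  have "holomorphic_several (\<lambda>z. inverse (g z)) D"
  proof (rule holomorphic_severalI[where f' = "\<lambda>z v. - (inverse (g z) * frechet_derivative g (at z) v * inverse (g z))"])
    fix z assume z: "z \<in> D"
    show "((\<lambda>z. inverse (g z)) has_derivative
      (\<lambda>v. - (inverse (g z) * frechet_derivative g (at z) v * inverse (g z)))) (at z)"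
      using Deriv.has_derivative_inverse[OF nz[OF z] holomorphic_severalD(1)[OF g z]] .
  qed (simp add: holomorphic_severalD(2)[OF g])
  from holomorphic_several_mult[OF f this] show ?thesis by (simp add: divide_inverse)
qed

lemma has_field_derivative_on_line:
  assumes f: "holomorphic_several f D" and z: "z + t *s v \<in> D"
  shows "((\<lambda>t. f (z + t *s v)) has_field_derivative frechet_derivative f (at (z + t *s v)) v) (at t)"
proof -
  have "((\<lambda>t. z + t *s v) has_derivative (\<lambda>t. t *s v)) (at t)"
    by (auto intro!: derivative_eq_intros bounded_linear_imp_has_derivative bounded_linear_smult_left)
  from has_derivative_compose[OF this holomorphic_severalD(1)[OF f z]]
  show ?thesis
    by (simp add: has_field_derivative_def holomorphic_severalD(2)[OF f z] mult_commute_abs)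
qed

lemma holomorphic_on_line:
  assumes "holomorphic_several f D"
  shows "(\<lambda>t. f (z + t *s v)) holomorphic_on {t. z + t *s v \<in> D}"
  unfolding holomorphic_on_def field_differentiable_def
  using has_field_derivative_at_within[OF has_field_derivative_on_line[OF assms]] by blast

text \<open>The one-variable Cauchy estimate on the complex line through \<open>z\<close> in direction \<open>v\<close>.\<close>

lemma derivative_Cauchy_estimate:
  assumes f: "holomorphic_several f D" and r: "r > 0" and sub: "cball z r \<subseteq> D"
    and M: "\<And>x. x \<in> cball z r \<Longrightarrow> cmod (f x) \<le> M"
  shows "cmod (frechet_derivative f (at z) v) \<le> M / r * norm v"
proof (cases "v = 0")
  case True
  have "z \<in> D" using sub r by force
  then show ?thesis using holomorphic_severalD[OF f, of z] True
    by (auto dest!: has_derivative_bounded_linear simp: linear_simps)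
next
  case False
  let ?g = "\<lambda>t. f (z + t *s v)" and ?r = "r / norm v"
  have r': "?r > 0" using r False by simp
  have in_ball: "z + t *s v \<in> cball z r" if "cmod t \<le> ?r" for t
    using that False by (simp add: dist_norm norm_vector_smult field_simps)
  have hol: "?g holomorphic_on cball 0 ?r"
    using holomorphic_on_line[OF f, of z v] by (rule holomorphic_on_subset) (use in_ball sub in force)
  have "norm ((deriv ^^ 1) ?g 0) \<le> fact 1 * M / ?r ^ 1"
  proof (rule Cauchy_inequality)
    show "?g holomorphic_on ball 0 ?r" using hol by (rule holomorphic_on_subset) auto
    show "continuous_on (cball 0 ?r) ?g" using hol by (rule holomorphic_on_imp_continuous_on)
  qed (use r' in_ball M in auto)
  moreover have "deriv ?g 0 = frechet_derivative f (at z) v"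
  proof -
    have "z \<in> D" using sub r by force
    then show ?thesis using has_field_derivative_on_line[OF f, of z 0 v] by (simp add: DERIV_imp_deriv)
  qed
  ultimately show ?thesis by simp
qed

text \<open>By the Cauchy estimate the derivatives converge uniformly on a smaller ball, and the limit of the
derivatives is the derivative of the limit.\<close>

lemma holomorphic_several_uniform_limit:
  fixes f :: "nat \<Rightarrow> complex^'d \<Rightarrow> complex"
  assumes hol: "\<And>n. holomorphic_several (f n) D"
    and lim: "\<And>z. z \<in> D \<Longrightarrow> \<exists>r>0. cball z r \<subseteq> D \<and> uniform_limit (cball z r) f g sequentially"
  shows "holomorphic_several g D"
  unfolding holomorphic_several_def
proof
  fix z assume z: "z \<in> D"
  obtain r where r: "r > 0" "cball z r \<subseteq> D" and unif: "uniform_limit (cball z r) f g sequentially"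
    using lim[OF z] by blast
  let ?f' = "\<lambda>n x. frechet_derivative (f n) (at x)"
  define S where "S = ball z (r/2)"
  have SD: "x \<in> D" "cball x (r/2) \<subseteq> cball z r" if "x \<in> S" for x
  proof -
    show "cball x (r/2) \<subseteq> cball z r"
    proof
      fix y assume "y \<in> cball x (r/2)"
      with that show "y \<in> cball z r" using dist_triangle[of z y x] by (simp add: S_def)
    qed
    then show "x \<in> D" using r by force
  qed
  have cauchy: "\<exists>N. \<forall>n\<ge>N. \<forall>m\<ge>N. \<forall>x\<in>S. \<forall>v. cmod (?f' n x v - ?f' m x v) \<le> e * norm v" if e: "e > 0" for e
  proof -
    have "e * r / 4 > 0" using e r by simp
    from uniform_limitD[OF unif this]
    obtain N where N: "\<And>n x. n \<ge> N \<Longrightarrow> x \<in> cball z r \<Longrightarrow> dist (f n x) (g x) < e * r / 4"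
      unfolding eventually_sequentially by blast
    have "cmod (?f' n x v - ?f' m x v) \<le> e * norm v" if nm: "n \<ge> N" "m \<ge> N" and x: "x \<in> S" for n m x v
    proof -
      have h: "holomorphic_several (\<lambda>x. f n x - f m x) D"
        by (intro holomorphic_several_diff hol)
      have "cmod (f n y - f m y) \<le> e * r / 2" if "y \<in> cball x (r/2)" for y
      proof -
        have "y \<in> cball z r" using that SD[OF x] by blast
        then show ?thesis
          using N[OF nm(1)] N[OF nm(2)] dist_triangle2[of "f n y" "f m y" "g y"]
          by (fastforce simp: dist_norm)
      qed
      from derivative_Cauchy_estimate[OF h _ _ this, where v = v] SD[OF x] r
      have "cmod (frechet_derivative (\<lambda>x. f n x - f m x) (at x) v) \<le> e * r / 2 / (r / 2) * norm v"
        by (meson half_gt_zero order_trans)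
      then have "cmod (frechet_derivative (\<lambda>x. f n x - f m x) (at x) v) \<le> e * norm v"
        using r by simp
      moreover have "frechet_derivative (\<lambda>x. f n x - f m x) (at x) = (\<lambda>v. ?f' n x v - ?f' m x v)"
        by (rule sym, rule frechet_derivative_at, intro has_derivative_diff holomorphic_severalD(1)[OF hol] SD(1)[OF x])
      ultimately show ?thesis by simp
    qed
    then show ?thesis by blast
  qed
  have conv: "convergent (\<lambda>n. ?f' n x v)" if x: "x \<in> S" for x and v :: "complex^'d"
  proof (rule Cauchy_convergent, rule metric_CauchyI)
    fix e :: real assume e: "e > 0"
    define e' where "e' = e / (norm v + 1)"
    have e': "e' > 0" "e' * norm v < e"
    proof -
      have p: "norm v + 1 > 0" using norm_ge_zero[of v] by linarith
      show "e' > 0" using e p by (simp add: e'_def)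
      have "e * norm v < e * (norm v + 1)" using e by simp
      then show "e' * norm v < e" using p by (simp add: e'_def field_simps)
    qed
    show "\<exists>N. \<forall>m\<ge>N. \<forall>n\<ge>N. dist (?f' m x v) (?f' n x v) < e"
      using cauchy[OF e'(1)] x e'(2) unfolding dist_norm by (meson le_less_trans)
  qed
  define g' where "g' x v = lim (\<lambda>n. ?f' n x v)" for x v
  have g': "(\<lambda>n. ?f' n x v) \<longlonglongrightarrow> g' x v" if "x \<in> S" for x v
    using conv[OF that] unfolding g'_def convergent_LIMSEQ_iff .
  have zS: "z \<in> S" using r by (simp add: S_def)
  have glim: "(\<lambda>n. f n x) \<longlonglongrightarrow> g x" if "x \<in> S" for x
    using tendsto_uniform_limitI[OF unif] that SD(2)[OF that] r by force
  have "\<exists>h. \<forall>x\<in>S. (\<lambda>n. f n x) \<longlonglongrightarrow> h x \<and> (h has_derivative g' x) (at x within S)"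
  proof (rule has_derivative_sequence[where f = f and f' = ?f' and l = "g z" and ?x0.0 = z])
    show "convex S" by (simp add: S_def)
    show "z \<in> S" "(\<lambda>n. f n z) \<longlonglongrightarrow> g z" using zS glim by auto
    show "(f n has_derivative ?f' n x) (at x within S)" if "x \<in> S" for n x
      using holomorphic_severalD(1)[OF hol SD(1)[OF that]] by (rule has_derivative_at_withinI)
    show "\<forall>\<^sub>F n in sequentially. \<forall>x\<in>S. \<forall>v. cmod (?f' n x v - g' x v) \<le> e * norm v" if e0: "e > 0" for e
    proof -
      obtain N where N: "\<forall>n\<ge>N. \<forall>m\<ge>N. \<forall>x\<in>S. \<forall>v. cmod (?f' n x v - ?f' m x v) \<le> e * norm v"
        using cauchy[OF e0] by blast
      have "cmod (?f' n x v - g' x v) \<le> e * norm v" if "n \<ge> N" "x \<in> S" for n x v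
        by (rule tendsto_upperbound[where F = sequentially and f = "\<lambda>m. cmod (?f' n x v - ?f' m x v)"])
          (use that N in \<open>auto intro!: tendsto_intros g' exI[of _ N] simp: eventually_sequentially\<close>)
      then show ?thesis unfolding eventually_sequentially by blast
    qed
  qed
  then obtain h where h: "\<And>x. x \<in> S \<Longrightarrow> (\<lambda>n. f n x) \<longlonglongrightarrow> h x" "\<And>x. x \<in> S \<Longrightarrow> (h has_derivative g' x) (at x within S)"
    by blast
  have eq: "h x = g x" if "x \<in> S" for x
    using LIMSEQ_unique[OF h(1) glim] that by blast
  have "(h has_derivative g' z) (at z)"
    using h(2)[OF zS] at_within_open[OF zS] by (simp add: S_def)
  then have "(g has_derivative g' z) (at z)"
    by (rule has_derivative_transform_within_open[of _ _ _ _ S]) (use zS eq in \<open>auto simp: S_def\<close>)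
  moreover have "g' z (c *s v) = c * g' z v" for c v
  proof (rule LIMSEQ_unique)
    show "(\<lambda>n. ?f' n z (c *s v)) \<longlonglongrightarrow> g' z (c *s v)" by (rule g'[OF zS])
    show "(\<lambda>n. ?f' n z (c *s v)) \<longlonglongrightarrow> c * g' z v"
      unfolding holomorphic_severalD(2)[OF hol z] by (intro tendsto_intros g'[OF zS])
  qed
  ultimately show "\<exists>f'. (g has_derivative f') (at z) \<and> (\<forall>c v. f' (c *s v) = c * f' v)"
    by blast
qed

section \<open>Change of variables in Euclidean spaces\<close>

text \<open>A bijection \<open>b\<close> from a finite type onto the standard basis of a Euclidean space gives a measure
preserving isometry with \<open>real^'n\<close>. Through it the change of variables theorem for \<open>real^'n\<close>, where
determinants of matrices are available, is transported to other Euclidean spaces.\<close>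

definition real_coords :: "('n::finite \<Rightarrow> 'a::euclidean_space) \<Rightarrow> 'a \<Rightarrow> real^'n" where
  "real_coords b x = (\<chi> k. x \<bullet> b k)"

definition from_real_coords :: "('n::finite \<Rightarrow> 'a::euclidean_space) \<Rightarrow> real^'n \<Rightarrow> 'a" where
  "from_real_coords b y = (\<Sum>k\<in>UNIV. (y $ k) *\<^sub>R b k)"

context
  fixes b :: "'n::finite \<Rightarrow> 'a::euclidean_space"
  assumes b: "bij_betw b UNIV Basis"
begin

lemma b_Basis: "b k \<in> Basis"
  using b by (auto simp: bij_betw_def)

lemma from_real_coords_real_coords: "from_real_coords b (real_coords b x) = x"
proof -
  have "from_real_coords b (real_coords b x) = (\<Sum>i\<in>Basis. (x \<bullet> i) *\<^sub>R i)"
    unfolding from_real_coords_def real_coords_def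
    by (simp add: sum.reindex_bij_betw[OF b, of "\<lambda>i. (x \<bullet> i) *\<^sub>R i"])
  then show ?thesis by (simp add: euclidean_representation)
qed

lemma real_coords_from_real_coords: "real_coords b (from_real_coords b y) = y"
proof -
  have "b k \<bullet> b l = (if k = l then 1 else 0)" for k l
    using b by (auto simp: inner_Basis b_Basis bij_betw_def dest: injD)
  then have "(\<Sum>k\<in>UNIV. y $ k * (b k \<bullet> b l)) = (\<Sum>k\<in>UNIV. if k = l then y $ k else 0)" for l
    by (intro sum.cong) auto
  then show ?thesis
    by (simp add: vec_eq_iff from_real_coords_def real_coords_def inner_sum_left)
qed

lemma linear_real_coords: "linear (real_coords b)"
  by (rule linearI) (simp_all add: real_coords_def vec_eq_iff inner_simps)

lemma linear_from_real_coords: "linear (from_real_coords b)"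
  by (rule linearI) (simp_all add: from_real_coords_def algebra_simps sum.distrib scaleR_sum_right)

lemma norm_real_coords: "norm (real_coords b x) = norm x"
proof -
  have "(norm (real_coords b x))\<^sup>2 = (\<Sum>k\<in>UNIV. (x \<bullet> b k)\<^sup>2)"
    by (simp add: norm_vec_def L2_set_def real_coords_def sum_nonneg)
  also have "\<dots> = (\<Sum>i\<in>Basis. (x \<bullet> i)\<^sup>2)"
    by (rule sum.reindex_bij_betw[OF b, of "\<lambda>i. (x \<bullet> i)\<^sup>2"])
  also have "\<dots> = (norm x)\<^sup>2"
    by (simp add: norm_eq_sqrt_inner euclidean_inner[of x x] power2_eq_square sum_nonneg)
  finally show ?thesis by simp
qed

lemma inj_real_coords: "inj (real_coords b)"
  by (metis from_real_coords_real_coords injI)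

lemma distr_real_coords: "distr lborel borel (from_real_coords b) = (lborel :: 'a measure)"
proof (rule lborel_eqI[symmetric])
  fix l u :: 'a assume le: "\<And>i. i \<in> Basis \<Longrightarrow> l \<bullet> i \<le> u \<bullet> i"
  have [measurable]: "from_real_coords b \<in> borel_measurable borel"
    by (intro borel_measurable_continuous_onI linear_continuous_on linear_conv_bounded_linear[THEN iffD1] linear_from_real_coords)
  have [simp]: "from_real_coords b y \<bullet> b k = y $ k" for y k
    using real_coords_from_real_coords[of y] by (simp add: real_coords_def vec_eq_iff)
  have "from_real_coords b -` box l u = box (real_coords b l) (real_coords b u)"
  proof -
    have "x \<in> box l u \<longleftrightarrow> (\<forall>k. l \<bullet> b k < x \<bullet> b k \<and> x \<bullet> b k < u \<bullet> b k)" for x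
      using b unfolding mem_box bij_betw_def by (metis UNIV_I imageE b_Basis)
    then show ?thesis
      by (auto simp: mem_box_cart real_coords_def)
  qed
  then have "emeasure (distr lborel borel (from_real_coords b)) (box l u)
      = emeasure lborel (box (real_coords b l) (real_coords b u))"
    by (simp add: emeasure_distr)
  also have "\<dots> = (\<Prod>i\<in>Basis. (real_coords b u - real_coords b l) \<bullet> i)"
    by (rule emeasure_lborel_box) (use le b_Basis in \<open>auto simp: Basis_vec_def inner_axis real_coords_def\<close>)
  also have "\<dots> = (\<Prod>k\<in>UNIV. (u - l) \<bullet> b k)"
    by (simp add: Basis_vec_def prod.UNION_disjoint axis_eq_axis inner_axis real_coords_def inner_diff_left)
  also have "\<dots> = (\<Prod>i\<in>Basis. (u - l) \<bullet> i)"
    by (simp add: prod.reindex_bij_betw[OF b, of "\<lambda>i. (u - l) \<bullet> i"])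
  finally show "emeasure (distr lborel borel (from_real_coords b)) (box l u) = (\<Prod>i\<in>Basis. (u - l) \<bullet> i)" .
qed simp

lemma from_real_coords_measurable: "from_real_coords b \<in> borel_measurable borel"
  and real_coords_measurable: "real_coords b \<in> borel_measurable borel"
  by (intro borel_measurable_continuous_onI linear_continuous_on
      linear_conv_bounded_linear[THEN iffD1] linear_from_real_coords linear_real_coords)+

lemma emeasure_real_coords_image:
  assumes "S \<in> sets borel"
  shows "real_coords b ` S \<in> sets borel" "emeasure lborel (real_coords b ` S) = emeasure lborel S"
proof -
  have eq: "real_coords b ` S = from_real_coords b -` S"
    using from_real_coords_real_coords real_coords_from_real_coords
    by (auto simp: image_iff) metis
  show "real_coords b ` S \<in> sets borel"
    unfolding eq using measurable_sets[OF from_real_coords_measurable assms] by simp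
  have "emeasure lborel S = emeasure (distr lborel borel (from_real_coords b)) S"
    by (simp add: distr_real_coords)
  also have "\<dots> = emeasure lborel (real_coords b ` S)"
    using assms from_real_coords_measurable by (simp add: emeasure_distr eq)
  finally show "emeasure lborel (real_coords b ` S) = emeasure lborel S" ..
qed

end


text \<open>This version of the change of variables formula also covers sets of infinite measure, where both
sides are infinite.\<close>

lemma emeasure_differentiable_image_vec:
  fixes f :: "real^'n::{finite,wellorder} \<Rightarrow> real^'n::_"
  assumes S: "S \<in> sets lebesgue"
    and der: "\<And>x. x \<in> S \<Longrightarrow> (f has_derivative f' x) (at x within S)"
    and inj: "inj_on f S"
  shows "f ` S \<in> sets lebesgue"
    and "emeasure lebesgue (f ` S) = (\<integral>\<^sup>+x. ennreal (indicator S x * \<bar>det (matrix (f' x))\<bar>) \<partial>lebesgue)"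
proof -
  have "f differentiable_on S"
    using der unfolding differentiable_on_def differentiable_def by blast
  then show fS: "f ` S \<in> sets lebesgue"
    by (intro differentiable_image_in_sets_lebesgue S) auto
  define g where "g x = indicator S x * \<bar>det (matrix (f' x))\<bar>" for x
  have g0: "0 \<le> g x" for x by (simp add: g_def)
  have "(\<lambda>x. \<bar>det (matrix (f' x))\<bar>) \<in> borel_measurable (lebesgue_on S)"
    using borel_measurable_det_Jacobian[OF S der] by measurable
  then have g_meas: "g \<in> borel_measurable lebesgue"
    using S by (subst (asm) borel_measurable_restrict_space_iff) (auto simp: g_def[abs_def])
  have g_int: "(g has_integral r) UNIV \<longleftrightarrow> ((\<lambda>x. \<bar>det (matrix (f' x))\<bar>) has_integral r) S" for r
  proof -
    have "g = (\<lambda>x. if x \<in> S then \<bar>det (matrix (f' x))\<bar> else 0)"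
      by (auto simp: g_def)
    then show ?thesis by (simp add: has_integral_restrict_UNIV)
  qed
  have "emeasure lebesgue (f ` S) = integral\<^sup>N lebesgue g"
  proof (cases "integral\<^sup>N lebesgue g = \<infinity>")
    case False
    then obtain r where r: "0 \<le> r" "integral\<^sup>N lebesgue g = ennreal r"
      by (metis ennreal_cases infinity_ennreal_def)
    then have "(g has_integral r) UNIV"
      using g_meas has_integral_iff_nn_integral_lebesgue[of g r] g0 by auto
    then have "f ` S \<in> lmeasurable \<and> measure lebesgue (f ` S) = r"
      using has_measure_differentiable_image[OF S der inj] g_int by blast
    then show ?thesis using r by (auto simp: emeasure_eq_measure2)
  next
    case True
    have "emeasure lebesgue (f ` S) = \<infinity>"
    proof (rule ccontr)
      assume "emeasure lebesgue (f ` S) \<noteq> \<infinity>"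
      then have "f ` S \<in> lmeasurable" using fS by (simp add: fmeasurable_def less_top)
      then have "(g has_integral measure lebesgue (f ` S)) UNIV"
        using has_measure_differentiable_image[OF S der inj] g_int by blast
      then show False
        using True has_integral_iff_nn_integral_lebesgue[of g "measure lebesgue (f ` S)"] g0 by auto
    qed
    with True show ?thesis by simp
  qed
  then show "emeasure lebesgue (f ` S) = (\<integral>\<^sup>+x. ennreal (indicator S x * \<bar>det (matrix (f' x))\<bar>) \<partial>lebesgue)"
    by (simp add: g_def)
qed

text \<open>For linear \<open>f\<close> this is the modulus of its determinant, computed in the coordinates given by \<open>b\<close>.\<close>

definition volume_factor :: "('n::finite \<Rightarrow> 'a::euclidean_space) \<Rightarrow> ('a \<Rightarrow> 'a) \<Rightarrow> real" where
  "volume_factor b f = \<bar>det (matrix (real_coords b \<circ> f \<circ> from_real_coords b))\<bar>"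

lemma emeasure_differentiable_image:
  fixes f :: "'a::euclidean_space \<Rightarrow> 'a" and b :: "'n::{finite,wellorder} \<Rightarrow> 'a"
  assumes b: "bij_betw b UNIV Basis" and S: "S \<in> sets borel"
    and der: "\<And>x. x \<in> S \<Longrightarrow> (f has_derivative f' x) (at x within S)"
    and inj: "inj_on f S"
    and J: "J \<in> borel_measurable borel" "\<And>x. x \<in> S \<Longrightarrow> volume_factor b (f' x) = J x"
  shows "f ` S \<in> sets lebesgue"
    and "emeasure lebesgue (f ` S) = (\<integral>\<^sup>+x. ennreal (indicator S x * J x) \<partial>lborel)"
proof -
  let ?T = "real_coords b" and ?R = "from_real_coords b"
  note TR [simp] = real_coords_from_real_coords[OF b] from_real_coords_real_coords[OF b]
  note T_meas [measurable] = real_coords_measurable[OF b]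
  note R_meas [measurable] = from_real_coords_measurable[OF b]
  have diff: "f differentiable_on S"
    using der unfolding differentiable_on_def differentiable_def by blast
  then show fS: "f ` S \<in> sets lebesgue"
    using S by (intro differentiable_image_in_sets_lebesgue) auto
  define g where "g = ?T \<circ> f \<circ> ?R"
  define g' where "g' y = ?T \<circ> f' (?R y) \<circ> ?R" for y
  have TS: "?T ` S \<in> sets borel" using emeasure_real_coords_image[OF b S] by simp
  have dT: "(?T has_derivative ?T) F" and dR: "(?R has_derivative ?R) F'" for F F'
    using linear_real_coords[OF b] linear_from_real_coords[OF b]
    by (simp_all add: linear_conv_bounded_linear bounded_linear_imp_has_derivative)
  have RTS: "?R ` (?T ` S) = S" by (simp add: image_image)
  have gder: "(g has_derivative g' y) (at y within ?T ` S)" if "y \<in> ?T ` S" for y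
  proof -
    have "?R y \<in> S" using that by auto
    then have "(f has_derivative f' (?R y)) (at (?R y) within ?R ` (?T ` S))"
      using der RTS by simp
    from diff_chain_within[OF dR this] show ?thesis
      unfolding g_def g'_def comp_assoc by (rule diff_chain_within[OF _ dT])
  qed
  have ginj: "inj_on g (?T ` S)"
    using inj inj_real_coords[OF b] by (auto simp: inj_on_def g_def)
  have gim: "g ` (?T ` S) = ?T ` (f ` S)"
    by (simp add: g_def image_image)
  have "emeasure lebesgue (?T ` (f ` S)) =
      (\<integral>\<^sup>+y. ennreal (indicator (?T ` S) y * \<bar>det (matrix (g' y))\<bar>) \<partial>lebesgue)"
    unfolding gim[symmetric] using TS gder ginj by (intro emeasure_differentiable_image_vec) auto
  also have "\<dots> = (\<integral>\<^sup>+y. ennreal (indicator S (?R y) * J (?R y)) \<partial>lebesgue)"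
  proof (intro nn_integral_cong)
    fix y
    have "y \<in> ?T ` S \<longleftrightarrow> ?R y \<in> S" using TR by (metis image_iff)
    then show "ennreal (indicator (?T ` S) y * \<bar>det (matrix (g' y))\<bar>) = ennreal (indicator S (?R y) * J (?R y))"
      using J(2)[of "?R y"] by (auto simp: g'_def volume_factor_def indicator_def)
  qed
  also have "\<dots> = (\<integral>\<^sup>+y. ennreal (indicator S (?R y) * J (?R y)) \<partial>lborel)"
    by (simp add: nn_integral_completion)
  also have "\<dots> = (\<integral>\<^sup>+x. ennreal (indicator S x * J x) \<partial>distr lborel borel ?R)"
    using S J(1) by (subst nn_integral_distr) auto
  also have "\<dots> = (\<integral>\<^sup>+x. ennreal (indicator S x * J x) \<partial>lborel)"
    by (simp add: distr_real_coords[OF b])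
  finally have *: "emeasure lebesgue (?T ` (f ` S)) = (\<integral>\<^sup>+x. ennreal (indicator S x * J x) \<partial>lborel)" .
  obtain B N where BN: "B \<in> sets borel" "negligible N" "B \<union> N = f ` S"
    using sets_lebesgue_almost_borel[OF fS] .
  have Bs: "emeasure lebesgue (f ` S) = emeasure lebesgue B"
    using BN emeasure_Un_null_set[of B lebesgue N] by (auto simp: negligible_iff_null_sets)
  have "?T differentiable_on N"
    using dT unfolding differentiable_on_def differentiable_def by blast
  then have "negligible (?T ` N)"
  proof (rule negligible_differentiable_image_negligible[rotated 2])
    have "DIM('a) = CARD('n)" using bij_betw_same_card[OF b] by simp
    then show "DIM('a) \<le> DIM((real, 'n) vec)" by simp
  qed (rule BN)
  then have "emeasure lebesgue (?T ` (f ` S)) = emeasure lebesgue (?T ` B)"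
    using BN(1) emeasure_real_coords_image[OF b BN(1)] emeasure_Un_null_set[of "?T ` B" lebesgue "?T ` N"]
    by (auto simp: negligible_iff_null_sets BN(3)[symmetric] image_Un)
  then show "emeasure lebesgue (f ` S) = (\<integral>\<^sup>+x. ennreal (indicator S x * J x) \<partial>lborel)"
    using * Bs BN(1) emeasure_real_coords_image[OF b BN(1)] by simp
qed

lemma volume_factor_compose:
  assumes b: "bij_betw b UNIV Basis" and "linear f" "linear g"
  shows "volume_factor b (f \<circ> g) = volume_factor b f * volume_factor b g"
proof -
  have "real_coords b \<circ> (f \<circ> g) \<circ> from_real_coords b =
    (real_coords b \<circ> f \<circ> from_real_coords b) \<circ> (real_coords b \<circ> g \<circ> from_real_coords b)"
    by (simp add: fun_eq_iff from_real_coords_real_coords[OF b])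
  then show ?thesis
    unfolding volume_factor_def
    by (simp add: matrix_compose linear_compose linear_real_coords[OF b] linear_from_real_coords[OF b] assms det_mul abs_mult)
qed

lemma volume_factor_isometry:
  assumes b: "bij_betw b UNIV Basis" and "linear f" "\<And>x. norm (f x) = norm x"
  shows "volume_factor b f = 1"
proof -
  have "norm (from_real_coords b y) = norm y" for y
    by (metis norm_real_coords[OF b] real_coords_from_real_coords[OF b])
  then have "orthogonal_transformation (real_coords b \<circ> f \<circ> from_real_coords b)"
    unfolding orthogonal_transformation
    using assms by (auto simp: norm_real_coords[OF b] intro!: linear_compose linear_real_coords[OF b] linear_from_real_coords[OF b])
  then show ?thesis unfolding volume_factor_def by simp
qed

lemma distr_lborel_isometry:
  fixes f :: "'a::euclidean_space \<Rightarrow> 'a" and b :: "'n::{finite,wellorder} \<Rightarrow> 'a"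
  assumes b: "bij_betw b UNIV Basis" and lin: "linear f" and iso: "\<And>x. norm (f x) = norm x"
  shows "distr lborel borel f = lborel"
proof (rule measure_eqI)
  fix X assume "X \<in> sets (distr lborel borel f)"
  then have X: "X \<in> sets borel" by simp
  have fm [measurable]: "f \<in> borel_measurable borel"
    by (intro borel_measurable_continuous_onI linear_continuous_on linear_conv_bounded_linear[THEN iffD1] lin)
  have of_: "orthogonal_transformation f"
    using lin iso by (simp add: orthogonal_transformation)
  have bijf: "bij f" by (rule orthogonal_transformation_bij[OF of_])
  let ?S = "f -` X"
  have S: "?S \<in> sets borel" using measurable_sets[OF fm X] by simp
  have "emeasure lebesgue (f ` ?S) = (\<integral>\<^sup>+x. ennreal (indicator ?S x * 1) \<partial>lborel)"
  proof (rule emeasure_differentiable_image[OF b S, where f' = "\<lambda>_. f"])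
    show "(f has_derivative f) (at x within ?S)" for x
      by (rule linear_imp_has_derivative[OF lin])
    show "inj_on f ?S" using bijf by (meson bij_def inj_on_subset subset_UNIV)
  qed (auto simp: volume_factor_isometry[OF b lin iso])
  also have "\<dots> = emeasure lborel ?S"
    using S by (simp add: ennreal_indicator)
  also have "f ` ?S = X" using bijf by (simp add: bij_def surj_image_vimage_eq)
  finally show "emeasure (distr lborel borel f) X = emeasure lborel X"
    using X by (simp add: emeasure_distr)
qed simp

section \<open>Volumes under complex matrices\<close>

text \<open>The type \<open>'d bit0\<close> has twice as many elements as \<open>'d\<close> and carries a well-order; this makes it an
index type for the real coordinates of \<open>complex^'d\<close>.\<close>

lemma ex_bij_betw_complex_vec_Basis:
  "\<exists>b :: 'd::finite bit0 \<Rightarrow> complex^'d. bij_betw b UNIV Basis"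
  by (rule finite_same_card_bij) auto

lemma ex_bij_betw_complex_Basis: "\<exists>b :: 2 \<Rightarrow> complex. bij_betw b UNIV Basis"
  by (rule finite_same_card_bij) (auto simp: Basis_complex_def)

text \<open>The identity matrix with its column \<open>k\<close> replaced by \<open>a\<close>. Together with the transpositions the
invertible ones among these matrices generate the general linear group.\<close>

definition column_matrix :: "'d \<Rightarrow> complex^'d \<Rightarrow> complex^'d^'d" where
  "column_matrix k a = (\<chi> i j. if j = k then a $ i else mat 1 $ i $ j)"

lemma det_column_matrix: "det (column_matrix k a) = a $ k"
  using cramer_lemma[where A = "mat 1" and k = k and x = a] by (simp add: column_matrix_def cong: if_cong)

lemma column_matrix_mult_component:
  "(column_matrix k a *v x) $ i = (if i = k then a $ k * x $ k else x $ i + a $ i * x $ k)"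
proof -
  have "(column_matrix k a *v x) $ i = (\<Sum>j\<in>UNIV. (if j = k then a $ i else if i = j then 1 else 0) * x $ j)"
    by (auto simp: matrix_vector_mult_def column_matrix_def mat_def intro!: sum.cong)
  also have "\<dots> = a $ i * x $ k + (\<Sum>j\<in>UNIV - {k}. (if i = j then 1 else 0) * x $ j)"
    by (subst sum.remove[of _ k]) (auto intro!: sum.cong)
  also have "(\<Sum>j\<in>UNIV - {k}. (if i = j then 1 else 0) * x $ j) = (if i = k then 0 else x $ i)"
    by (simp add: if_distrib[of "\<lambda>c. c * _"] cong: if_cong)
  finally show ?thesis by simp
qed

definition swap_matrix :: "'d \<Rightarrow> 'd \<Rightarrow> complex^'d^'d" where
  "swap_matrix m k = (\<chi> i j. if j = Transposition.transpose m k i then 1 else 0)"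

lemma swap_matrix_mult_component: "(swap_matrix m k *v x) $ i = x $ (Transposition.transpose m k i)"
  by (simp add: matrix_vector_mult_def swap_matrix_def if_distrib[of "\<lambda>c. c * _"] cong: if_cong)

lemma det_swap_matrix_square: "(cmod (det (swap_matrix m k)))\<^sup>2 = 1"
proof -
  have "swap_matrix m k ** swap_matrix m k = mat 1"
    by (simp add: matrix_eq matrix_vector_mul_assoc[symmetric] vec_eq_iff swap_matrix_mult_component)
  then have "det (swap_matrix m k) * det (swap_matrix m k) = 1"
    by (metis det_I det_mul)
  then have "cmod (det (swap_matrix m k) * det (swap_matrix m k)) = 1" by simp
  then show ?thesis by (simp add: norm_mult power2_eq_square)
qed

context
  fixes b :: "'d::finite bit0 \<Rightarrow> complex^'d"
  assumes b: "bij_betw b UNIV Basis"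
begin

lemma linear_matrix_vector: "linear ((*v) (A :: complex^'d^'d))"
proof (rule linearI)
  show "A *v (r *\<^sub>R x) = r *\<^sub>R (A *v x)" for r x
    by (simp add: matrix_vector_mult_def vec_eq_iff scaleR_sum_right)
qed (simp add: matrix_vector_right_distrib)

lemma volume_factor_matrix_mult:
  "volume_factor b ((*v) (A ** B)) = volume_factor b ((*v) A) * volume_factor b ((*v) B)"
proof -
  have "(*v) (A ** B) = (*v) A \<circ> (*v) B" by (auto simp: matrix_vector_mul_assoc)
  then show ?thesis by (simp add: volume_factor_compose[OF b linear_matrix_vector linear_matrix_vector])
qed

lemma volume_factor_mat_1: "volume_factor b ((*v) (mat 1)) = 1"
  by (rule volume_factor_isometry[OF b linear_matrix_vector]) simp

lemma volume_factor_eq_1: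
  assumes "\<And>x. (\<Sum>i\<in>UNIV. (cmod ((A *v x) $ i))\<^sup>2) = (\<Sum>i\<in>UNIV. (cmod (x $ i))\<^sup>2)"
  shows "volume_factor b ((*v) A) = 1"
  by (rule volume_factor_isometry[OF b linear_matrix_vector]) (simp add: norm_vec_def L2_set_def assms)

lemma volume_factor_swap: "volume_factor b ((*v) (swap_matrix m k)) = 1"
proof (rule volume_factor_eq_1)
  fix x :: "complex^'d"
  show "(\<Sum>i\<in>UNIV. (cmod ((swap_matrix m k *v x) $ i))\<^sup>2) = (\<Sum>i\<in>UNIV. (cmod (x $ i))\<^sup>2)"
    unfolding swap_matrix_mult_component
    by (rule sum.reindex_bij_betw[where g = "\<lambda>i. (cmod (x $ i))\<^sup>2"]) (rule bij_transpose)
qed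

text \<open>In the coordinates given by \<open>b\<close> the map is diagonal, and the factor \<open>r\<close> occurs for the two basis
vectors which span the complex coordinate \<open>k\<close>.\<close>

lemma volume_factor_real_dilation:
  assumes "r > 0"
  shows "volume_factor b ((*v) (column_matrix k (of_real r *s axis k 1))) = r\<^sup>2"
proof -
  let ?D = "column_matrix k (of_real r *s axis k 1)"
  define s where "s \<beta> = (if \<beta> \<in> axis k ` (Basis :: complex set) then r else 1)" for \<beta> :: "complex^'d"
  have D: "?D *v \<beta> = s \<beta> *\<^sub>R \<beta>" if "\<beta> \<in> Basis" for \<beta>
  proof -
    from that obtain l c where c: "c \<in> (Basis :: complex set)" "\<beta> = axis l c"
      by (auto simp: Basis_vec_def)
    have "\<beta> \<in> axis k ` (Basis :: complex set) \<longleftrightarrow> l = k"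
      using c nonzero_Basis[of c] by (auto simp: axis_eq_axis)
    moreover have "(t *\<^sub>R \<beta>) $ i = of_real t * \<beta> $ i" for t i
      by (subst vector_scaleR_component) (rule scaleR_conv_of_real)
    ultimately show ?thesis
      by (simp add: vec_eq_iff column_matrix_mult_component s_def) (auto simp: c(2) axis_def)
  qed
  have bb: "b i \<bullet> b j = (if i = j then 1 else 0)" for i j
    using b by (auto simp: inner_Basis b_Basis[OF b] bij_betw_def dest: injD)
  have entry: "matrix (real_coords b \<circ> (*v) ?D \<circ> from_real_coords b) $ i $ j = (if i = j then s (b j) else 0)" for i j
  proof -
    have "from_real_coords b (axis j 1) = b j"
      by (simp add: from_real_coords_def axis_def if_distrib[of "\<lambda>c. c *\<^sub>R _"] cong: if_cong)
    then show ?thesis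
      using D[OF b_Basis[OF b], of j] by (auto simp: matrix_def real_coords_def bb)
  qed
  have "det (matrix (real_coords b \<circ> (*v) ?D \<circ> from_real_coords b)) = (\<Prod>j\<in>UNIV. s (b j))"
    using det_diagonal[of "matrix (real_coords b \<circ> (*v) ?D \<circ> from_real_coords b)"] by (simp add: entry)
  also have "\<dots> = (\<Prod>\<beta>\<in>Basis. s \<beta>)"
    by (rule prod.reindex_bij_betw[OF b])
  also have "\<dots> = (\<Prod>\<beta>\<in>axis k ` (Basis :: complex set). s \<beta>)"
    by (rule prod.mono_neutral_right) (auto simp: Basis_vec_def s_def)
  also have "\<dots> = r ^ card (axis k ` (Basis :: complex set) :: (complex^'d) set)"
    by (simp add: s_def)
  also have "card (axis k ` (Basis :: complex set) :: (complex^'d) set) = 2"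
    by (subst card_image) (auto simp: inj_on_def axis_eq_axis)
  finally show ?thesis using assms by (simp add: volume_factor_def o_def)
qed

text \<open>A complex factor is a positive real factor times a factor of modulus one, and the latter acts as an
isometry.\<close>

lemma volume_factor_dilation:
  assumes "c \<noteq> 0"
  shows "volume_factor b ((*v) (column_matrix k (c *s axis k 1))) = (cmod c)\<^sup>2"
proof -
  let ?u = "sgn c"
  have c: "c = of_real (cmod c) * ?u" using assms by (simp add: sgn_div_norm scaleR_conv_of_real)
  have "column_matrix k (c *s axis k 1) = column_matrix k (of_real (cmod c) *s axis k 1) ** column_matrix k (?u *s axis k 1)"
    using c by (simp add: matrix_eq matrix_vector_mul_assoc[symmetric] vec_eq_iff column_matrix_mult_component
        axis_def mult.assoc[symmetric])
  moreover have "volume_factor b ((*v) (column_matrix k (?u *s axis k 1))) = 1"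
    by (rule volume_factor_eq_1, rule sum.cong)
      (auto simp: column_matrix_mult_component axis_def norm_mult norm_sgn assms)
  ultimately show ?thesis
    using volume_factor_real_dilation[of "cmod c" k] assms by (simp add: volume_factor_matrix_mult)
qed

text \<open>Conjugation by a dilation turns the shear into its own square. The volume factor is multiplicative
and nonzero, so it equals its own square.\<close>

lemma volume_factor_shear:
  fixes a :: "complex^'d"
  assumes "a $ k = 1"
  shows "volume_factor b ((*v) (column_matrix k a)) = 1"
proof -
  let ?U = "column_matrix k a" and ?D = "column_matrix k (2 *s axis k 1)" and ?E = "column_matrix k ((1/2) *s axis k 1)"
  have "?U ** ?U = ?E ** (?U ** ?D)"
    using assms by (auto simp: matrix_eq matrix_vector_mul_assoc[symmetric] vec_eq_iff column_matrix_mult_component axis_def)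
  then have "volume_factor b ((*v) ?U) * volume_factor b ((*v) ?U)
      = volume_factor b ((*v) ?E) * (volume_factor b ((*v) ?U) * volume_factor b ((*v) ?D))"
    by (simp only: volume_factor_matrix_mult[symmetric])
  then have "volume_factor b ((*v) ?U) * volume_factor b ((*v) ?U) = volume_factor b ((*v) ?U)"
    using volume_factor_dilation[of 2 k] volume_factor_dilation[of "1/2" k]
    by (simp add: norm_divide power_divide)
  moreover have "volume_factor b ((*v) ?U) \<noteq> 0"
  proof -
    have "?U ** column_matrix k (2 *s axis k 1 - a) = mat 1"
      using assms by (auto simp: matrix_eq matrix_vector_mul_assoc[symmetric] vec_eq_iff column_matrix_mult_component axis_def algebra_simps)
    then have "volume_factor b ((*v) ?U) * volume_factor b ((*v) (column_matrix k (2 *s axis k 1 - a))) = 1"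
      using volume_factor_mat_1 by (simp only: volume_factor_matrix_mult[symmetric])
    then show ?thesis by auto
  qed
  ultimately show ?thesis by simp
qed

lemma volume_factor_column:
  fixes a :: "complex^'d"
  assumes "a $ k \<noteq> 0"
  shows "volume_factor b ((*v) (column_matrix k a)) = (cmod (a $ k))\<^sup>2"
proof -
  have "column_matrix k a = column_matrix k ((1 / a $ k) *s a) ** column_matrix k (a $ k *s axis k 1)"
    using assms by (auto simp: matrix_eq matrix_vector_mul_assoc[symmetric] vec_eq_iff column_matrix_mult_component axis_def)
  then show ?thesis
    using assms by (simp add: volume_factor_matrix_mult volume_factor_shear volume_factor_dilation)
qed

text \<open>The real determinant of a complex linear map is the square of the modulus of its complex
determinant. Both sides are multiplicative, so Gaussian elimination reduces the claim to
transpositions and to the matrices \<open>column_matrix k a\<close>. The induction is on a set \<open>K\<close> of columns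
outside which \<open>A\<close> agrees with the identity matrix.\<close>

lemma volume_factor_matrix:
  fixes A :: "complex^'d^'d"
  assumes "det A \<noteq> 0"
  shows "volume_factor b ((*v) A) = (cmod (det A))\<^sup>2"
proof -
  have "volume_factor b ((*v) A) = (cmod (det A))\<^sup>2"
    if "finite K" "det A \<noteq> 0" "\<And>j. j \<notin> K \<Longrightarrow> A *v axis j 1 = axis j 1" for K and A :: "complex^'d^'d"
    using that
  proof (induction K arbitrary: A rule: finite_induct)
    case empty
    have "A *v x = x" for x
    proof -
      have "A *v (\<Sum>j\<in>UNIV. x $ j *s axis j 1) = (\<Sum>j\<in>UNIV. x $ j *s (A *v axis j 1))"
        by (simp add: vec.linear_sum[OF matrix_vector_mul_linear_gen] vector_scalar_commute)
      then show ?thesis using empty by (simp add: basis_expansion)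
    qed
    then have A: "A = mat 1" by (simp add: matrix_eq)
    show ?case unfolding A volume_factor_mat_1 det_I by simp
  next
    case (insert k K)
    define a where "a = A *v axis k 1"
    \<comment> \<open>If column \<open>k\<close> were supported outside \<open>insert k K\<close>, it would be a combination of the unit columns there, and \<open>A\<close> would be singular.\<close>
    have "\<exists>i\<in>insert k K. a $ i \<noteq> 0"
    proof (rule ccontr)
      assume "\<not> ?thesis"
      then have a0: "a $ i = 0" if "i \<in> insert k K" for i using that by blast
      define x where "x = axis k 1 - (\<chi> i. if i \<in> insert k K then 0 else a $ i)"
      have "(\<chi> i. if i \<in> insert k K then 0 else a $ i) = (\<Sum>j\<in>- insert k K. a $ j *s axis j 1)"
        by (auto simp: vec_eq_iff axis_def if_distrib[of "\<lambda>c. _ * c"] cong: if_cong)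
      then have "A *v x = a - (\<Sum>j\<in>- insert k K. a $ j *s (A *v axis j 1))"
        by (simp add: x_def matrix_vector_mult_diff_distrib a_def vec.linear_sum[OF matrix_vector_mul_linear_gen] vector_scalar_commute)
      also have "\<dots> = a - (\<Sum>j\<in>- insert k K. a $ j *s axis j 1)"
        using insert.prems(2) by (auto intro!: sum.cong)
      also have "\<dots> = 0"
        using a0 by (auto simp: vec_eq_iff axis_def if_distrib[of "\<lambda>c. _ * c"] cong: if_cong)
      finally have "A *v x = 0" .
      moreover have "x $ k \<noteq> 0" by (simp add: x_def axis_def)
      then have "x \<noteq> 0" by auto
      ultimately show False
        using insert.prems(1) invertible_det_nz matrix_left_invertible_ker invertible_def by metis
    qed
    then obtain i where i: "i \<in> insert k K" "a $ i \<noteq> 0" by blast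
    \<comment> \<open>Bring a nonzero entry of column \<open>k\<close> to the diagonal; the inverse of the resulting column matrix then clears column \<open>k\<close>.\<close>
    define S where "S = swap_matrix i k"
    define a' where "a' = S *v a"
    define ai where "ai = (\<chi> j. if j = k then 1 / a' $ k else - a' $ j / a' $ k)"
    have a'k: "a' $ k \<noteq> 0" using i by (simp add: a'_def S_def swap_matrix_mult_component)
    have aik: "ai $ k \<noteq> 0" using a'k by (simp add: ai_def)
    define B where "B = column_matrix k ai ** (S ** A)"
    have "det S \<noteq> 0" using det_swap_matrix_square[of i k] by (auto simp: S_def)
    then have detB: "det B \<noteq> 0"
      using insert.prems(1) aik by (simp add: B_def det_mul det_column_matrix)
    have "B *v axis j 1 = axis j 1" if "j \<notin> K" for j
    proof (cases "j = k")
      case True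
      have "B *v axis k 1 = column_matrix k ai *v a'"
        by (simp add: B_def matrix_vector_mul_assoc[symmetric] a_def a'_def)
      also have "\<dots> = axis k 1"
        using a'k by (auto simp: vec_eq_iff column_matrix_mult_component ai_def axis_def)
      finally show ?thesis using True by simp
    next
      case False
      then have j: "j \<notin> insert k K" using that by simp
      then have "j \<noteq> i" using i by auto
      have "S *v axis j 1 = axis j 1"
        using False \<open>j \<noteq> i\<close>
        by (auto simp: vec_eq_iff S_def swap_matrix_mult_component axis_def Transposition.transpose_def)
      moreover have "column_matrix k ai *v axis j 1 = axis j 1"
        using False by (auto simp: vec_eq_iff column_matrix_mult_component axis_def)
      ultimately show ?thesis
        using insert.prems(2)[OF j] by (simp add: B_def matrix_vector_mul_assoc[symmetric])
    qed
    from insert.IH[OF detB this] have IH: "volume_factor b ((*v) B) = (cmod (det B))\<^sup>2" .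
    have "(cmod (ai $ k))\<^sup>2 * volume_factor b ((*v) A) = (cmod (ai $ k))\<^sup>2 * (cmod (det A))\<^sup>2"
      using IH aik det_swap_matrix_square[of i k]
      by (simp add: B_def volume_factor_matrix_mult det_mul det_column_matrix volume_factor_column
          volume_factor_swap S_def norm_mult power_mult_distrib)
    then show ?case using aik by simp
  qed
  from this[of UNIV A] show ?thesis using assms by simp
qed

end

section \<open>Square integrable functions and Riesz representation\<close>

text \<open>The square integrable functions on \<open>M\<close> with their inner product \<open>ip\<close> and the square \<open>sqnorm\<close> of
their norm. As in the definition of the Bergman space, functions are not identified when they agree
almost everywhere.\<close>

definition l2 :: "'a measure \<Rightarrow> ('a \<Rightarrow> complex) set" where
  "l2 M = {f \<in> borel_measurable M. integrable M (\<lambda>x. (cmod (f x))\<^sup>2)}"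

definition ip :: "'a measure \<Rightarrow> ('a \<Rightarrow> complex) \<Rightarrow> ('a \<Rightarrow> complex) \<Rightarrow> complex" where
  "ip M f g = (LINT x|M. f x * cnj (g x))"

definition sqnorm :: "'a measure \<Rightarrow> ('a \<Rightarrow> complex) \<Rightarrow> real" where
  "sqnorm M f = (LINT x|M. (cmod (f x))\<^sup>2)"

lemma borel_measurable_cnj [measurable]: "cnj \<in> borel_measurable borel"
  by (intro borel_measurable_continuous_onI continuous_intros)

lemma l2_measurable [measurable_dest]: "f \<in> l2 M \<Longrightarrow> f \<in> borel_measurable M"
  by (simp add: l2_def)

lemma l2_integrable: "f \<in> l2 M \<Longrightarrow> integrable M (\<lambda>x. (cmod (f x))\<^sup>2)"
  by (simp add: l2_def)

lemma l2_integrable_mult: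
  assumes [measurable]: "f \<in> l2 M" "g \<in> l2 M"
  shows "integrable M (\<lambda>x. f x * cnj (g x))"
proof (rule Bochner_Integration.integrable_bound)
  show "integrable M (\<lambda>x. (cmod (f x))\<^sup>2 + (cmod (g x))\<^sup>2)"
    using assms by (intro Bochner_Integration.integrable_add l2_integrable)
  show "(\<lambda>x. f x * cnj (g x)) \<in> borel_measurable M" by measurable
  have "cmod (f x) * cmod (g x) \<le> (cmod (f x))\<^sup>2 + (cmod (g x))\<^sup>2" for x
  proof -
    have "0 \<le> cmod (f x) * cmod (g x)" by simp
    then show ?thesis using sum_squares_bound[of "cmod (f x)" "cmod (g x)"] by linarith
  qed
  then show "AE x in M. norm (f x * cnj (g x)) \<le> norm ((cmod (f x))\<^sup>2 + (cmod (g x))\<^sup>2)"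
    by (auto simp: norm_mult)
qed

lemma l2_cmult: "f \<in> l2 M \<Longrightarrow> (\<lambda>x. c * f x) \<in> l2 M"
  by (auto simp: l2_def norm_mult power_mult_distrib)

lemma l2_add:
  assumes [measurable]: "f \<in> l2 M" "g \<in> l2 M"
  shows "(\<lambda>x. f x + g x) \<in> l2 M"
proof -
  have "integrable M (\<lambda>x. (cmod (f x + g x))\<^sup>2)"
  proof (rule Bochner_Integration.integrable_bound)
    show "integrable M (\<lambda>x. 2 * (cmod (f x))\<^sup>2 + 2 * (cmod (g x))\<^sup>2)"
      using assms by (intro Bochner_Integration.integrable_add integrable_mult_right l2_integrable) auto
    have "(cmod (f x + g x))\<^sup>2 \<le> 2 * (cmod (f x))\<^sup>2 + 2 * (cmod (g x))\<^sup>2" for x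
    proof -
      have "(cmod (f x + g x))\<^sup>2 \<le> (cmod (f x) + cmod (g x))\<^sup>2"
        by (intro power_mono norm_triangle_ineq) auto
      also have "\<dots> \<le> 2 * (cmod (f x))\<^sup>2 + 2 * (cmod (g x))\<^sup>2"
        using sum_squares_bound[of "cmod (f x)" "cmod (g x)"] by (simp add: power2_sum)
      finally show ?thesis .
    qed
    then show "AE x in M. norm ((cmod (f x + g x))\<^sup>2) \<le> norm (2 * (cmod (f x))\<^sup>2 + 2 * (cmod (g x))\<^sup>2)"
      by auto
  qed measurable
  then show ?thesis using assms by (simp add: l2_def)
qed

lemma l2_diff: "f \<in> l2 M \<Longrightarrow> g \<in> l2 M \<Longrightarrow> (\<lambda>x. f x - g x) \<in> l2 M"
  using l2_add[OF _ l2_cmult[of g M "-1"], of f] by simp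

lemma sqnorm_nonneg: "sqnorm M f \<ge> 0"
  by (simp add: sqnorm_def)

lemma sqnorm_eq_nn_integral:
  assumes "f \<in> l2 M"
  shows "(\<integral>\<^sup>+x. ennreal ((cmod (f x))\<^sup>2) \<partial>M) = ennreal (sqnorm M f)"
  unfolding sqnorm_def by (rule nn_integral_eq_integral[OF l2_integrable[OF assms]]) auto

lemma ip_add_left:
  "f \<in> l2 M \<Longrightarrow> g \<in> l2 M \<Longrightarrow> h \<in> l2 M \<Longrightarrow> ip M (\<lambda>x. f x + g x) h = ip M f h + ip M g h"
  by (simp add: ip_def ring_distribs l2_integrable_mult)

lemma ip_cmult_left: "ip M (\<lambda>x. c * f x) h = c * ip M f h"
  by (simp add: ip_def mult.assoc)

lemma ip_cnj: "cnj (ip M f g) = ip M g f"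
proof -
  have "ip M g f = (LINT x|M. cnj (f x * cnj (g x)))"
    by (simp add: ip_def mult.commute)
  also have "\<dots> = cnj (ip M f g)" unfolding ip_def by (rule Bochner_Integration.integral_cnj)
  finally show ?thesis by simp
qed

lemma ip_diff_right:
  assumes "f \<in> l2 M" "g \<in> l2 M" "h \<in> l2 M"
  shows "ip M h (\<lambda>x. f x - g x) = ip M h f - ip M h g"
  using assms by (simp add: ip_def ring_distribs l2_integrable_mult)

lemma ip_cong: "(\<And>x. x \<in> space M \<Longrightarrow> f x = f' x) \<Longrightarrow> (\<And>x. x \<in> space M \<Longrightarrow> g x = g' x) \<Longrightarrow> ip M f g = ip M f' g'"
  unfolding ip_def by (intro Bochner_Integration.integral_cong) auto

lemma sqnorm_add:
  assumes f: "f \<in> l2 M" and g: "g \<in> l2 M"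
  shows "sqnorm M (\<lambda>x. f x + t * g x) = sqnorm M f + 2 * Re (t * ip M g f) + (cmod t)\<^sup>2 * sqnorm M g"
proof -
  define R where "R x = Re (t * (g x * cnj (f x)))" for x
  have eq: "(cmod (f x + t * g x))\<^sup>2 = (cmod (f x))\<^sup>2 + 2 * R x + (cmod t)\<^sup>2 * (cmod (g x))\<^sup>2" for x
    unfolding cmod_power2 R_def by (simp add: power2_eq_square algebra_simps)
  have i: "integrable M (\<lambda>x. t * (g x * cnj (f x)))"
    using l2_integrable_mult[OF g f] by simp
  have iR: "integrable M R" using integrable_Re[OF i] unfolding R_def[abs_def] .
  have "sqnorm M (\<lambda>x. f x + t * g x) = (LINT x|M. (cmod (f x))\<^sup>2) + 2 * (LINT x|M. R x) + (cmod t)\<^sup>2 * (LINT x|M. (cmod (g x))\<^sup>2)"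
    unfolding sqnorm_def eq
    using l2_integrable[OF f] l2_integrable[OF g] iR by simp
  also have "(LINT x|M. R x) = Re (t * ip M g f)"
    using integral_Re[OF i] by (simp add: ip_def R_def)
  finally show ?thesis by (simp add: sqnorm_def)
qed

lemma sqnorm_cmult: "sqnorm M (\<lambda>x. c * f x) = (cmod c)\<^sup>2 * sqnorm M f"
  by (simp add: sqnorm_def norm_mult power_mult_distrib)

lemma sqnorm_parallelogram:
  assumes "f \<in> l2 M" "g \<in> l2 M"
  shows "sqnorm M (\<lambda>x. f x - g x) = 2 * sqnorm M f + 2 * sqnorm M g - sqnorm M (\<lambda>x. f x + g x)"
  using sqnorm_add[OF assms, of 1] sqnorm_add[OF assms, of "-1"] by simp

text \<open>The square of the norm of \<open>g + t f\<close> is nonnegative; the value of \<open>t\<close> below minimizes it.\<close>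

lemma ip_Cauchy_Schwarz:
  assumes f: "f \<in> l2 M" and g: "g \<in> l2 M"
  shows "(cmod (ip M f g))\<^sup>2 \<le> sqnorm M f * sqnorm M g"
proof (cases "sqnorm M f = 0")
  case True
  then have "AE x in M. (cmod (f x))\<^sup>2 = 0"
    unfolding sqnorm_def using integral_nonneg_eq_0_iff_AE[OF l2_integrable[OF f]] by simp
  then have "AE x in M. f x * cnj (g x) = 0" by eventually_elim simp
  then have "ip M f g = 0" unfolding ip_def by (rule integral_eq_zero_AE)
  then show ?thesis by (simp add: sqnorm_nonneg)
next
  case False
  then have pos: "sqnorm M f > 0" using sqnorm_nonneg[of M f] by simp
  let ?w = "ip M f g" and ?t = "- cnj (ip M f g) / of_real (sqnorm M f)"
  have "?t * ?w = of_real (- (cmod ?w)\<^sup>2 / sqnorm M f)"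
    using complex_norm_square[of ?w] by (simp add: mult.commute[of "cnj _"])
  then have "Re (?t * ?w) = - (cmod ?w)\<^sup>2 / sqnorm M f" by (simp only: Re_complex_of_real)
  moreover have "(cmod ?t)\<^sup>2 * sqnorm M f = (cmod ?w)\<^sup>2 / sqnorm M f"
    using pos by (simp add: norm_divide power_divide power2_eq_square)
  moreover have "0 \<le> sqnorm M g + 2 * Re (?t * ?w) + (cmod ?t)\<^sup>2 * sqnorm M f"
    using sqnorm_add[OF g f, of ?t] sqnorm_nonneg[of M "\<lambda>x. g x + ?t * f x"] by simp
  ultimately have "(cmod ?w)\<^sup>2 / sqnorm M f \<le> sqnorm M g" by linarith
  then show ?thesis using pos by (simp add: field_simps)
qed

text \<open>A minimizing sequence of the functional \<open>Q f = sqnorm M f - 2 Re (L f)\<close> is a Cauchy sequence by the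
parallelogram identity, and the vanishing of the first variation of \<open>Q\<close> at its limit \<open>k\<close> says that \<open>L\<close>
is the inner product with \<open>k\<close>. The boundedness of \<open>L\<close> is expressed by the lower bound for \<open>Q\<close>; in this
form it is immediate both for point evaluations and for inner products with a fixed function.\<close>

lemma Riesz_representation:
  assumes H: "H \<subseteq> l2 M" "H \<noteq> {}"
    and add: "\<And>f g. f \<in> H \<Longrightarrow> g \<in> H \<Longrightarrow> (\<lambda>x. f x + g x) \<in> H"
    and cmult: "\<And>c f. f \<in> H \<Longrightarrow> (\<lambda>x. c * f x) \<in> H"
    and complete: "\<And>F. (\<And>n. F n \<in> H) \<Longrightarrow>
        (\<And>e. e > 0 \<Longrightarrow> \<exists>N. \<forall>m\<ge>N. \<forall>n\<ge>N. sqnorm M (\<lambda>x. F m x - F n x) < e) \<Longrightarrow>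
        \<exists>k\<in>H. (\<lambda>n. sqnorm M (\<lambda>x. F n x - k x)) \<longlonglongrightarrow> 0"
    and L_add: "\<And>f g. f \<in> H \<Longrightarrow> g \<in> H \<Longrightarrow> L (\<lambda>x. f x + g x) = L f + L g"
    and L_cmult: "\<And>c f. f \<in> H \<Longrightarrow> L (\<lambda>x. c * f x) = c * L f"
    and bound: "\<And>f. f \<in> H \<Longrightarrow> sqnorm M f - 2 * Re (L f) \<ge> B"
  shows "\<exists>k\<in>H. \<forall>f\<in>H. L f = ip M f k"
proof -
  define Q where "Q f = sqnorm M f - 2 * Re (L f)" for f
  define m where "m = Inf (Q ` H)"
  have bdd: "bdd_below (Q ` H)" using bound by (auto simp: Q_def bdd_below_def)
  have m_le: "m \<le> Q f" if "f \<in> H" for f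
    unfolding m_def using that bdd by (intro cInf_lower) auto
  have "\<exists>f\<in>H. Q f < m + 1 / real (Suc n)" for n
  proof -
    have "Inf (Q ` H) < m + 1 / real (Suc n)" by (simp add: m_def)
    then show ?thesis using cInf_lessD[of "Q ` H"] H(2) by auto
  qed
  then obtain F where F: "\<And>n. F n \<in> H" "\<And>n. Q (F n) < m + 1 / real (Suc n)" by metis
  have l2: "f \<in> l2 M" if "f \<in> H" for f using that H by blast
  have cauchy: "sqnorm M (\<lambda>x. F i x - F j x) \<le> 2 / real (Suc i) + 2 / real (Suc j)" for i j
  proof -
    let ?h = "\<lambda>x. (1/2) * (F i x + F j x)"
    have "?h \<in> H" by (intro cmult add F)
    then have "m \<le> Q ?h" by (rule m_le)
    also have "Q ?h = sqnorm M (\<lambda>x. F i x + F j x) / 4 - Re (L (F i)) - Re (L (F j))"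
    proof -
      have "L ?h = (1/2) * (L (F i) + L (F j))"
        by (subst L_cmult[OF add[OF F(1) F(1)]]) (simp only: L_add[OF F(1) F(1)])
      then have "2 * Re (L ?h) = Re (L (F i)) + Re (L (F j))"
      proof -
        have "2 * Re ((1/2) * (x + y)) = Re x + Re y" for x y by simp
        with \<open>L ?h = _\<close> show ?thesis by (simp only:)
      qed
      moreover have "sqnorm M ?h = sqnorm M (\<lambda>x. F i x + F j x) / 4"
        by (subst sqnorm_cmult) (simp add: power_divide)
      ultimately show ?thesis unfolding Q_def by linarith
    qed
    finally have "4 * m \<le> sqnorm M (\<lambda>x. F i x + F j x) - 4 * Re (L (F i)) - 4 * Re (L (F j))" by simp
    then show ?thesis
      using sqnorm_parallelogram[OF l2[OF F(1)] l2[OF F(1)], of i j] F(2)[of i] F(2)[of j]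
      by (simp add: Q_def)
  qed
  have "\<exists>k\<in>H. (\<lambda>n. sqnorm M (\<lambda>x. F n x - k x)) \<longlonglongrightarrow> 0"
  proof (rule complete[OF F(1)])
    show "\<exists>N. \<forall>m\<ge>N. \<forall>n\<ge>N. sqnorm M (\<lambda>x. F m x - F n x) < e" if e: "e > 0" for e
    proof -
      obtain N where N: "4 / e < real N" using reals_Archimedean2 by blast
      have small: "2 / real (Suc n) < e / 2" if "n \<ge> N" for n
      proof -
        have "4 / e < real (Suc n)" using N that by linarith
        then show ?thesis using e by (simp add: field_simps)
      qed
      have "sqnorm M (\<lambda>x. F i x - F j x) < e" if "i \<ge> N" "j \<ge> N" for i j
        using cauchy[of i j] small[OF that(1)] small[OF that(2)] by linarith
      then show ?thesis by (intro exI[of _ N]) simp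
    qed
  qed
  then obtain k where k: "k \<in> H" "(\<lambda>n. sqnorm M (\<lambda>x. F n x - k x)) \<longlonglongrightarrow> 0" by blast
  have lim: "(\<lambda>n. ip M g (F n)) \<longlonglongrightarrow> ip M g k" if g: "g \<in> H" for g
  proof -
    have "(\<lambda>n. sqrt (sqnorm M g * sqnorm M (\<lambda>x. F n x - k x))) \<longlonglongrightarrow> sqrt (sqnorm M g * 0)"
      by (intro tendsto_intros k(2))
    moreover have "cmod (ip M g (F n) - ip M g k) \<le> sqrt (sqnorm M g * sqnorm M (\<lambda>x. F n x - k x))" for n
      using ip_Cauchy_Schwarz[OF l2[OF g] l2_diff[OF l2[OF F(1)] l2[OF k(1)]], of n]
      by (simp add: ip_diff_right[OF l2[OF F(1)] l2[OF k(1)] l2[OF g]] real_le_rsqrt)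
    ultimately have "(\<lambda>n. ip M g (F n) - ip M g k) \<longlonglongrightarrow> 0"
      by (intro Lim_null_comparison[where f = "\<lambda>n. ip M g (F n) - ip M g k"]) (auto intro: always_eventually)
    then show ?thesis by (simp add: LIM_zero_iff)
  qed
  have "L g = ip M g k" if g: "g \<in> H" for g
  proof -
    define w where "w = ip M g k - L g"
    have ineq: "0 \<le> 2 * Re (t * w) + (cmod t)\<^sup>2 * sqnorm M g" for t
    proof (rule tendsto_lowerbound)
      have "(\<lambda>n. 2 * Re (t * (ip M g (F n) - L g)) + (cmod t)\<^sup>2 * sqnorm M g + 1 / real (Suc n)) \<longlonglongrightarrow>
          2 * Re (t * w) + (cmod t)\<^sup>2 * sqnorm M g + 0"
        unfolding w_def by (intro tendsto_intros lim g LIMSEQ_inverse_real_of_nat[unfolded inverse_eq_divide])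
      then show "(\<lambda>n. 2 * Re (t * (ip M g (F n) - L g)) + (cmod t)\<^sup>2 * sqnorm M g + 1 / real (Suc n)) \<longlonglongrightarrow>
          2 * Re (t * w) + (cmod t)\<^sup>2 * sqnorm M g" by simp
      have "0 \<le> 2 * Re (t * (ip M g (F n) - L g)) + (cmod t)\<^sup>2 * sqnorm M g + 1 / real (Suc n)" for n
      proof -
        have "m \<le> Q (\<lambda>x. F n x + t * g x)" by (intro m_le add cmult F g)
        also have "\<dots> = Q (F n) + 2 * Re (t * (ip M g (F n) - L g)) + (cmod t)\<^sup>2 * sqnorm M g"
          using sqnorm_add[OF l2[OF F(1)] l2[OF g], of n t] L_add[OF F(1) cmult[OF g], of n t] L_cmult[OF g, of t]
          by (simp add: Q_def ring_distribs)
        finally show ?thesis using F(2)[of n] by linarith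
      qed
      then show "\<forall>\<^sub>F n in sequentially. 0 \<le> 2 * Re (t * (ip M g (F n) - L g)) + (cmod t)\<^sup>2 * sqnorm M g + 1 / real (Suc n)"
        by (intro always_eventually allI)
    qed simp
    \<comment> \<open>Testing with \<open>t = - s cnj w\<close> for a small positive \<open>s\<close> forces \<open>w = 0\<close>.\<close>
    define s where "s = 1 / (sqnorm M g + 1)"
    have p: "sqnorm M g + 1 > 0" using sqnorm_nonneg[of M g] by linarith
    have s: "s > 0" "s * sqnorm M g \<le> 1" using p by (simp_all add: s_def field_simps)
    have "- of_real s * cnj w * w = of_real (- s * (cmod w)\<^sup>2)"
      using complex_norm_square[of w] by (simp add: mult.commute[of "cnj _"] mult.assoc)
    then have "Re (- of_real s * cnj w * w) = - s * (cmod w)\<^sup>2" by (simp only: Re_complex_of_real)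
    moreover have "(cmod (- of_real s * cnj w))\<^sup>2 = s\<^sup>2 * (cmod w)\<^sup>2"
      using s by (simp add: norm_mult power_mult_distrib)
    ultimately have "0 \<le> - 2 * s * (cmod w)\<^sup>2 + s\<^sup>2 * (cmod w)\<^sup>2 * sqnorm M g"
      using ineq[of "- of_real s * cnj w"] by simp
    also have "\<dots> = s * (cmod w)\<^sup>2 * (s * sqnorm M g - 2)" by (simp add: algebra_simps power2_eq_square)
    finally have "0 \<le> s * (cmod w)\<^sup>2 * (s * sqnorm M g - 2)" .
    then have "(cmod w)\<^sup>2 \<le> 0"
      using s by (smt (verit) mult_pos_neg mult_pos_pos zero_le_power2)
    then show ?thesis by (simp add: w_def)
  qed
  then show ?thesis using k(1) by blast
qed

section \<open>Weighted Bergman spaces and their projections\<close>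

text \<open>The weight is fixed on an open set, and the volume measure is a positive multiple \<open>c\<close> of Lebesgue
measure. The locale is used for \<open>\<Omega>\<close> and for \<open>\<theta>(\<Omega>)\<close> with the same multiple.\<close>

locale weighted_domain =
  fixes V :: "(complex^'d) measure" and D :: "(complex^'d) set" and \<nu> :: "complex^'d \<Rightarrow> real" and c :: real
  assumes V_eq: "V = density lebesgue (\<lambda>_. ennreal c)" and c_pos: "0 < c"
    and open_D: "open D" and cont_\<nu>: "continuous_on D \<nu>" and \<nu>_pos: "z \<in> D \<Longrightarrow> 0 < \<nu> z"
begin

abbreviation "M \<equiv> weighted_measure V D \<nu>"
abbreviation "H \<equiv> bergman_space V D \<nu>"

lemma D_sets [simp]: "D \<in> sets lebesgue"
  using open_D by (simp add: borel_open)

lemma \<nu>_measurable [measurable]: "\<nu> \<in> borel_measurable (lebesgue_on D)"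
  by (rule continuous_imp_measurable_on_sets_lebesgue[OF cont_\<nu>]) simp

lemma weighted_measure_eq: "M = density (lebesgue_on D) (\<lambda>z. ennreal (c * \<nu> z))"
proof -
  have "restrict_space V D = density (lebesgue_on D) (\<lambda>_. ennreal c)"
  proof (rule measure_eqI)
    fix X assume "X \<in> sets (restrict_space V D)"
    then have X: "X \<in> sets lebesgue" "X \<subseteq> D"
      using open_D by (auto simp: V_eq sets_restrict_space_iff)
    then have "X \<in> sets (lebesgue_on D)" by (simp add: sets_restrict_space_iff)
    with X show "emeasure (restrict_space V D) X = emeasure (density (lebesgue_on D) (\<lambda>_. ennreal c)) X"
      by (simp add: V_eq emeasure_restrict_space emeasure_density_const)
  qed (simp add: V_eq sets_restrict_space)
  moreover have "ennreal c * ennreal (\<nu> z) = ennreal (c * \<nu> z)" for z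
    using c_pos by (simp add: ennreal_mult')
  ultimately show ?thesis
    unfolding weighted_measure_def by (simp add: density_density_eq)
qed

lemma space_M [simp]: "space M = D"
  by (simp add: weighted_measure_eq)

lemma sets_M [simp]: "sets M = sets (lebesgue_on D)"
  by (simp add: weighted_measure_eq)

lemma nn_integral_M:
  assumes [measurable]: "f \<in> borel_measurable (lebesgue_on D)"
  shows "(\<integral>\<^sup>+x. f x \<partial>M) = (\<integral>\<^sup>+x. ennreal (c * \<nu> x) * f x * indicator D x \<partial>lebesgue)"
  unfolding weighted_measure_eq
  by (subst nn_integral_density) (auto simp: nn_integral_restrict_space)

lemma L2_eq: "L2 V D \<nu> = l2 M"
  by (simp add: L2_def l2_def)

lemma bergman_l2: "f \<in> H \<Longrightarrow> f \<in> l2 M"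
  by (simp add: bergman_space_def L2_eq)

lemma bergman_holomorphic: "f \<in> H \<Longrightarrow> holomorphic_several f D"
  by (simp add: bergman_space_def)

lemma bergmanI: "f \<in> l2 M \<Longrightarrow> holomorphic_several f D \<Longrightarrow> f \<in> H"
  by (simp add: bergman_space_def L2_eq)

lemma holomorphic_measurable:
  assumes "holomorphic_several f D"
  shows "f \<in> borel_measurable (lebesgue_on D)"
  by (rule continuous_imp_measurable_on_sets_lebesgue[OF holomorphic_several_continuous_on[OF assms]]) simp

lemma bergman_cong:
  assumes "f \<in> H" "\<And>z. z \<in> D \<Longrightarrow> f z = g z"
  shows "g \<in> H"
proof (rule bergmanI)
  show hol: "holomorphic_several g D"
    using holomorphic_several_cong[OF open_D, of f g] assms(2) bergman_holomorphic[OF assms(1)] by simp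
  have "integrable M (\<lambda>x. (cmod (g x))\<^sup>2)"
    using l2_integrable[OF bergman_l2[OF assms(1)]]
    by (rule Bochner_Integration.integrable_cong[THEN iffD1, rotated -1]) (auto simp: assms(2))
  then show "g \<in> l2 M"
    using holomorphic_measurable[OF hol] by (simp add: l2_def measurable_cong_sets[OF sets_M refl])
qed

lemma bergman_add: "f \<in> H \<Longrightarrow> g \<in> H \<Longrightarrow> (\<lambda>z. f z + g z) \<in> H"
  by (rule bergmanI[OF l2_add[OF bergman_l2 bergman_l2] holomorphic_several_add[OF bergman_holomorphic bergman_holomorphic]])

lemma bergman_cmult: "f \<in> H \<Longrightarrow> (\<lambda>z. a * f z) \<in> H"
  by (rule bergmanI[OF l2_cmult[OF bergman_l2] holomorphic_several_cmult[OF bergman_holomorphic]])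

lemma bergman_diff: "f \<in> H \<Longrightarrow> g \<in> H \<Longrightarrow> (\<lambda>z. f z - g z) \<in> H"
  by (rule bergmanI[OF l2_diff[OF bergman_l2 bergman_l2] holomorphic_several_diff[OF bergman_holomorphic bergman_holomorphic]])

lemma bergman_zero: "(\<lambda>_. 0) \<in> H"
  by (rule bergmanI[OF _ holomorphic_several_const]) (simp add: l2_def)

text \<open>A continuous positive weight is bounded below on a compact ball, so locally the weighted integral
controls the Lebesgue integral.\<close>

lemma local_integral_bound:
  assumes u: "u \<in> D"
  shows "\<exists>R>0. \<exists>C>0. cball u R \<subseteq> D \<and> (\<forall>k\<in>borel_measurable (lebesgue_on D).
    (\<integral>\<^sup>+x. k x * indicator (cball u R) x \<partial>lborel) \<le> ennreal C * (\<integral>\<^sup>+x. k x \<partial>M))"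
proof -
  obtain R where R: "R > 0" "cball u R \<subseteq> D"
    using open_D u open_contains_cball by blast
  have "\<exists>x\<in>cball u R. \<forall>y\<in>cball u R. \<nu> x \<le> \<nu> y"
    using R continuous_on_subset[OF cont_\<nu>] by (intro continuous_attains_inf) auto
  then obtain m where m: "m > 0" "\<And>y. y \<in> cball u R \<Longrightarrow> m \<le> \<nu> y"
    using \<nu>_pos R by blast
  define C where "C = 1 / (c * m)"
  have C: "C > 0" using m c_pos by (simp add: C_def)
  have "(\<integral>\<^sup>+x. k x * indicator (cball u R) x \<partial>lborel) \<le> ennreal C * (\<integral>\<^sup>+x. k x \<partial>M)"
    if k [measurable]: "k \<in> borel_measurable (lebesgue_on D)" for k
  proof -
    have "k x * indicator (cball u R) x \<le> ennreal C * (ennreal (c * \<nu> x) * k x * indicator D x)" for x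
    proof (cases "x \<in> cball u R")
      case True
      have "1 \<le> C * (c * \<nu> x)" using m(1) m(2)[OF True] c_pos by (simp add: C_def)
      then have "ennreal 1 \<le> ennreal (C * (c * \<nu> x))" by (rule ennreal_leI)
      also have "\<dots> = ennreal C * ennreal (c * \<nu> x)" using C by (intro ennreal_mult') simp
      finally have "1 * k x \<le> ennreal C * ennreal (c * \<nu> x) * k x" by (intro mult_right_mono) auto
      moreover have "x \<in> D" using True R by blast
      ultimately show ?thesis using True by (simp add: mult.assoc)
    qed simp
    then have "(\<integral>\<^sup>+x. k x * indicator (cball u R) x \<partial>lebesgue)
        \<le> (\<integral>\<^sup>+x. ennreal C * (ennreal (c * \<nu> x) * k x * indicator D x) \<partial>lebesgue)"
      by (rule nn_integral_mono)
    also have "\<dots> = ennreal C * (\<integral>\<^sup>+x. k x \<partial>M)"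
    proof -
      have "(\<lambda>x. ennreal (c * \<nu> x) * k x) \<in> borel_measurable (lebesgue_on D)" by measurable
      then have "(\<lambda>x. ennreal (c * \<nu> x) * k x * indicator D x) \<in> borel_measurable lebesgue"
        by (subst (asm) borel_measurable_restrict_space_iff_ennreal) auto
      then show ?thesis by (simp add: nn_integral_cmult nn_integral_M)
    qed
    finally show ?thesis by (simp add: nn_integral_completion)
  qed
  then show ?thesis using R C by blast
qed

lemma nn_integral_locally_finite:
  assumes k: "k \<in> borel_measurable (lebesgue_on D)" and fin: "(\<integral>\<^sup>+x. k x \<partial>M) < \<infinity>" and u: "u \<in> D"
  shows "\<exists>\<rho>>0. ball u \<rho> \<subseteq> D \<and> (\<integral>\<^sup>+x. k x * indicator (ball u \<rho>) x \<partial>lborel) < \<infinity>"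
proof -
  obtain R C where R: "R > 0" "cball u R \<subseteq> D"
    and C: "(\<integral>\<^sup>+x. k x * indicator (cball u R) x \<partial>lborel) \<le> ennreal C * (\<integral>\<^sup>+x. k x \<partial>M)"
    using local_integral_bound[OF u] k by blast
  have "(\<integral>\<^sup>+x. k x * indicator (ball u R) x \<partial>lborel) \<le> (\<integral>\<^sup>+x. k x * indicator (cball u R) x \<partial>lborel)"
    by (rule nn_integral_mono) (auto simp: indicator_def)
  also note C
  also have "ennreal C * (\<integral>\<^sup>+x. k x \<partial>M) < \<infinity>" using fin by (simp add: ennreal_mult_less_top)
  finally show ?thesis using R ball_subset_cball by blast
qed

lemma AE_not_in_negligible:
  assumes "negligible Z"
  shows "AE z in M. z \<notin> Z"
proof -
  have "AE z in lebesgue. z \<notin> Z"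
    using assms unfolding negligible_iff_null_sets by (rule AE_not_in)
  then have "AE z in lebesgue. z \<in> D \<longrightarrow> 0 < ennreal (c * \<nu> z) \<longrightarrow> z \<notin> Z"
    by eventually_elim auto
  then show ?thesis
    unfolding weighted_measure_eq by (simp add: AE_density AE_restrict_space_iff)
qed

text \<open>The mean value inequality on balls of a fixed radius; this bounds point evaluations locally
uniformly by the norm of the Bergman space.\<close>

lemma evaluation_locally_bounded:
  assumes z0: "z0 \<in> D"
  shows "\<exists>r>0. \<exists>C>0. cball z0 r \<subseteq> D \<and> (\<forall>f\<in>H. \<forall>z\<in>cball z0 r. (cmod (f z))\<^sup>2 \<le> C * sqnorm M f)"
proof -
  obtain R C where R: "R > 0" "cball z0 R \<subseteq> D" and C: "C > 0"
    and int: "\<And>k. k \<in> borel_measurable (lebesgue_on D) \<Longrightarrow>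
      (\<integral>\<^sup>+x. k x * indicator (cball z0 R) x \<partial>lborel) \<le> ennreal C * (\<integral>\<^sup>+x. k x \<partial>M)"
    using local_integral_bound[OF z0] by blast
  define r where "r = R / 2"
  have r: "r > 0" using R by (simp add: r_def)
  define vol where "vol = measure lborel (ball (0::complex^'d) r)"
  have vol: "vol > 0" using r by (simp add: vol_def content_ball_pos)
  have vol_eq: "emeasure lborel (ball z r) = ennreal vol" for z :: "complex^'d"
    using r emeasure_ball[of r z] emeasure_ball[of r "0::complex^'d"]
    by (simp add: vol_def emeasure_eq_ennreal_measure measure_def enn2real_ennreal)
  have "(cmod (f z))\<^sup>2 \<le> C / vol * sqnorm M f" if f: "f \<in> H" and z: "z \<in> cball z0 r" for f z
  proof -
    have ball: "ball z r \<subseteq> cball z0 R"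
    proof
      fix x assume "x \<in> ball z r"
      then show "x \<in> cball z0 R" using z dist_triangle[of z0 x z] by (simp add: r_def)
    qed
    have hol: "holomorphic_several f D" by (rule bergman_holomorphic[OF f])
    obtain b :: "'d bit0 \<Rightarrow> complex^'d" where b: "bij_betw b UNIV Basis"
      using ex_bij_betw_complex_vec_Basis by blast
    have "ennreal ((cmod (f z))\<^sup>2) * emeasure lborel (ball z r)
      \<le> (\<integral>\<^sup>+x. ennreal ((cmod (f x))\<^sup>2) * indicator (ball z r) x \<partial>lborel)"
    proof (rule square_mean_value_inequality[where rot = "(*s)"])
      fix a :: complex assume a: "cmod a = 1"
      show "(*s) a \<in> borel_measurable borel"
        by (intro borel_measurable_continuous_onI continuous_intros)
      show "distr lborel borel ((*s) a) = (lborel :: (complex^'d) measure)"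
        by (rule distr_lborel_isometry[OF b])
          (simp_all add: norm_vector_smult a bounded_linear.linear[OF bounded_linear_smult_right])
    next
      show "continuous_on (ball z r) f"
        using holomorphic_several_continuous_on[OF hol] ball R by (meson continuous_on_subset order_trans)
      fix v :: "complex^'d"
      show "(\<lambda>t. f (z + t *s v)) holomorphic_on {t. cmod t * norm v < r}"
        using holomorphic_on_line[OF hol, of z v]
        by (rule holomorphic_on_subset) (use ball R in \<open>auto simp: dist_norm norm_vector_smult subset_iff\<close>)
    qed (simp add: norm_vector_smult)
    also have "\<dots> \<le> (\<integral>\<^sup>+x. ennreal ((cmod (f x))\<^sup>2) * indicator (cball z0 R) x \<partial>lborel)"
      by (rule nn_integral_mono) (use ball in \<open>auto simp: indicator_def\<close>)
    also have "\<dots> \<le> ennreal C * (\<integral>\<^sup>+x. ennreal ((cmod (f x))\<^sup>2) \<partial>M)"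
      using holomorphic_measurable[OF hol] by (intro int) measurable
    also have "\<dots> = ennreal (C * sqnorm M f)"
      using C sqnorm_nonneg[of M f]
      by (simp add: sqnorm_eq_nn_integral[OF bergman_l2[OF f]] ennreal_mult[symmetric])
    finally have "ennreal ((cmod (f z))\<^sup>2 * vol) \<le> ennreal (C * sqnorm M f)"
      using vol by (simp add: vol_eq ennreal_mult[symmetric])
    then have "(cmod (f z))\<^sup>2 * vol \<le> C * sqnorm M f"
      using C sqnorm_nonneg[of M f] by (subst (asm) ennreal_le_iff) auto
    then show ?thesis using vol by (simp add: field_simps)
  qed
  moreover have "cball z0 r \<subseteq> D" using R by (auto simp: r_def)
  moreover have "C / vol > 0" using vol C by simp
  ultimately show ?thesis using r by blast
qed

text \<open>A Cauchy sequence in the norm is locally uniformly Cauchy because point evaluations are locally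
bounded. Its limit is holomorphic, and Fatou's lemma shows that it is also the limit in the norm.\<close>

lemma bergman_complete:
  assumes F: "\<And>n. F n \<in> H"
    and cauchy: "\<And>e. e > 0 \<Longrightarrow> \<exists>N. \<forall>m\<ge>N. \<forall>n\<ge>N. sqnorm M (\<lambda>x. F m x - F n x) < e"
  shows "\<exists>k\<in>H. (\<lambda>n. sqnorm M (\<lambda>x. F n x - k x)) \<longlonglongrightarrow> 0"
proof -
  define k where "k z = lim (\<lambda>n. F n z)" for z
  have loc: "\<exists>r>0. cball z r \<subseteq> D \<and> uniform_limit (cball z r) F k sequentially" if z: "z \<in> D" for z
  proof -
    obtain r C where r: "r > 0" "C > 0" "cball z r \<subseteq> D"
      and bd: "\<forall>f\<in>H. \<forall>x\<in>cball z r. (cmod (f x))\<^sup>2 \<le> C * sqnorm M f"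
      using evaluation_locally_bounded[OF z] by blast
    have C: "(cmod (f x))\<^sup>2 \<le> C * sqnorm M f" if "f \<in> H" "x \<in> cball z r" for f x
      using bd that by blast
    have "uniformly_Cauchy_on (cball z r) F"
      unfolding uniformly_Cauchy_on_def
    proof (intro allI impI)
      fix e :: real assume e: "e > 0"
      then have "e\<^sup>2 / C > 0" using r by simp
      then obtain N where N: "\<forall>m\<ge>N. \<forall>n\<ge>N. sqnorm M (\<lambda>x. F m x - F n x) < e\<^sup>2 / C"
        using cauchy by blast
      have "dist (F m x) (F n x) < e" if "x \<in> cball z r" "m \<ge> N" "n \<ge> N" for x m n
      proof -
        have "(cmod (F m x - F n x))\<^sup>2 \<le> C * sqnorm M (\<lambda>x. F m x - F n x)"
          by (rule C[OF bergman_diff[OF F F] that(1)])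
        also have "\<dots> < C * (e\<^sup>2 / C)" using N that r by (intro mult_strict_left_mono) auto
        finally have "(cmod (F m x - F n x))\<^sup>2 < e\<^sup>2" using r by simp
        then show ?thesis using e by (simp add: dist_norm power2_less_imp_less)
      qed
      then show "\<exists>N. \<forall>x\<in>cball z r. \<forall>m\<ge>N. \<forall>n\<ge>N. dist (F m x) (F n x) < e" by blast
    qed
    then have "uniform_limit (cball z r) F k sequentially"
      unfolding k_def by (simp add: Cauchy_uniformly_convergent uniformly_convergent_uniform_limit_iff[symmetric])
    then show ?thesis using r by blast
  qed
  have hol: "holomorphic_several k D"
    by (rule holomorphic_several_uniform_limit[OF bergman_holomorphic[OF F] loc])
  have k_meas: "k \<in> borel_measurable M"
    using holomorphic_measurable[OF hol] by (simp add: measurable_cong_sets[OF sets_M refl])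
  have F_meas: "F n \<in> borel_measurable M" for n
    using bergman_l2[OF F[of n]] by (rule l2_measurable)
  have lim: "(\<lambda>n. F n z) \<longlonglongrightarrow> k z" if z: "z \<in> D" for z
  proof -
    obtain r where "r > 0" "uniform_limit (cball z r) F k sequentially" using loc[OF z] by blast
    then show ?thesis using tendsto_uniform_limitI[where S = "cball z r" and f = F and x = z] by simp
  qed
  have est: "(\<integral>\<^sup>+x. ennreal ((cmod (F n x - k x))\<^sup>2) \<partial>M) \<le> ennreal e"
    if N: "\<forall>m\<ge>N. \<forall>n\<ge>N. sqnorm M (\<lambda>x. F m x - F n x) < e" and n: "n \<ge> N" for N n e
  proof -
    have "(\<integral>\<^sup>+x. ennreal ((cmod (F n x - k x))\<^sup>2) \<partial>M) = (\<integral>\<^sup>+x. liminf (\<lambda>m. ennreal ((cmod (F n x - F m x))\<^sup>2)) \<partial>M)"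
    proof (rule nn_integral_cong)
      fix x assume "x \<in> space M"
      then have "(\<lambda>m. ennreal ((cmod (F n x - F m x))\<^sup>2)) \<longlonglongrightarrow> ennreal ((cmod (F n x - k x))\<^sup>2)"
        by (intro tendsto_ennrealI tendsto_intros lim) simp
      then show "ennreal ((cmod (F n x - k x))\<^sup>2) = liminf (\<lambda>m. ennreal ((cmod (F n x - F m x))\<^sup>2))"
        by (rule lim_imp_Liminf[OF sequentially_bot, symmetric])
    qed
    also have "\<dots> \<le> liminf (\<lambda>m. \<integral>\<^sup>+x. ennreal ((cmod (F n x - F m x))\<^sup>2) \<partial>M)"
      using F_meas by (intro nn_integral_liminf) measurable
    also have "\<dots> \<le> ennreal e"
    proof -
      have "(\<integral>\<^sup>+x. ennreal ((cmod (F n x - F m x))\<^sup>2) \<partial>M) \<le> ennreal e" if "m \<ge> N" for m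
        using sqnorm_eq_nn_integral[OF bergman_l2[OF bergman_diff[OF F F]], of n m] N n that
        by (simp add: ennreal_leI less_imp_le)
      then have "liminf (\<lambda>m. \<integral>\<^sup>+x. ennreal ((cmod (F n x - F m x))\<^sup>2) \<partial>M) \<le> liminf (\<lambda>m. ennreal e)"
        by (intro Liminf_mono) (auto simp: eventually_sequentially)
      then show ?thesis by (simp add: Liminf_const)
    qed
    finally show ?thesis .
  qed
  have diff_l2: "(\<lambda>x. F n x - k x) \<in> l2 M" if N: "\<forall>m\<ge>N. \<forall>n\<ge>N. sqnorm M (\<lambda>x. F m x - F n x) < e" and n: "n \<ge> N" for N n e
  proof -
    have "(\<integral>\<^sup>+x. ennreal ((cmod (F n x - k x))\<^sup>2) \<partial>M) < \<infinity>"
      using est[OF N n] by (rule le_less_trans) simp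
    then have "integrable M (\<lambda>x. (cmod (F n x - k x))\<^sup>2)"
      using F_meas k_meas by (intro integrableI_nonneg) auto
    then show ?thesis using F_meas k_meas by (simp add: l2_def)
  qed
  obtain N0 where N0: "\<forall>m\<ge>N0. \<forall>n\<ge>N0. sqnorm M (\<lambda>x. F m x - F n x) < 1"
    using cauchy[of 1] by auto
  have "k \<in> l2 M"
    using l2_diff[OF bergman_l2[OF F[of N0]] diff_l2[OF N0 order_refl]] by simp
  then have kH: "k \<in> H" using hol by (rule bergmanI)
  have "(\<lambda>n. sqnorm M (\<lambda>x. F n x - k x)) \<longlonglongrightarrow> 0"
  proof (rule LIMSEQ_I)
    fix e :: real assume e: "e > 0"
    then have "e / 2 > 0" by simp
    then obtain N where N: "\<forall>m\<ge>N. \<forall>n\<ge>N. sqnorm M (\<lambda>x. F m x - F n x) < e / 2"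
      using cauchy by blast
    have "norm (sqnorm M (\<lambda>x. F n x - k x) - 0) < e" if n: "n \<ge> N" for n
    proof -
      have "ennreal (sqnorm M (\<lambda>x. F n x - k x)) \<le> ennreal (e / 2)"
        using est[OF N n] sqnorm_eq_nn_integral[OF diff_l2[OF N n]] by simp
      then have "sqnorm M (\<lambda>x. F n x - k x) \<le> e / 2"
        using e by (subst (asm) ennreal_le_iff) auto
      then show ?thesis using e sqnorm_nonneg[of M "\<lambda>x. F n x - k x"] by simp
    qed
    then show "\<exists>N. \<forall>n\<ge>N. norm (sqnorm M (\<lambda>x. F n x - k x) - 0) < e" by blast
  qed
  then show ?thesis using kH by blast
qed

lemma bergman_Riesz:
  assumes L_add: "\<And>f g. f \<in> H \<Longrightarrow> g \<in> H \<Longrightarrow> L (\<lambda>x. f x + g x) = L f + L g"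
    and L_cmult: "\<And>c f. f \<in> H \<Longrightarrow> L (\<lambda>x. c * f x) = c * L f"
    and bound: "\<And>f. f \<in> H \<Longrightarrow> sqnorm M f - 2 * Re (L f) \<ge> B"
  shows "\<exists>k\<in>H. \<forall>f\<in>H. L f = ip M f k"
proof (rule Riesz_representation)
  show "H \<subseteq> l2 M" "H \<noteq> {}" using bergman_l2 bergman_zero by auto
qed (fact bergman_add bergman_cmult bergman_complete assms)+

text \<open>With \<open>|f w|\<^sup>2 \<le> C sqnorm M f\<close> one has \<open>2 |f w| \<le> |f w|\<^sup>2/C + C \<le> sqnorm M f + C\<close>, which is the lower bound
needed for the Riesz representation of the evaluation at \<open>w\<close>.\<close>

lemma ex_reproducing_kernel:
  assumes w: "w \<in> D"
  shows "\<exists>k\<in>H. \<forall>f\<in>H. f w = ip M f k"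
proof -
  obtain r C where rC: "r > 0" "C > 0"
    and bd: "\<forall>f\<in>H. \<forall>x\<in>cball w r. (cmod (f x))\<^sup>2 \<le> C * sqnorm M f"
    using evaluation_locally_bounded[OF w] by blast
  have C: "C > 0" "(cmod (f w))\<^sup>2 \<le> C * sqnorm M f" if "f \<in> H" for f
    using bd rC that by auto
  have "sqnorm M f - 2 * Re (f w) \<ge> - C" if f: "f \<in> H" for f
  proof -
    have "2 * Re (f w) \<le> 2 * cmod (f w)" by (simp add: complex_Re_le_cmod)
    also have "\<dots> \<le> (cmod (f w))\<^sup>2 / C + C"
    proof -
      have "0 \<le> (cmod (f w) - C)\<^sup>2 / C" using rC by simp
      also have "\<dots> = (cmod (f w))\<^sup>2 / C + C - 2 * cmod (f w)"
        using rC by (simp add: power2_eq_square field_simps)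
      finally show ?thesis by simp
    qed
    also have "\<dots> \<le> sqnorm M f + C"
      using C(2)[OF f] rC by (simp add: field_simps)
    finally show ?thesis by simp
  qed
  then show ?thesis by (rule bergman_Riesz[rotated 2]) simp_all
qed

lemma reproducing_kernel_iff:
  "reproducing_kernel V D \<nu> K \<longleftrightarrow>
    (\<forall>w\<in>D. (\<lambda>z. K z w) \<in> H \<and> (\<forall>f\<in>H. f w = ip M f (\<lambda>z. K z w)))"
  by (simp add: reproducing_kernel_def ip_def)

lemma reproducing_kernel_hermitian:
  assumes K: "reproducing_kernel V D \<nu> K1" "reproducing_kernel V D \<nu> K2" and zw: "z \<in> D" "w \<in> D"
  shows "K1 z w = cnj (K2 w z)"
proof -
  have K1: "(\<lambda>x. K1 x w) \<in> H" "\<And>f. f \<in> H \<Longrightarrow> f w = ip M f (\<lambda>x. K1 x w)"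
    and K2: "(\<lambda>x. K2 x z) \<in> H" "\<And>f. f \<in> H \<Longrightarrow> f z = ip M f (\<lambda>x. K2 x z)"
    using K zw by (auto simp: reproducing_kernel_iff)
  have "K1 z w = ip M (\<lambda>x. K1 x w) (\<lambda>x. K2 x z)" by (rule K2(2)[OF K1(1)])
  also have "\<dots> = cnj (ip M (\<lambda>x. K2 x z) (\<lambda>x. K1 x w))" by (simp add: ip_cnj)
  also have "ip M (\<lambda>x. K2 x z) (\<lambda>x. K1 x w) = K2 w z" by (rule K1(2)[OF K2(1), symmetric])
  finally show ?thesis .
qed

text \<open>Two reproducing kernels agree on \<open>D \<times> D\<close> by the hermitian symmetry, so the definite description in
the definition of the Bergman kernel denotes the extension by zero of any reproducing kernel.\<close>

lemma reproducing_kernel_bergman_kernel: "reproducing_kernel V D \<nu> (bergman_kernel V D \<nu>)"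
proof -
  obtain k where "\<forall>w\<in>D. k w \<in> H \<and> (\<forall>f\<in>H. f w = ip M f (k w))"
    using bchoice[of D "\<lambda>w k. k \<in> H \<and> (\<forall>f\<in>H. f w = ip M f k)"] ex_reproducing_kernel by blast
  then have k: "k w \<in> H" "\<And>f. f \<in> H \<Longrightarrow> f w = ip M f (k w)" if "w \<in> D" for w
    using that by blast+
  define K where "K z w = (if z \<in> D \<and> w \<in> D then k w z else 0)" for z w
  have rk: "reproducing_kernel V D \<nu> K"
    unfolding reproducing_kernel_iff
  proof (intro ballI conjI)
    fix w assume w: "w \<in> D"
    show "(\<lambda>z. K z w) \<in> H" by (rule bergman_cong[OF k(1)[OF w]]) (simp add: K_def w)
    show "f w = ip M f (\<lambda>z. K z w)" if "f \<in> H" for f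
    proof -
      have "ip M f (k w) = ip M f (\<lambda>z. K z w)"
        by (rule ip_cong) (simp_all add: K_def w)
      with k(2)[OF w that] show ?thesis by simp
    qed
  qed
  have uniq: "K1 = K2"
    if K: "reproducing_kernel V D \<nu> K1" "\<forall>z w. z \<notin> D \<or> w \<notin> D \<longrightarrow> K1 z w = 0"
      "reproducing_kernel V D \<nu> K2" "\<forall>z w. z \<notin> D \<or> w \<notin> D \<longrightarrow> K2 z w = 0" for K1 K2
  proof (intro ext)
    fix z w
    show "K1 z w = K2 z w"
    proof (cases "z \<in> D \<and> w \<in> D")
      case True
      then show ?thesis
        using reproducing_kernel_hermitian[OF K(1,3), of z w] reproducing_kernel_hermitian[OF K(3,3), of z w] by metis
    qed (use K in auto)
  qed
  define P where "P K \<longleftrightarrow> reproducing_kernel V D \<nu> K \<and> (\<forall>z w. z \<notin> D \<or> w \<notin> D \<longrightarrow> K z w = 0)" for K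
  have "P K" using rk by (simp add: P_def K_def)
  have "P (THE K. P K)"
  proof (rule theI[of P, OF \<open>P K\<close>])
    show "K' = K" if "P K'" for K'
      using uniq[of K' K] that \<open>P K\<close> unfolding P_def by blast
  qed
  then have "reproducing_kernel V D \<nu> (bergman_kernel V D \<nu>)"
    by (simp add: P_def bergman_kernel_def)
  then show ?thesis .
qed

lemma bergman_projection_eq_ip:
  assumes z: "z \<in> D"
  shows "bergman_projection V D \<nu> \<phi> z = ip M \<phi> (\<lambda>w. bergman_kernel V D \<nu> w z)"
  unfolding bergman_projection_def ip_def
proof (rule Bochner_Integration.integral_cong[OF refl])
  fix w assume "w \<in> space M"
  then have w: "w \<in> D" by simp
  let ?K = "bergman_kernel V D \<nu>"
  have "?K z w = cnj (?K w z)"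
    by (rule reproducing_kernel_hermitian[OF reproducing_kernel_bergman_kernel reproducing_kernel_bergman_kernel z w])
  then show "\<phi> w * ?K z w = \<phi> w * cnj (?K w z)" by simp
qed

text \<open>This characterizes the Bergman projection by orthogonality: if \<open>\<phi> - k\<close> is orthogonal to the Bergman
space, then integrating \<open>\<phi>\<close> against the kernel at \<open>z\<close> is the same as integrating \<open>k\<close>, which reproduces \<open>k z\<close>.\<close>

lemma bergman_projection_unique:
  assumes k: "k \<in> H" "\<And>f. f \<in> H \<Longrightarrow> ip M f \<phi> = ip M f k" and z: "z \<in> D"
  shows "bergman_projection V D \<nu> \<phi> z = k z"
proof -
  have Kz: "(\<lambda>w. bergman_kernel V D \<nu> w z) \<in> H" "k z = ip M k (\<lambda>w. bergman_kernel V D \<nu> w z)"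
    using reproducing_kernel_bergman_kernel z k(1) unfolding reproducing_kernel_iff by blast+
  show ?thesis
    unfolding bergman_projection_eq_ip[OF z] Kz(2) using k(2)[OF Kz(1)] by (metis ip_cnj)
qed

lemma ex_bergman_projection:
  assumes \<phi>: "\<phi> \<in> l2 M"
  shows "\<exists>k\<in>H. \<forall>f\<in>H. ip M f \<phi> = ip M f k"
proof (rule bergman_Riesz)
  fix f assume f: "f \<in> H"
  show "- sqnorm M \<phi> \<le> sqnorm M f - 2 * Re (ip M f \<phi>)"
    using sqnorm_add[OF \<phi> bergman_l2[OF f], of "-1"] sqnorm_nonneg[of M "\<lambda>x. \<phi> x + - 1 * f x"] by simp
qed (simp_all add: ip_add_left ip_cmult_left bergman_l2 \<phi>)

end

section \<open>Polynomial functions\<close>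

text \<open>The polynomial functions, generated by constants, coordinates, sums and products. Properties stable
under these operations are then proved by induction; \<open>range_poly_eval\<close> identifies the set with
the values of \<open>poly_eval\<close>.\<close>

inductive_set polyfun :: "(complex^'d \<Rightarrow> complex) set" where
  polyfun_const: "(\<lambda>_. c) \<in> polyfun"
| polyfun_coord: "(\<lambda>z. z $ i) \<in> polyfun"
| polyfun_add: "f \<in> polyfun \<Longrightarrow> g \<in> polyfun \<Longrightarrow> (\<lambda>z. f z + g z) \<in> polyfun"
| polyfun_mult: "f \<in> polyfun \<Longrightarrow> g \<in> polyfun \<Longrightarrow> (\<lambda>z. f z * g z) \<in> polyfun"

lemma polyfun_cmult: "f \<in> polyfun \<Longrightarrow> (\<lambda>z. c * f z) \<in> polyfun"
  by (rule polyfun_mult[OF polyfun_const])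

lemma polyfun_diff: "f \<in> polyfun \<Longrightarrow> g \<in> polyfun \<Longrightarrow> (\<lambda>z. f z - g z) \<in> polyfun"
  using polyfun_add[OF _ polyfun_cmult[of g "-1"], of f] by simp

lemma polyfun_sum: "(\<And>i. i \<in> I \<Longrightarrow> f i \<in> polyfun) \<Longrightarrow> (\<lambda>z. \<Sum>i\<in>I. f i z) \<in> polyfun"
  by (induction I rule: infinite_finite_induct) (auto intro: polyfun_const polyfun_add)

lemma polyfun_prod: "(\<And>i. i \<in> I \<Longrightarrow> f i \<in> polyfun) \<Longrightarrow> (\<lambda>z. \<Prod>i\<in>I. f i z) \<in> polyfun"
  by (induction I rule: infinite_finite_induct) (auto intro: polyfun_const polyfun_mult)

lemma polyfun_power: "f \<in> polyfun \<Longrightarrow> (\<lambda>z. f z ^ n) \<in> polyfun"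
  by (induction n) (auto intro: polyfun_const polyfun_mult)

lemmas polyfun_intros = polyfun_const polyfun_coord polyfun_add polyfun_mult polyfun_cmult
  polyfun_diff polyfun_sum polyfun_prod polyfun_power

lemma polyfun_matrix:
  assumes "f \<in> polyfun"
  shows "(\<lambda>z. f (A *v z)) \<in> polyfun"
  using assms
proof induction
  case (polyfun_coord i)
  show ?case unfolding matrix_vector_mult_def by (simp add: polyfun_intros)
qed (auto intro: polyfun_intros)

lemma polyfun_on_line:
  assumes "f \<in> polyfun"
  shows "\<exists>q. \<forall>t. f (u + t *s v) = poly q t"
  using assms
proof induction
  case (polyfun_const c)
  show ?case by (rule exI[of _ "[:c:]"]) simp
next
  case (polyfun_coord i)
  show ?case by (rule exI[of _ "[:u $ i, v $ i:]"]) simp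
next
  case (polyfun_add f g)
  then show ?case by (metis poly_add)
next
  case (polyfun_mult f g)
  then show ?case by (metis poly_mult)
qed

text \<open>Partial derivatives of polynomial functions are again polynomial functions. This is stated for derivatives along
complex lines since the Jacobian matrix is defined through these.\<close>

lemma polyfun_directional_derivative:
  assumes "f \<in> polyfun"
  shows "\<exists>g\<in>polyfun. \<forall>z. ((\<lambda>t. f (z + t *s v)) has_field_derivative g z) (at 0)"
  using assms
proof induction
  case (polyfun_const c)
  show ?case by (rule bexI[OF _ polyfun.polyfun_const[of 0]]) auto
next
  case (polyfun_coord i)
  show ?case by (rule bexI[OF _ polyfun.polyfun_const[of "v $ i"]]) (auto intro!: derivative_eq_intros)
next
  case (polyfun_add f g)
  then obtain f' g' where "f' \<in> polyfun" "g' \<in> polyfun"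
    "\<And>z. ((\<lambda>t. f (z + t *s v)) has_field_derivative f' z) (at 0)"
    "\<And>z. ((\<lambda>t. g (z + t *s v)) has_field_derivative g' z) (at 0)" by blast
  then show ?case
    by (intro bexI[of _ "\<lambda>z. f' z + g' z"]) (auto intro!: polyfun_intros derivative_eq_intros)
next
  case (polyfun_mult f g)
  then obtain f' g' where "f' \<in> polyfun" "g' \<in> polyfun"
    "\<And>z. ((\<lambda>t. f (z + t *s v)) has_field_derivative f' z) (at 0)"
    "\<And>z. ((\<lambda>t. g (z + t *s v)) has_field_derivative g' z) (at 0)" by blast
  with polyfun_mult.hyps show ?case
    by (intro bexI[of _ "\<lambda>z. f' z * g z + g' z * f z"]) (auto intro!: polyfun_intros derivative_eq_intros)
qed

lemma holomorphic_several_polyfun: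
  assumes "f \<in> polyfun"
  shows "holomorphic_several f D"
  using assms
proof induction
  case (polyfun_coord i)
  show ?case
    by (rule holomorphic_severalI[where f' = "\<lambda>_ v. v $ i"])
      (auto intro!: bounded_linear_imp_has_derivative bounded_linear_vec_nth)
qed (auto intro: holomorphic_several_const holomorphic_several_add holomorphic_several_mult)

definition monomial :: "('d::finite \<Rightarrow>\<^sub>0 nat) \<Rightarrow> complex^'d \<Rightarrow> complex" where
  "monomial m z = (\<Prod>i\<in>UNIV. (z $ i) ^ Poly_Mapping.lookup m i)"

lemma monomial_add: "monomial (m + n) z = monomial m z * monomial n z"
  by (simp add: monomial_def lookup_add power_add prod.distrib)

lemma poly_eval_superset:
  assumes "finite K" "Poly_Mapping.keys p \<subseteq> K"
  shows "poly_eval p z = (\<Sum>m\<in>K. Poly_Mapping.lookup p m * monomial m z)"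
  unfolding poly_eval_def monomial_def[symmetric]
  by (rule sum.mono_neutral_left) (use assms in \<open>auto simp: in_keys_iff\<close>)

lemma poly_eval_add: "poly_eval (p + q) z = poly_eval p z + poly_eval q z"
proof -
  let ?K = "Poly_Mapping.keys p \<union> Poly_Mapping.keys q"
  have "finite ?K" "Poly_Mapping.keys (p + q) \<subseteq> ?K"
    by (auto simp: keys_add)
  then show ?thesis
    using poly_eval_superset[of ?K p z] poly_eval_superset[of ?K q z] poly_eval_superset[of ?K "p + q" z]
    by (simp add: lookup_add ring_distribs sum.distrib)
qed

lemma poly_eval_single: "poly_eval (Poly_Mapping.single m c) z = c * monomial m z"
  by (subst poly_eval_superset[of "{m}"]) (auto simp: lookup_single)

lemma sum_in_range_poly_eval:
  assumes "finite I" "\<And>i. i \<in> I \<Longrightarrow> f i \<in> range poly_eval"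
  shows "(\<lambda>z. \<Sum>i\<in>I. f i z) \<in> range poly_eval"
  using assms
proof (induction I rule: finite_induct)
  case empty
  have "(\<lambda>z. 0) = poly_eval 0" by (simp add: poly_eval_def fun_eq_iff)
  then show ?case by auto
next
  case (insert i I)
  then obtain p q where "f i = poly_eval p" "(\<lambda>z. \<Sum>i\<in>I. f i z) = poly_eval q" by blast
  then have "(\<lambda>z. \<Sum>i\<in>insert i I. f i z) = poly_eval (p + q)"
    using insert.hyps by (simp add: fun_eq_iff poly_eval_add)
  then show ?case by blast
qed

lemma range_poly_eval: "range poly_eval = polyfun"
proof (intro equalityI subsetI)
  fix f :: "complex^'d \<Rightarrow> complex" assume "f \<in> range poly_eval"
  then obtain p where p: "f = poly_eval p" by blast
  show "f \<in> polyfun"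
    unfolding p poly_eval_def[abs_def] by (intro polyfun_intros)
next
  fix f :: "complex^'d \<Rightarrow> complex" assume "f \<in> polyfun"
  then show "f \<in> range poly_eval"
  proof induction
    case (polyfun_const c)
    have "(\<lambda>_. c) = poly_eval (Poly_Mapping.single 0 c)"
      by (simp add: fun_eq_iff poly_eval_single monomial_def)
    then show ?case by blast
  next
    case (polyfun_coord i)
    have "monomial (Poly_Mapping.single i 1) z = (\<Prod>j\<in>UNIV. if j = i then z $ i else 1)" for z :: "complex^'d"
      unfolding monomial_def by (intro prod.cong) (auto simp: lookup_single)
    then have "(\<lambda>z. z $ i) = poly_eval (Poly_Mapping.single (Poly_Mapping.single i 1) 1)"
      by (simp add: fun_eq_iff poly_eval_single)
    then show ?case by blast
  next
    case (polyfun_add f g)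
    then obtain p q where "f = poly_eval p" "g = poly_eval q" by blast
    then have "(\<lambda>z. f z + g z) = poly_eval (p + q)" by (simp add: poly_eval_add fun_eq_iff)
    then show ?case by blast
  next
    case (polyfun_mult f g)
    then obtain p q where pq: "f = poly_eval p" "g = poly_eval q" by blast
    let ?P = "Poly_Mapping.keys p" and ?Q = "Poly_Mapping.keys q"
    have "f z * g z = (\<Sum>(m, n)\<in>?P \<times> ?Q. poly_eval (Poly_Mapping.single (m + n)
        (Poly_Mapping.lookup p m * Poly_Mapping.lookup q n)) z)" for z
    proof -
      have "f z * g z = (\<Sum>m\<in>?P. \<Sum>n\<in>?Q. (Poly_Mapping.lookup p m * monomial m z) * (Poly_Mapping.lookup q n * monomial n z))"
        unfolding pq poly_eval_def monomial_def[symmetric] by (rule sum_product)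
      also have "\<dots> = (\<Sum>m\<in>?P. \<Sum>n\<in>?Q. poly_eval (Poly_Mapping.single (m + n)
        (Poly_Mapping.lookup p m * Poly_Mapping.lookup q n)) z)"
        by (simp add: poly_eval_single monomial_add mult_ac)
      finally show ?thesis by (simp add: sum.cartesian_product)
    qed
    then have "(\<lambda>z. f z * g z) = (\<lambda>z. \<Sum>x\<in>?P \<times> ?Q. poly_eval (Poly_Mapping.single (fst x + snd x)
        (Poly_Mapping.lookup p (fst x) * Poly_Mapping.lookup q (snd x))) z)"
      by (simp add: fun_eq_iff case_prod_beta)
    also have "\<dots> \<in> range poly_eval"
      by (rule sum_in_range_poly_eval) auto
    finally show ?case .
  qed
qed

section \<open>Jacobian matrices and zero sets of polynomials\<close>

definition jacobian_matrix :: "(complex^'d \<Rightarrow> complex^'d) \<Rightarrow> complex^'d \<Rightarrow> complex^'d^'d" where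
  "jacobian_matrix f z = (\<chi> i j. deriv (\<lambda>t. f (z + t *s axis j 1) $ i) 0)"

lemma complex_jacobian_eq_det: "complex_jacobian f z = det (jacobian_matrix f z)"
  by (simp add: complex_jacobian_def jacobian_matrix_def)

lemma has_derivative_jacobian_matrix:
  fixes f :: "complex^'d \<Rightarrow> complex^'d"
  assumes hol: "\<And>i. holomorphic_several (\<lambda>z. f z $ i) D" and z: "z \<in> D"
  shows "(f has_derivative (*v) (jacobian_matrix f z)) (at z)"
proof -
  let ?F = "\<lambda>i. frechet_derivative (\<lambda>z. f z $ i) (at z)"
  have F: "?F i v = (jacobian_matrix f z *v v) $ i" for i v
  proof -
    have lin: "bounded_linear (?F i)"
      using holomorphic_severalD(1)[OF hol z] by (rule has_derivative_bounded_linear)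
    have d: "deriv (\<lambda>t. f (z + t *s axis j 1) $ i) 0 = ?F i (axis j 1)" for j
      using has_field_derivative_on_line[OF hol, of z 0 "axis j 1" i] z by (simp add: DERIV_imp_deriv)
    have "?F i v = ?F i (\<Sum>j\<in>UNIV. v $ j *s axis j 1)"
      by (simp add: basis_expansion)
    also have "\<dots> = (\<Sum>j\<in>UNIV. v $ j * ?F i (axis j 1))"
      by (simp add: linear_sum[OF bounded_linear.linear[OF lin]] holomorphic_severalD(2)[OF hol z])
    finally show ?thesis
      by (simp add: matrix_vector_mult_def jacobian_matrix_def d mult.commute)
  qed
  have "((\<lambda>x. f x \<bullet> \<beta>) has_derivative (\<lambda>v. (jacobian_matrix f z *v v) \<bullet> \<beta>)) (at z)" if "\<beta> \<in> Basis" for \<beta>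
  proof -
    from that obtain i c where "\<beta> = axis i c" by (auto simp: Basis_vec_def)
    moreover have "((\<lambda>x. f x $ i \<bullet> c) has_derivative (\<lambda>v. (jacobian_matrix f z *v v) $ i \<bullet> c)) (at z)"
      using bounded_linear.has_derivative[OF bounded_linear_inner_left holomorphic_severalD(1)[OF hol z]]
      by (simp add: F)
    ultimately show ?thesis by (simp add: inner_axis)
  qed
  then show ?thesis by (subst has_derivative_componentwise_within) blast
qed

lemma matrix_vector_smult: "(A :: complex^'d^'d) *v (c *s v) = c *s (A *v v)"
  by (simp add: vec_eq_iff matrix_vector_mult_def sum_distrib_left mult_ac)

lemma bounded_linear_matrix: "bounded_linear ((*v) (A :: complex^'d^'d))"
  unfolding linear_conv_bounded_linear[symmetric]
  by (rule linearI) (simp add: matrix_vector_right_distrib, simp add: matrix_vector_mult_def vec_eq_iff scaleR_sum_right)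

text \<open>The inverse function theorem. The inverse of a complex linear bijection is complex linear, so the
local inverse is holomorphic.\<close>

lemma holomorphic_local_inverse:
  fixes f :: "complex^'d \<Rightarrow> complex^'d"
  assumes hol: "\<And>i. holomorphic_several (\<lambda>z. f z $ i) D" and D: "open D" and z: "z \<in> D"
    and cont: "\<And>i j. continuous_on D (\<lambda>z. jacobian_matrix f z $ i $ j)"
    and J: "complex_jacobian f z \<noteq> 0"
  obtains U V g g' where "open U" "U \<subseteq> D" "z \<in> U" "open V" "homeomorphism U V f g"
    "\<And>y. y \<in> V \<Longrightarrow> (g has_derivative g' y) (at y)"
    "\<And>y c v. y \<in> V \<Longrightarrow> g' y (c *s v) = c *s g' y v"
proof -
  define F where "F x = Blinfun ((*v) (jacobian_matrix f x))" for x
  have F: "blinfun_apply (F x) = (*v) (jacobian_matrix f x)" for x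
    by (simp add: F_def bounded_linear_Blinfun_apply[OF bounded_linear_matrix])
  have contJ: "continuous_on D (\<lambda>x. jacobian_matrix f x *v v)" for v
  proof -
    have "continuous_on D (\<lambda>x. \<chi> i. \<Sum>j\<in>UNIV. jacobian_matrix f x $ i $ j * v $ j)"
      by (intro continuous_on_vec_lambda continuous_on_sum continuous_on_mult cont continuous_on_const)
    then show ?thesis by (simp add: matrix_vector_mult_def)
  qed
  have contF: "continuous_on D F"
    unfolding continuous_on_def
  proof
    fix x assume x: "x \<in> D"
    have "continuous (at x within D) F"
    proof (rule continuous_blinfun_componentwiseI1)
      fix i :: "complex^'d"
      show "continuous (at x within D) (\<lambda>x. blinfun_apply (F x) i)"
        using contJ[of i] x by (simp add: F continuous_on_eq_continuous_within)
    qed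
    then show "(F \<longlongrightarrow> F x) (at x within D)" by (simp add: continuous_within)
  qed
  have "invertible (jacobian_matrix f z)"
    using J by (simp add: complex_jacobian_eq_det invertible_det_nz)
  then obtain B where B: "B ** jacobian_matrix f z = mat 1" by (auto simp: invertible_def)
  define invf where "invf = Blinfun ((*v) B)"
  have inv: "invf o\<^sub>L F z = id_blinfun"
    by (rule blinfun_eqI) (simp add: F invf_def bounded_linear_Blinfun_apply[OF bounded_linear_matrix]
        matrix_vector_mul_assoc B)
  have der: "(f has_derivative blinfun_apply (F x)) (at x)" if "x \<in> D" for x
    unfolding F by (rule has_derivative_jacobian_matrix[OF hol that])
  show thesis
  proof (rule inverse_function_theorem[OF D der contF z inv])
  fix U V g g'
  assume UV: "open U" "U \<subseteq> D" "z \<in> U" "open V" "homeomorphism U V f g"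
    "\<And>y. y \<in> V \<Longrightarrow> (g has_derivative (g' y)) (at y)"
    "\<And>y. y \<in> V \<Longrightarrow> g' y = inv_into UNIV (blinfun_apply (F (g y)))"
    "\<And>y. y \<in> V \<Longrightarrow> bij (blinfun_apply (F (g y)))"
  have g'_smult: "g' y (c *s v) = c *s g' y v" if y: "y \<in> V" for y c v
  proof -
    let ?A = "jacobian_matrix f (g y)"
    have bij: "bij ((*v) ?A)" using UV(8)[OF y] by (simp add: F)
    have g': "g' y = inv_into UNIV ((*v) ?A)" using UV(7)[OF y] by (simp add: F)
    have "?A *v (c *s g' y v) = c *s v"
      using bij unfolding g' by (simp add: matrix_vector_smult bij_is_surj surj_f_inv_f)
    then show ?thesis
      using bij unfolding g' by (metis bij_is_inj inv_f_f)
  qed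
  show thesis
    by (rule that[where g' = g', OF UV(1-5)]) (use UV(6) g'_smult in simp_all)
  qed
qed

text \<open>On the complex line from \<open>a\<close> to \<open>b\<close> the function is a nonzero polynomial in one variable, so it has
only finitely many zeros there.\<close>

lemma polyfun_nonzero_near:
  assumes f: "f \<in> polyfun" "f b \<noteq> 0" and S: "open S" "a \<in> S"
  shows "\<exists>x\<in>S. f x \<noteq> 0"
proof -
  obtain q where q: "\<And>t. f (a + t *s (b - a)) = poly q t"
    using polyfun_on_line[OF f(1)] by metis
  have "poly q 1 \<noteq> 0" using q[of 1] f(2) by simp
  then have "q \<noteq> 0" by auto
  then have fin: "finite {t. poly q t = 0}" by (rule poly_roots_finite)
  have "continuous_on UNIV (\<lambda>t. a + t *s (b - a))"
    by (intro continuous_intros)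
  then have "open ((\<lambda>t. a + t *s (b - a)) -` S)"
    using S(1) by (intro open_vimage)
  moreover have "0 \<in> (\<lambda>t. a + t *s (b - a)) -` S" using S(2) by simp
  ultimately have "infinite ((\<lambda>t. a + t *s (b - a)) -` S)"
    by (metis empty_iff finite_imp_not_open)
  then have "\<not> (\<lambda>t. a + t *s (b - a)) -` S \<subseteq> {t. poly q t = 0}"
    using fin finite_subset by blast
  then obtain t where "a + t *s (b - a) \<in> S" "poly q t \<noteq> 0" by blast
  then show ?thesis using q[of t] by metis
qed

lemma polyfun_nonzero_mult:
  assumes f: "f \<in> polyfun" "f a \<noteq> 0" and g: "g \<in> polyfun" "g b \<noteq> 0"
  shows "\<exists>x. f x * g x \<noteq> 0"
proof -
  have "open {x. f x \<noteq> 0}"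
    using holomorphic_several_continuous_on[OF holomorphic_several_polyfun[OF f(1), of UNIV]]
    by (intro open_Collect_neq continuous_on_const)
  from polyfun_nonzero_near[OF g this] f(2) show ?thesis by auto
qed

lemma polyfun_nonzero_prod:
  assumes "finite I" "\<And>i. i \<in> I \<Longrightarrow> f i \<in> polyfun" "\<And>i. i \<in> I \<Longrightarrow> \<exists>z. f i z \<noteq> 0"
  shows "\<exists>z. (\<Prod>i\<in>I. f i z) \<noteq> 0"
  using assms
proof (induction I rule: finite_induct)
  case (insert i I)
  then obtain a b where "f i a \<noteq> 0" "(\<Prod>i\<in>I. f i b) \<noteq> 0" by blast
  with polyfun_nonzero_mult[of "f i" a "\<lambda>z. \<Prod>i\<in>I. f i z" b] insert
  show ?case by (auto intro: polyfun_prod)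
qed simp

lemma polyfun_continuous_on: "f \<in> polyfun \<Longrightarrow> continuous_on D f"
  by (rule holomorphic_several_continuous_on[OF holomorphic_several_polyfun])

text \<open>Two points of the set are joined within the complex line through them, from which only finitely many
points are removed.\<close>

lemma connected_polyfun_nonzero:
  fixes f :: "complex^'d \<Rightarrow> complex"
  assumes f: "f \<in> polyfun"
  shows "connected {x. f x \<noteq> 0}"
proof (subst connected_iff_connected_component, intro ballI)
  fix a b assume "a \<in> {x. f x \<noteq> 0}" "b \<in> {x. f x \<noteq> 0}"
  then have ab: "f a \<noteq> 0" "f b \<noteq> 0" by auto
  obtain q where q: "\<And>t. f (a + t *s (b - a)) = poly q t"
    using polyfun_on_line[OF f] by metis
  have "poly q 1 \<noteq> 0" using q[of 1] ab by simp
  then have "q \<noteq> 0" by auto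
  then have "countable {t. poly q t = 0}" by (intro countable_finite poly_roots_finite)
  then have "connected (- {t. poly q t = 0})"
    by (intro path_connected_imp_connected path_connected_complement_countable) auto
  then have "connected ((\<lambda>t. a + t *s (b - a)) ` (- {t. poly q t = 0}))"
    by (intro connected_continuous_image continuous_intros)
  moreover have "(\<lambda>t. a + t *s (b - a)) ` (- {t. poly q t = 0}) \<subseteq> {x. f x \<noteq> 0}"
    using q by auto
  moreover have "a \<in> (\<lambda>t. a + t *s (b - a)) ` (- {t. poly q t = 0})"
    using q[of 0] ab by (intro image_eqI[of _ _ 0]) auto
  moreover have "b \<in> (\<lambda>t. a + t *s (b - a)) ` (- {t. poly q t = 0})"
    using q[of 1] ab by (intro image_eqI[of _ _ 1]) auto
  ultimately show "connected_component {x. f x \<noteq> 0} a b"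
    unfolding connected_component_def by blast
qed

section \<open>Orbits and the Jacobian of a basic map\<close>

lemma matrix_inv_mult:
  assumes "invertible (A :: complex^'d^'d)"
  shows "A ** matrix_inv A = mat 1" "matrix_inv A ** A = mat 1"
proof -
  have "A ** matrix_inv A = mat 1 \<and> matrix_inv A ** A = mat 1"
    using assms unfolding invertible_def matrix_inv_def by (rule someI_ex)
  then show "A ** matrix_inv A = mat 1" "matrix_inv A ** A = mat 1" by auto
qed

text \<open>The relation between \<open>G\<close> and \<open>\<theta>\<close> in the form in which it is applied. The group is described by matrix multiplication, which avoids the
passage to inverses in the definition of the action.\<close>

locale basic_map =
  fixes G :: "(complex^'d^'d) set" and \<theta> :: "complex^'d \<Rightarrow> complex^'d"
  assumes finite_G: "finite G" and one_mem: "mat 1 \<in> G"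
    and mult_mem: "A \<in> G \<Longrightarrow> B \<in> G \<Longrightarrow> A ** B \<in> G"
    and inverse_mem: "A \<in> G \<Longrightarrow> \<exists>B\<in>G. A ** B = mat 1 \<and> B ** A = mat 1"
    and theta_poly: "(\<lambda>z. \<theta> z $ i) \<in> polyfun"
    and theta_invariant: "A \<in> G \<Longrightarrow> \<theta> (A *v z) = \<theta> z"
    and invariant_factors: "f \<in> polyfun \<Longrightarrow> (\<And>A z. A \<in> G \<Longrightarrow> f (A *v z) = f z) \<Longrightarrow>
      \<exists>q\<in>polyfun. \<forall>z. f z = q (\<theta> z)"

lemma basic_map_of_reflection_group:
  fixes G :: "(complex^'d^'d) set"
  assumes G: "finite_complex_reflection_group G" and \<theta>: "basic_polynomial_map G \<theta>"
  shows "basic_map G \<theta>"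
proof -
  interpret GL: group "general_linear :: (complex^'d^'d) monoid" by (rule group_general_linear)
  have sub: "subgroup G general_linear" and fin: "finite G"
    using G by (auto simp: finite_complex_reflection_group_def)
  have inv: "invertible A" if "A \<in> G" for A
    using subgroup.mem_carrier[OF sub that] by simp
  have inverse: "matrix_inv A \<in> G" "A ** matrix_inv A = mat 1" "matrix_inv A ** A = mat 1" if "A \<in> G" for A
  proof -
    show "matrix_inv A \<in> G"
      using subgroup.m_inv_closed[OF sub that] inv_general_linear[OF inv[OF that]] by simp
    show "A ** matrix_inv A = mat 1" "matrix_inv A ** A = mat 1"
      using inv[OF that] by (simp_all add: matrix_inv_mult)
  qed
  have act: "\<exists>B\<in>G. \<forall>z. act B z = A *v z" if "A \<in> G" for A
  proof (intro bexI allI)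
    show "matrix_inv A \<in> G" using inverse that by blast
    fix z
    have "matrix_inv (matrix_inv A) = A"
      using inverse(2,3)[OF that] inverse(1)[OF that] inverse(2)[OF inverse(1)[OF that]]
      by (metis matrix_mul_assoc matrix_mul_lid matrix_mul_rid)
    then show "act (matrix_inv A) z = A *v z" by (simp add: act_def)
  qed
  have invariants: "invariant_polynomials G = range (\<lambda>q z. poly_eval q (\<theta> z))"
    using \<theta> by (simp add: basic_polynomial_map_def)
  show ?thesis
  proof
    show "finite G" by (rule fin)
    show "mat 1 \<in> G" using subgroup.one_closed[OF sub] by simp
    show "A ** B \<in> G" if "A \<in> G" "B \<in> G" for A B
      using subgroup.m_closed[OF sub that] by simp
    show "\<exists>B\<in>G. A ** B = mat 1 \<and> B ** A = mat 1" if "A \<in> G" for A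
      using inverse[OF that] by blast
    show "(\<lambda>z. \<theta> z $ i) \<in> polyfun" for i
      using \<theta> unfolding basic_polynomial_map_def range_poly_eval[symmetric] by blast
    show "\<theta> (A *v z) = \<theta> z" if A: "A \<in> G" for A z
    proof -
      obtain B where B: "B \<in> G" "\<And>z. act B z = A *v z" using act[OF A] by blast
      have "\<theta> (act B z) $ i = \<theta> z $ i" for i
      proof -
        have "(\<lambda>u::complex^'d. u $ i) \<in> range poly_eval"
          unfolding range_poly_eval by (rule polyfun_coord)
        then obtain q where q: "(\<lambda>u::complex^'d. u $ i) = poly_eval q" by blast
        have "(\<lambda>z. poly_eval q (\<theta> z)) \<in> invariant_polynomials G"
          unfolding invariants by blast
        then show ?thesis using B(1) unfolding q[symmetric] invariant_polynomials_def by blast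
      qed
      then show ?thesis by (simp add: vec_eq_iff B(2))
    qed
    show "\<exists>q\<in>polyfun. \<forall>z. f z = q (\<theta> z)"
      if f: "f \<in> polyfun" "\<And>A z. A \<in> G \<Longrightarrow> f (A *v z) = f z" for f
    proof -
      have "f \<in> invariant_polynomials G"
        using f inverse(1) by (auto simp: invariant_polynomials_def act_def range_poly_eval)
      then obtain q where "f = (\<lambda>z. poly_eval q (\<theta> z))" unfolding invariants by blast
      then show ?thesis by (intro bexI[of _ "poly_eval q"]) (auto simp: range_poly_eval[symmetric])
    qed
  qed
qed

lemma group_invariant_mult_mem:
  assumes "finite_complex_reflection_group G" "group_invariant G D" "A \<in> G" "z \<in> D"
  shows "A *v z \<in> D"
proof -
  have sub: "subgroup G general_linear"
    using assms(1) by (auto simp: finite_complex_reflection_group_def)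
  have "invertible A" using subgroup.mem_carrier[OF sub assms(3)] by simp
  obtain w where w: "w \<in> D" "z = act A w"
    using assms(2-4) unfolding group_invariant_def by blast
  have "A *v z = w"
    using \<open>invertible A\<close> by (simp add: w(2) act_def matrix_vector_mul_assoc matrix_inv_mult)
  then show ?thesis using w by simp
qed

context basic_map
begin

lemma bij_betw_mult_right:
  assumes "B \<in> G"
  shows "bij_betw (\<lambda>A. A ** B) G G"
proof -
  obtain C where C: "C \<in> G" "B ** C = mat 1" "C ** B = mat 1" using inverse_mem[OF assms] by blast
  show ?thesis
    by (rule bij_betwI[where g = "\<lambda>A. A ** C"])
      (use C assms mult_mem in \<open>auto simp: matrix_mul_assoc[symmetric]\<close>)
qed

lemma sum_orbit: "B \<in> G \<Longrightarrow> (\<Sum>A\<in>G. f (A *v (B *v z))) = (\<Sum>A\<in>G. f (A *v z))"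
  using sum.reindex_bij_betw[OF bij_betw_mult_right, of B "\<lambda>A. f (A *v z)"]
  by (simp add: matrix_vector_mul_assoc)

lemma prod_orbit: "B \<in> G \<Longrightarrow> (\<Prod>A\<in>G. f (A *v (B *v z))) = (\<Prod>A\<in>G. f (A *v z))"
  using prod.reindex_bij_betw[OF bij_betw_mult_right, of B "\<lambda>A. f (A *v z)"]
  by (simp add: matrix_vector_mul_assoc)

text \<open>If \<open>w\<close> is not in the orbit of \<open>z\<close>, some polynomial \<open>q\<close> vanishes on that orbit but not at \<open>w\<close>. The
product of \<open>1 - q (B x) / q w\<close> over \<open>B\<close> in \<open>G\<close> is invariant and equals \<open>1\<close> at \<open>z\<close> and \<open>0\<close> at \<open>w\<close>;
it factors through \<open>\<theta>\<close>, so \<open>\<theta> z \<noteq> \<theta> w\<close>. A product is used because in a sum over \<open>G\<close> the values at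
the different points of the orbit of \<open>w\<close> could cancel.\<close>

lemma theta_separates_orbits:
  assumes eq: "\<theta> z = \<theta> w"
  shows "\<exists>A\<in>G. w = A *v z"
proof (rule ccontr)
  assume not: "\<not> ?thesis"
  then have "\<exists>i. w $ i \<noteq> (A *v z) $ i" if "A \<in> G" for A
    using that by (auto simp: vec_eq_iff)
  then obtain i where i: "\<And>A. A \<in> G \<Longrightarrow> w $ i A \<noteq> (A *v z) $ i A" by metis
  define q where "q x = (\<Prod>A\<in>G. (x $ i A - (A *v z) $ i A))" for x
  have q_poly: "q \<in> polyfun" unfolding q_def[abs_def] by (intro polyfun_intros)
  have q0: "q (A *v z) = 0" if "A \<in> G" for A
    unfolding q_def by (rule prod_zero[OF finite_G]) (use that in auto)
  have qw: "q w \<noteq> 0" using i by (simp add: q_def finite_G)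
  define p where "p x = (\<Prod>B\<in>G. (1 - (1 / q w) * q (B *v x)))" for x
  have "p \<in> polyfun" unfolding p_def[abs_def] by (intro polyfun_intros polyfun_matrix q_poly)
  moreover have "p (A *v x) = p x" if "A \<in> G" for A x
    unfolding p_def using prod_orbit[OF that, of "\<lambda>x. 1 - (1 / q w) * q x"] .
  ultimately obtain r where "\<And>x. p x = r (\<theta> x)" using invariant_factors by blast
  then have "p z = p w" using eq by simp
  moreover have "p z = 1" unfolding p_def using q0 by simp
  moreover have "p w = 0"
    unfolding p_def by (rule prod_zero[OF finite_G]) (use one_mem qw in \<open>auto intro!: bexI[of _ "mat 1"]\<close>)
  ultimately show False by simp
qed

lemma theta_eq_iff: "\<theta> z = \<theta> w \<longleftrightarrow> (\<exists>A\<in>G. w = A *v z)"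
  using theta_separates_orbits theta_invariant by metis

lemma theta_holomorphic: "holomorphic_several (\<lambda>z. \<theta> z $ i) D"
  by (rule holomorphic_several_polyfun[OF theta_poly])

lemma theta_has_derivative: "(\<theta> has_derivative (*v) (jacobian_matrix \<theta> z)) (at z)"
  by (rule has_derivative_jacobian_matrix[of _ UNIV]) (auto intro: theta_holomorphic)

lemma theta_continuous_on: "continuous_on D \<theta>"
  by (meson continuous_at_imp_continuous_on has_derivative_continuous theta_has_derivative)

lemma jacobian_matrix_polyfun: "(\<lambda>z. jacobian_matrix \<theta> z $ i $ j) \<in> polyfun"
proof -
  obtain g where g: "g \<in> polyfun" "\<And>z. ((\<lambda>t. \<theta> (z + t *s axis j 1) $ i) has_field_derivative g z) (at 0)"
    using polyfun_directional_derivative[OF theta_poly, of "axis j 1" i] by blast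
  then have "(\<lambda>z. jacobian_matrix \<theta> z $ i $ j) = g"
    by (auto simp: jacobian_matrix_def fun_eq_iff intro!: DERIV_imp_deriv)
  then show ?thesis using g by simp
qed

lemma complex_jacobian_polyfun: "complex_jacobian \<theta> \<in> polyfun"
  unfolding complex_jacobian_eq_det[abs_def] det_def
  by (intro polyfun_intros jacobian_matrix_polyfun)

text \<open>The chain rule applied to \<open>\<theta> (A z) = \<theta> z\<close>.\<close>

lemma complex_jacobian_equivariant:
  assumes "A \<in> G"
  shows "complex_jacobian \<theta> (A *v z) * det A = complex_jacobian \<theta> z"
proof -
  have "((\<lambda>x. \<theta> (A *v x)) has_derivative (\<lambda>v. jacobian_matrix \<theta> (A *v z) *v (A *v v))) (at z)"
    by (rule has_derivative_compose[OF bounded_linear_imp_has_derivative[OF bounded_linear_matrix] theta_has_derivative])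
  then have "(\<theta> has_derivative (*v) (jacobian_matrix \<theta> (A *v z) ** A)) (at z)"
    by (simp add: theta_invariant[OF assms] matrix_vector_mul_assoc)
  then have "(*v) (jacobian_matrix \<theta> (A *v z) ** A) = (*v) (jacobian_matrix \<theta> z)"
    using theta_has_derivative has_derivative_unique by blast
  then have "jacobian_matrix \<theta> (A *v z) ** A = jacobian_matrix \<theta> z"
    by (simp add: matrix_eq fun_eq_iff)
  then show ?thesis by (metis complex_jacobian_eq_det det_mul)
qed

text \<open>If the derivative of \<open>\<theta>\<close> at \<open>z\<close> annihilates \<open>v \<noteq> 0\<close>, then so does the derivative at \<open>z\<close> of every
invariant polynomial. But when the stabilizer of \<open>z\<close> is trivial, there is a polynomial \<open>f\<close> which
near \<open>z\<close> agrees to first order with \<open>x \<mapsto> x $ k - z $ k\<close>, where \<open>v $ k \<noteq> 0\<close>, and which vanishes to second order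
at the other points of the orbit. The sum of \<open>f\<close> over \<open>G\<close> is invariant with derivative \<open>v $ k\<close> at
\<open>z\<close> in direction \<open>v\<close>.\<close>

lemma complex_jacobian_nonzero:
  assumes free: "\<And>A. A \<in> G \<Longrightarrow> A *v z = z \<Longrightarrow> A = mat 1"
  shows "complex_jacobian \<theta> z \<noteq> 0"
proof
  assume "complex_jacobian \<theta> z = 0"
  then have "\<not> invertible (jacobian_matrix \<theta> z)"
    by (simp add: complex_jacobian_eq_det invertible_det_nz)
  then obtain v where v: "jacobian_matrix \<theta> z *v v = 0" "v \<noteq> 0"
    using matrix_left_invertible_ker invertible_left_inverse by metis
  then obtain k where k: "v $ k \<noteq> 0" by (auto simp: vec_eq_iff)
  have "\<exists>i. z $ i \<noteq> (A *v z) $ i" if "A \<in> G - {mat 1}" for A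
    using free that by (metis Diff_iff insertCI vec_eq_iff)
  then obtain i where i: "\<And>A. A \<in> G - {mat 1} \<Longrightarrow> z $ i A \<noteq> (A *v z) $ i A" by metis
  \<comment> \<open>\<open>h\<close> has the value \<open>1\<close> at \<open>z\<close> and vanishes at the other points of the orbit, so its square vanishes there to second order.\<close>
  define h where "h x = (\<Prod>A\<in>G - {mat 1}. (1 / (z $ i A - (A *v z) $ i A)) * (x $ i A - (A *v z) $ i A))" for x
  define f where "f x = (x $ k - z $ k) * (h x * h x)" for x
  have h_poly: "h \<in> polyfun" unfolding h_def[abs_def] by (intro polyfun_intros)
  have f_poly: "f \<in> polyfun" unfolding f_def[abs_def] by (intro polyfun_intros h_poly)
  have hz: "h z = 1" using i by (auto simp: h_def intro!: prod.neutral)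
  have h0: "h (A *v z) = 0" if "A \<in> G" "A \<noteq> mat 1" for A
    unfolding h_def by (rule prod_zero) (use that finite_G in auto)
  let ?h' = "\<lambda>x. frechet_derivative h (at x)"
  define f' where "f' x w = (x $ k - z $ k) * (h x * ?h' x w + ?h' x w * h x) + w $ k * (h x * h x)" for x w
  have dh: "(h has_derivative ?h' x) (at x)" for x
    using holomorphic_severalD(1)[OF holomorphic_several_polyfun[OF h_poly, of UNIV]] by blast
  have df: "(f has_derivative f' x) (at x)" for x
  proof -
    have "((\<lambda>x. x $ k - z $ k) has_derivative (\<lambda>w. w $ k)) (at x)"
      by (auto intro!: derivative_eq_intros bounded_linear_imp_has_derivative bounded_linear_vec_nth)
    from has_derivative_mult[OF this has_derivative_mult[OF dh dh]]
    show ?thesis unfolding f_def[abs_def] f'_def[abs_def] .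
  qed
  define p where "p x = (\<Sum>A\<in>G. f (A *v x))" for x
  have "p \<in> polyfun" unfolding p_def[abs_def] by (intro polyfun_intros polyfun_matrix f_poly)
  moreover have "p (A *v x) = p x" if "A \<in> G" for A x
    unfolding p_def using sum_orbit[OF that] .
  ultimately obtain q where q: "q \<in> polyfun" "\<And>x. p x = q (\<theta> x)" using invariant_factors by blast
  have "(p has_derivative (\<lambda>w. \<Sum>A\<in>G. f' (A *v z) (A *v w))) (at z)"
    unfolding p_def[abs_def]
    by (intro has_derivative_sum has_derivative_compose[OF bounded_linear_imp_has_derivative[OF bounded_linear_matrix] df])
  moreover have "(p has_derivative (\<lambda>w. frechet_derivative q (at (\<theta> z)) (jacobian_matrix \<theta> z *v w))) (at z)"
  proof -
    have "p = (\<lambda>x. q (\<theta> x))" using q(2) by blast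
    then show ?thesis
      using has_derivative_compose[OF theta_has_derivative
          holomorphic_severalD(1)[OF holomorphic_several_polyfun[OF q(1), of UNIV]]] by simp
  qed
  ultimately have "(\<lambda>w. \<Sum>A\<in>G. f' (A *v z) (A *v w)) = (\<lambda>w. frechet_derivative q (at (\<theta> z)) (jacobian_matrix \<theta> z *v w))"
    by (rule has_derivative_unique)
  then have "(\<Sum>A\<in>G. f' (A *v z) (A *v v)) = frechet_derivative q (at (\<theta> z)) 0"
    using v(1) by metis
  also have "\<dots> = 0"
    using holomorphic_severalD(1)[OF holomorphic_several_polyfun[OF q(1), of UNIV], of "\<theta> z"]
    by (auto dest!: has_derivative_bounded_linear simp: linear_simps)
  finally have "(\<Sum>A\<in>G. f' (A *v z) (A *v v)) = 0" .
  moreover have "(\<Sum>A\<in>G. f' (A *v z) (A *v v)) = f' z v"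
  proof -
    have "(\<Sum>A\<in>G. f' (A *v z) (A *v v)) = (\<Sum>A\<in>{mat 1}. f' (A *v z) (A *v v))"
      using finite_G one_mem h0 by (intro sum.mono_neutral_right) (auto simp: f'_def)
    then show ?thesis by simp
  qed
  moreover have "f' z v = v $ k" by (simp add: f'_def hz)
  ultimately show False using k by simp
qed

end

section \<open>Basic maps are proper, surjective and open\<close>

lemma root_bound:
  fixes x :: complex
  assumes root: "x ^ n = - (\<Sum>k<n. c k * x ^ k)" and c: "\<And>k. k < n \<Longrightarrow> cmod (c k) \<le> M" and n: "n > 0"
  shows "cmod x \<le> max 1 (real n * M)"
proof (cases "cmod x \<le> 1")
  case False
  then have x1: "cmod x > 1" by simp
  have M: "M \<ge> 0" using c[OF n] norm_ge_zero[of "c 0"] by linarith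
  have "cmod x ^ n \<le> (\<Sum>k<n. cmod (c k) * cmod x ^ k)"
    unfolding norm_power[symmetric] root norm_minus_cancel
    by (rule order_trans[OF norm_sum]) (simp add: norm_mult norm_power)
  also have "\<dots> \<le> (\<Sum>k<n. M * cmod x ^ (n - 1))"
    using c x1 M by (intro sum_mono mult_mono power_increasing) auto
  also have "\<dots> = real n * M * cmod x ^ (n - 1)" by simp
  finally have "cmod x * cmod x ^ (n - 1) \<le> real n * M * cmod x ^ (n - 1)"
    using n by (cases n) auto
  moreover have "cmod x ^ (n - 1) > 0" using x1 by (intro zero_less_power) linarith
  ultimately show ?thesis by (simp add: mult_le_cancel_right)
qed simp

text \<open>The elementary symmetric functions of polynomial functions are polynomial functions.\<close>

lemma polyfun_coeff_prod:
  assumes "finite S" "\<And>s. s \<in> S \<Longrightarrow> a s \<in> polyfun"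
  shows "(\<lambda>z. coeff (\<Prod>s\<in>S. [:- a s z, 1:]) k) \<in> polyfun"
  using assms
proof (induction S arbitrary: k rule: finite_induct)
  case empty
  show ?case by (simp add: coeff_1 polyfun_const)
next
  case (insert s S)
  have "(\<lambda>z. coeff (\<Prod>s\<in>insert s S. [:- a s z, 1:]) k) =
    (\<lambda>z. (-1) * a s z * coeff (\<Prod>s\<in>S. [:- a s z, 1:]) k +
      (case k of 0 \<Rightarrow> 0 | Suc j \<Rightarrow> coeff (\<Prod>s\<in>S. [:- a s z, 1:]) j))"
    using insert.hyps by (auto simp: coeff_pCons split: nat.split)
  moreover have "(\<lambda>z. case k of 0 \<Rightarrow> 0 | Suc j \<Rightarrow> coeff (\<Prod>s\<in>S. [:- a s z, 1:]) j) \<in> polyfun"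
    using insert by (cases k) (auto intro: polyfun_const)
  ultimately show ?case
    using insert by (simp only:) (intro polyfun_add polyfun_mult polyfun_const; simp)
qed

lemma negligible_linear_kernel:
  fixes f :: "'a::euclidean_space \<Rightarrow> 'b::real_vector"
  assumes f: "linear f" and b: "f b \<noteq> 0"
  shows "negligible {z. f z = 0}"
proof (rule negligible_lowdim, rule ccontr)
  assume "\<not> dim {z. f z = 0} < DIM('a)"
  then have "{z. f z = 0} = UNIV"
    by (intro subspace_dim_equal subspace_UNIV linear_subspace_kernel f) (auto simp: dim_UNIV)
  then show False using b by auto
qed

context basic_map
begin

text \<open>The coordinate \<open>z $ i\<close> is a root of the monic polynomial \<open>\<Prod>_A (X - (A z) $ i)\<close>. Its coefficients are
invariant polynomials in \<open>z\<close>, hence polynomials in \<open>\<theta> z\<close>, and so they are bounded when \<open>\<theta> z\<close> stays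
in a bounded set. Therefore \<open>\<theta>\<close> is proper.\<close>

lemma bounded_theta_vimage:
  assumes K: "bounded K"
  shows "bounded (\<theta> -` K)"
proof -
  let ?n = "card G"
  have n: "?n > 0" using finite_G one_mem card_gt_0_iff by blast
  have "\<exists>B. \<forall>z\<in>\<theta> -` K. cmod (z $ i) \<le> B" for i
  proof -
    define P where "P z = (\<Prod>A\<in>G. [:- (A *v z) $ i, 1:])" for z
    have coeff_poly: "(\<lambda>z. coeff (P z) k) \<in> polyfun" for k
      unfolding P_def using polyfun_matrix[OF polyfun_coord] by (intro polyfun_coeff_prod finite_G)
    have "P (B *v z) = P z" if "B \<in> G" for B z
      unfolding P_def by (rule prod_orbit[OF that])
    then have "\<exists>q\<in>polyfun. \<forall>z. coeff (P z) k = q (\<theta> z)" for k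
      using coeff_poly by (intro invariant_factors) auto
    then obtain q where q: "\<And>k. q k \<in> polyfun" "\<And>k z. coeff (P z) k = q k (\<theta> z)" by metis
    have "\<exists>M. \<forall>u\<in>K. cmod (q k u) \<le> M" for k
    proof -
      have "compact (q k ` closure K)"
        using K by (intro compact_continuous_image holomorphic_several_continuous_on[of _ UNIV, THEN continuous_on_subset]
            holomorphic_several_polyfun q) auto
      then have "bounded (q k ` closure K)" by (rule compact_imp_bounded)
      then show ?thesis using closure_subset[of K] by (auto simp: bounded_iff)
    qed
    then obtain M where M: "\<And>k u. u \<in> K \<Longrightarrow> cmod (q k u) \<le> M k" by metis
    define M' where "M' = (\<Sum>k<?n. \<bar>M k\<bar>)"
    have M': "cmod (q k u) \<le> M'" if "u \<in> K" "k < ?n" for k u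
    proof -
      have "cmod (q k u) \<le> \<bar>M k\<bar>" using M[OF that(1), of k] by simp
      also have "\<dots> \<le> M'" unfolding M'_def by (rule member_le_sum) (use that in auto)
      finally show ?thesis .
    qed
    have "cmod (z $ i) \<le> max 1 (real ?n * M')" if z: "\<theta> z \<in> K" for z
    proof (rule root_bound[OF _ _ n])
      have deg: "degree (P z) = ?n" and monic: "lead_coeff (P z) = 1"
        unfolding P_def by (subst degree_prod_eq_sum_degree) (auto simp: lead_coeff_prod)
      have "poly (P z) (z $ i) = (\<Prod>A\<in>G. z $ i - (A *v z) $ i)"
        by (simp add: P_def poly_prod)
      also have "\<dots> = 0"
        by (rule prod_zero[OF finite_G]) (use one_mem in \<open>auto intro!: bexI[of _ "mat 1"]\<close>)
      finally have "(\<Sum>k\<le>?n. coeff (P z) k * (z $ i) ^ k) = 0"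
        by (simp add: poly_altdef deg)
      then have "(\<Sum>k<?n. coeff (P z) k * (z $ i) ^ k) + (z $ i) ^ ?n = 0"
        using monic deg by (simp add: lessThan_Suc_atMost[symmetric])
      then show "(z $ i) ^ ?n = - (\<Sum>k<?n. q k (\<theta> z) * (z $ i) ^ k)"
        by (simp add: q(2) eq_neg_iff_add_eq_0 add.commute)
      show "cmod (q k (\<theta> z)) \<le> M'" if "k < ?n" for k
        by (rule M'[OF z that])
    qed
    then show ?thesis by auto
  qed
  then obtain B where B: "\<And>z i. z \<in> \<theta> -` K \<Longrightarrow> cmod (z $ i) \<le> B i" by metis
  have "norm z \<le> (\<Sum>i\<in>UNIV. B i)" if "z \<in> \<theta> -` K" for z
    unfolding norm_vec_def
    by (rule order_trans[OF L2_set_le_sum]) (auto intro: sum_mono B that)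
  then show ?thesis unfolding bounded_iff by blast
qed

lemma closed_theta_image:
  assumes S: "closed S"
  shows "closed (\<theta> ` S)"
  unfolding closed_sequential_limits
proof (intro allI impI)
  fix u l assume u: "(\<forall>n. u n \<in> \<theta> ` S) \<and> u \<longlonglongrightarrow> l"
  then have "\<forall>n. \<exists>z. z \<in> S \<and> u n = \<theta> z" by blast
  then obtain z where "\<forall>n. z n \<in> S \<and> u n = \<theta> (z n)" by (rule choice[THEN exE])
  then have z: "z n \<in> S" "u n = \<theta> (z n)" for n by blast+
  have "bounded (range u)" using u convergent_imp_bounded[of u l] by blast
  then have "bounded (\<theta> -` range u)" by (rule bounded_theta_vimage)
  then have "bounded (range z)"
    by (rule bounded_subset) (use z(2) in force)
  then obtain x r where r: "strict_mono r" "(z \<circ> r) \<longlonglongrightarrow> x"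
    using bounded_imp_convergent_subsequence by blast
  have "x \<in> S" using closed_sequentially[OF S _ r(2)] z(1) by simp
  moreover have "(\<lambda>n. \<theta> ((z \<circ> r) n)) \<longlonglongrightarrow> \<theta> x"
    using theta_continuous_on[of UNIV] r(2) by (rule continuous_on_tendsto_compose) auto
  moreover have "(\<lambda>n. \<theta> ((z \<circ> r) n)) \<longlonglongrightarrow> l"
    using LIMSEQ_subseq_LIMSEQ[OF _ r(1), of u l] u by (simp add: o_def z(2))
  ultimately show "l \<in> \<theta> ` S" using LIMSEQ_unique by blast
qed

text \<open>For \<open>A\<close> in \<open>G\<close> other than the identity some coordinate of \<open>A z - z\<close> is a nonzero linear form, which
vanishes at the points fixed by \<open>A\<close>. The product of these forms and of their translates under \<open>G\<close>
is an invariant polynomial \<open>\<Delta> \<circ> \<theta>\<close>. Its zero set is a finite union of hyperplanes.\<close>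

lemma ex_polynomial_detecting_stabilizers:
  "\<exists>\<Delta>\<in>polyfun. (\<exists>z. \<Delta> (\<theta> z) \<noteq> 0) \<and>
    (\<forall>z. \<forall>A\<in>G. \<Delta> (\<theta> z) \<noteq> 0 \<longrightarrow> A *v z = z \<longrightarrow> A = mat 1) \<and>
    negligible {z. \<Delta> (\<theta> z) = 0}"
proof -
  have "\<exists>i z. (A *v z) $ i \<noteq> z $ i" if "A \<in> G - {mat 1}" for A
  proof -
    have "A \<noteq> mat 1" using that by simp
    then show ?thesis by (auto simp: matrix_eq vec_eq_iff)
  qed
  then obtain i where i: "\<And>A. A \<in> G - {mat 1} \<Longrightarrow> \<exists>z. (A *v z) $ i A \<noteq> z $ i A" by metis
  define l where "l A z = (A *v z) $ i A - z $ i A" for A z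
  have l_poly: "l A \<in> polyfun" for A
    unfolding l_def[abs_def] using polyfun_matrix[OF polyfun_coord] by (intro polyfun_diff polyfun_coord)
  have l_linear: "linear (l A)" for A
    unfolding l_def[abs_def]
    by (intro linear_compose_sub bounded_linear.linear bounded_linear_compose[OF bounded_linear_vec_nth bounded_linear_matrix]
        bounded_linear_vec_nth)
  define p0 where "p0 z = (\<Prod>A\<in>G - {mat 1}. l A z)" for z
  have p0_poly: "p0 \<in> polyfun" unfolding p0_def[abs_def] by (intro polyfun_prod l_poly)
  have "\<exists>z. p0 z \<noteq> 0"
    unfolding p0_def
  proof (rule polyfun_nonzero_prod)
    show "\<exists>z. l A z \<noteq> 0" if "A \<in> G - {mat 1}" for A
      using i[OF that] by (simp add: l_def)
  qed (simp_all add: finite_G l_poly)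
  then obtain a where a: "p0 a \<noteq> 0" by blast
  define p where "p z = (\<Prod>B\<in>G. p0 (B *v z))" for z
  have surj: "\<exists>w. B *v w = z" if B: "B \<in> G" for B z
  proof -
    obtain C where "B ** C = mat 1" using inverse_mem[OF B] by blast
    then have "B *v (C *v z) = z" by (simp add: matrix_vector_mul_assoc)
    then show ?thesis by blast
  qed
  have "negligible {z. l A (B *v z) = 0}" if B: "B \<in> G" and A: "A \<in> G - {mat 1}" for A B
  proof -
    have "linear (l A \<circ> (*v) B)"
      by (rule linear_compose[OF bounded_linear.linear[OF bounded_linear_matrix] l_linear])
    moreover have "\<exists>z. (l A \<circ> (*v) B) z \<noteq> 0"
    proof -
      obtain y where "l A y \<noteq> 0" using i[OF A] by (auto simp: l_def)
      moreover obtain z where "B *v z = y" using surj[OF B] by blast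
      ultimately show ?thesis by auto
    qed
    ultimately have "negligible {z. (l A \<circ> (*v) B) z = 0}" using negligible_linear_kernel by blast
    then show ?thesis by simp
  qed
  then have "negligible (\<Union>B\<in>G. \<Union>A\<in>G - {mat 1}. {z. l A (B *v z) = 0})"
    using finite_G by (intro negligible_Union finite_imageI finite_Diff; force intro!: negligible_Union)
  moreover have "{z. p z = 0} \<subseteq> (\<Union>B\<in>G. \<Union>A\<in>G - {mat 1}. {z. l A (B *v z) = 0})"
    using finite_G by (auto simp: p_def p0_def)
  ultimately have p_negl: "negligible {z. p z = 0}" by (rule negligible_subset)
  have p_poly: "p \<in> polyfun" unfolding p_def[abs_def] by (intro polyfun_prod polyfun_matrix p0_poly)
  have "\<exists>z. p z \<noteq> 0"
    unfolding p_def
  proof (rule polyfun_nonzero_prod[OF finite_G])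
    fix B assume "B \<in> G"
    show "(\<lambda>z. p0 (B *v z)) \<in> polyfun" by (intro polyfun_matrix p0_poly)
    show "\<exists>z. p0 (B *v z) \<noteq> 0" using a surj[OF \<open>B \<in> G\<close>] by metis
  qed
  then obtain c where c: "p c \<noteq> 0" by blast
  have "p (A *v z) = p z" if "A \<in> G" for A z
    unfolding p_def by (rule prod_orbit[OF that])
  then obtain \<Delta> where \<Delta>: "\<Delta> \<in> polyfun" "\<And>z. p z = \<Delta> (\<theta> z)"
    using invariant_factors[OF p_poly] by metis
  show ?thesis
  proof (intro bexI[OF _ \<Delta>(1)] conjI allI ballI impI)
    show "\<exists>z. \<Delta> (\<theta> z) \<noteq> 0" using c \<Delta>(2) by metis
    show "negligible {z. \<Delta> (\<theta> z) = 0}" using p_negl by (simp add: \<Delta>(2))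
    fix z A assume A: "A \<in> G" "A *v z = z" and nz: "\<Delta> (\<theta> z) \<noteq> 0"
    show "A = mat 1"
    proof (rule ccontr)
      assume "A \<noteq> mat 1"
      then have "p0 z = 0"
        unfolding p0_def using A finite_G by (intro prod_zero bexI[of _ A]) (auto simp: l_def)
      then have "p z = 0"
        unfolding p_def by (intro prod_zero finite_G) (use one_mem in \<open>auto intro!: bexI[of _ "mat 1"]\<close>)
      then show False using nz \<Delta>(2) by simp
    qed
  qed
qed

lemma theta_local_inverse:
  assumes J: "complex_jacobian \<theta> z \<noteq> 0" and D: "open D" "z \<in> D"
  shows "\<exists>U V g. open U \<and> U \<subseteq> D \<and> z \<in> U \<and> open V \<and> homeomorphism U V \<theta> g \<and>
    (\<exists>g'. \<forall>y\<in>V. (g has_derivative g' y) (at y) \<and> (\<forall>c v. g' y (c *s v) = c *s g' y v))"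
proof -
  have cont: "continuous_on D (\<lambda>z. jacobian_matrix \<theta> z $ i $ j)" for i j
    by (rule holomorphic_several_continuous_on[OF holomorphic_several_polyfun[OF jacobian_matrix_polyfun]])
  show ?thesis
  proof (rule holomorphic_local_inverse[OF theta_holomorphic D cont J])
    fix U V g g'
    assume UV: "open U" "U \<subseteq> D" "z \<in> U" "open V" "homeomorphism U V \<theta> g"
      and g': "\<And>y. y \<in> V \<Longrightarrow> (g has_derivative g' y) (at y)"
        "\<And>y c v. y \<in> V \<Longrightarrow> g' y (c *s v) = c *s g' y v"
    show ?thesis
      by (intro exI[of _ U] exI[of _ V] exI[of _ g] exI[of _ g'] conjI ballI allI UV g')
  qed
qed

text \<open>Properness makes the range of \<open>\<theta>\<close> closed. Within the connected set \<open>{u. \<Delta> u \<noteq> 0}\<close> the range is also open,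
by the inverse function theorem, and nonempty; so it contains this set, which is dense.\<close>

lemma theta_surj: "\<exists>z. \<theta> z = u"
proof -
  obtain \<Delta> where \<Delta>: "\<Delta> \<in> polyfun" "\<exists>z. \<Delta> (\<theta> z) \<noteq> 0"
    and free: "\<forall>z. \<forall>A\<in>G. \<Delta> (\<theta> z) \<noteq> 0 \<longrightarrow> A *v z = z \<longrightarrow> A = mat 1"
    using ex_polynomial_detecting_stabilizers by blast
  let ?U = "{u. \<Delta> u \<noteq> 0}" and ?R = "range \<theta>"
  have \<Delta>_cont: "continuous_on UNIV \<Delta>"
    by (rule holomorphic_several_continuous_on[OF holomorphic_several_polyfun[OF \<Delta>(1)]])
  then have opU: "open ?U" by (intro open_Collect_neq continuous_on_const)
  have clR: "closed ?R" by (rule closed_theta_image) simp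
  have opR: "open (?R \<inter> ?U)"
  proof (subst open_subopen, intro ballI)
    fix y assume "y \<in> ?R \<inter> ?U"
    then obtain z where z: "y = \<theta> z" "\<Delta> (\<theta> z) \<noteq> 0" by blast
    then have J: "complex_jacobian \<theta> z \<noteq> 0"
      using free by (intro complex_jacobian_nonzero) blast
    obtain U V g where UV: "z \<in> U" "open V" "homeomorphism U V \<theta> g"
      using theta_local_inverse[OF J open_UNIV UNIV_I] by blast
    have "open (V \<inter> ?U)" "y \<in> V \<inter> ?U"
      using UV z opU by (auto simp: homeomorphism_def)
    moreover have "V \<inter> ?U \<subseteq> ?R \<inter> ?U"
      using UV(3) by (auto simp: homeomorphism_def)
    ultimately show "\<exists>T. open T \<and> y \<in> T \<and> T \<subseteq> ?R \<inter> ?U" by blast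
  qed
  obtain b where b: "\<Delta> (\<theta> b) \<noteq> 0" using \<Delta>(2) by blast
  have "?U \<subseteq> ?R"
  proof (rule ccontr)
    assume "\<not> ?U \<subseteq> ?R"
    then have "(- ?R) \<inter> ?U \<noteq> {}" by blast
    moreover have "(?R \<inter> ?U) \<inter> ?U \<noteq> {}" using b by blast
    ultimately show False
      using connectedD[OF connected_polyfun_nonzero[OF \<Delta>(1)], of "?R \<inter> ?U" "- ?R"] opR clR
      by (auto simp: open_Compl)
  qed
  show ?thesis
  proof (rule ccontr)
    assume "\<not> ?thesis"
    then have u: "u \<in> - ?R" by auto
    from polyfun_nonzero_near[OF \<Delta>(1) b open_Compl[OF clR] u]
    show False using \<open>?U \<subseteq> ?R\<close> by blast
  qed
qed

text \<open>An invariant set is a union of fibres, so its image is the complement of the image of its complement,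
and images of closed sets are closed.\<close>

lemma open_theta_image:
  assumes S: "open S" and inv: "\<And>A z. A \<in> G \<Longrightarrow> z \<in> S \<Longrightarrow> A *v z \<in> S"
  shows "open (\<theta> ` S)"
proof -
  have "\<theta> ` S = - \<theta> ` (- S)"
  proof (intro equalityI subsetI)
    fix u assume "u \<in> \<theta> ` S"
    then obtain z where z: "z \<in> S" "u = \<theta> z" by blast
    show "u \<in> - \<theta> ` (- S)"
    proof
      assume "u \<in> \<theta> ` (- S)"
      then obtain w where w: "w \<notin> S" "u = \<theta> w" by blast
      then obtain A where "A \<in> G" "w = A *v z" using theta_separates_orbits z by metis
      then show False using inv z w by blast
    qed
  next
    fix u assume "u \<in> - \<theta> ` (- S)"
    moreover obtain z where "\<theta> z = u" using theta_surj by blast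
    ultimately show "u \<in> \<theta> ` S" by blast
  qed
  then show ?thesis using closed_theta_image[of "- S"] S by (simp add: open_Compl closed_Compl)
qed

end

section \<open>Square integrable holomorphic functions extend across zero sets\<close>

text \<open>The mean value inequality on the disc around \<open>t\<close> of radius \<open>|t - a|\<close> bounds \<open>|(t - a) g t|\<^sup>2\<close> by the
integral of \<open>|g|\<^sup>2\<close> over a disc around \<open>a\<close> which shrinks as \<open>t\<close> tends to \<open>a\<close>. So \<open>(t - a) g t\<close> tends
to zero, and Riemann's theorem applies.\<close>

lemma square_integrable_removable_singularity:
  fixes g :: "complex \<Rightarrow> complex"
  assumes A: "open A" "a \<in> A" and hol: "g holomorphic_on A - {a}"
    and fin: "(\<integral>\<^sup>+t. ennreal ((cmod (g t))\<^sup>2) * indicator A t \<partial>lborel) < \<infinity>"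
  shows "\<exists>G. G holomorphic_on A \<and> (\<forall>t\<in>A - {a}. G t = g t)"
proof -
  define B where "B = A - {a}"
  have openB: "open B" using A by (simp add: B_def open_delete)
  define k where "k t = ennreal ((cmod (g t))\<^sup>2) * indicator B t" for t
  have k_meas [measurable]: "k \<in> borel_measurable borel"
  proof -
    have "(\<lambda>t. indicator B t *\<^sub>R g t) \<in> borel_measurable borel"
      using borel_measurable_continuous_on_indicator[of B g] openB hol
      by (simp add: holomorphic_on_imp_continuous_on B_def)
    then have "(\<lambda>t. ennreal ((cmod (indicator B t *\<^sub>R g t))\<^sup>2)) \<in> borel_measurable borel" by measurable
    moreover have "(\<lambda>t. ennreal ((cmod (indicator B t *\<^sub>R g t))\<^sup>2)) = k"
      by (auto simp: k_def indicator_def)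
    ultimately show ?thesis by (simp only:)
  qed
  have k_fin: "(\<integral>\<^sup>+t. k t \<partial>lborel) < \<infinity>"
    by (rule le_less_trans[OF nn_integral_mono fin]) (auto simp: k_def B_def indicator_def)
  obtain d where d: "d > 0" "ball a d \<subseteq> A" using A open_contains_ball by blast
  define \<mu> where "\<mu> = density lborel k"
  define I where "I n = emeasure \<mu> (ball a (1 / real (Suc n)))" for n
  have I_eq: "emeasure \<mu> S = (\<integral>\<^sup>+t. k t * indicator S t \<partial>lborel)" if "S \<in> sets borel" for S
    using that by (simp add: \<mu>_def emeasure_density)
  have I_lim: "I \<longlonglongrightarrow> 0"
  proof -
    have "I \<longlonglongrightarrow> emeasure \<mu> (\<Inter>n. ball a (1 / real (Suc n)))"
      unfolding I_def
    proof (rule Lim_emeasure_decseq)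
      show "range (\<lambda>n. ball a (1 / real (Suc n))) \<subseteq> sets \<mu>" by (auto simp: \<mu>_def)
      show "decseq (\<lambda>n. ball a (1 / real (Suc n)))"
        unfolding decseq_def
      proof (intro allI impI)
        fix m n :: nat assume "m \<le> n"
        then have "1 / real (Suc n) \<le> 1 / real (Suc m)" by (simp add: field_simps)
        then show "ball a (1 / real (Suc n)) \<subseteq> ball a (1 / real (Suc m))" by (rule subset_ball)
      qed
      show "emeasure \<mu> (ball a (1 / real (Suc n))) \<noteq> \<infinity>" for n
      proof -
        have "emeasure \<mu> (ball a (1 / real (Suc n))) \<le> (\<integral>\<^sup>+t. k t \<partial>lborel)"
          by (simp add: I_eq, rule nn_integral_mono) (simp add: indicator_def)
        then show ?thesis using k_fin by (auto simp: top_unique)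
      qed
    qed
    also have "(\<Inter>n. ball a (1 / real (Suc n))) = {a}"
    proof (intro equalityI subsetI)
      fix t assume t: "t \<in> (\<Inter>n. ball a (1 / real (Suc n)))"
      show "t \<in> {a}"
      proof (rule ccontr)
        assume "t \<notin> {a}"
        then obtain n where "inverse (real (Suc n)) < dist a t"
          using reals_Archimedean[of "dist a t"] by auto
        moreover have "dist a t < 1 / real (Suc n)" using t by auto
        ultimately show False by (simp add: inverse_eq_divide)
      qed
    qed auto
    also have "emeasure \<mu> {a} = 0"
    proof -
      have "(\<integral>\<^sup>+t. k t * indicator {a} t \<partial>lborel) = (\<integral>\<^sup>+t. 0 \<partial>(lborel :: complex measure))"
        by (rule nn_integral_cong) (simp add: k_def B_def indicator_def)
      then show ?thesis by (simp add: I_eq)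
    qed
    finally show ?thesis .
  qed
  have bound: "ennreal ((cmod ((t - a) * g t))\<^sup>2) \<le> I n"
    if t: "t \<noteq> a" "dist a t < d / 2" "2 * dist a t < 1 / real (Suc n)" for t n
  proof -
    define r where "r = dist a t"
    have r: "r > 0" using t by (simp add: r_def)
    have sub: "ball t r \<subseteq> B" "ball t r \<subseteq> ball a (1 / real (Suc n))"
    proof -
      have "dist a x < 2 * r" if "x \<in> ball t r" for x
        using that dist_triangle[of a x t] by (simp add: r_def)
      moreover have "a \<notin> ball t r" by (simp add: r_def dist_commute)
      ultimately show "ball t r \<subseteq> B" "ball t r \<subseteq> ball a (1 / real (Suc n))"
        using t d by (auto simp: B_def r_def subset_iff) (fastforce simp: r_def)+
    qed
    obtain b :: "2 \<Rightarrow> complex" where b: "bij_betw b UNIV Basis" using ex_bij_betw_complex_Basis by blast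
    have "ennreal ((cmod (g t))\<^sup>2) * emeasure lborel (ball t r)
      \<le> (\<integral>\<^sup>+x. ennreal ((cmod (g x))\<^sup>2) * indicator (ball t r) x \<partial>lborel)"
    proof (rule square_mean_value_inequality[where rot = "(*)"])
      fix c :: complex assume c: "cmod c = 1"
      show "distr lborel borel ((*) c) = lborel"
        by (rule distr_lborel_isometry[OF b])
          (simp_all add: norm_mult c bounded_linear.linear[OF bounded_linear_mult_right])
    next
      have holB: "g holomorphic_on ball t r" using hol sub by (auto simp: B_def intro: holomorphic_on_subset)
      then show "continuous_on (ball t r) g" by (rule holomorphic_on_imp_continuous_on)
      fix v :: complex
      have "(g \<circ> (\<lambda>s. t + s * v)) holomorphic_on {s. cmod s * norm v < r}"
        by (rule holomorphic_on_compose_gen[OF _ holB]) (auto intro!: holomorphic_intros simp: dist_norm norm_mult)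
      then show "(\<lambda>s. g (t + s * v)) holomorphic_on {s. cmod s * norm v < r}" by (simp add: o_def)
    qed (auto simp: norm_mult)
    also have "\<dots> \<le> (\<integral>\<^sup>+x. k x * indicator (ball a (1 / real (Suc n))) x \<partial>lborel)"
      by (rule nn_integral_mono) (use sub in \<open>auto simp: k_def indicator_def\<close>)
    also have "\<dots> = I n" by (simp add: I_def I_eq)
    finally have "ennreal ((cmod (g t))\<^sup>2) * emeasure lborel (ball t r) \<le> I n" .
    moreover have "ennreal (r\<^sup>2) \<le> emeasure lborel (ball t r)"
    proof -
      have "emeasure lborel (ball t r) = ennreal (pi * r\<^sup>2)"
        using emeasure_ball[of r t] r by (simp add: unit_ball_vol_2)
      moreover have "r\<^sup>2 \<le> pi * r\<^sup>2"
        using mult_right_mono[of 1 pi "r\<^sup>2"] pi_ge_two by simp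
      ultimately show ?thesis by (simp add: ennreal_leI)
    qed
    then have "ennreal ((cmod (g t))\<^sup>2) * ennreal (r\<^sup>2) \<le> ennreal ((cmod (g t))\<^sup>2) * emeasure lborel (ball t r)"
      by (intro mult_left_mono) auto
    moreover have "ennreal ((cmod ((t - a) * g t))\<^sup>2) = ennreal ((cmod (g t))\<^sup>2) * ennreal (r\<^sup>2)"
      by (simp add: ennreal_mult[symmetric] norm_mult power_mult_distrib r_def dist_norm norm_minus_commute mult.commute)
    ultimately show ?thesis by simp
  qed
  have "((\<lambda>t. (t - a) * g t) \<longlongrightarrow> 0) (at a)"
  proof (rule tendstoI)
    fix e :: real assume e: "e > 0"
    then have "ennreal (e\<^sup>2) > 0" by simp
    then have "\<forall>\<^sub>F n in sequentially. I n < ennreal (e\<^sup>2)"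
      using I_lim by (rule order_tendstoD(2)[rotated])
    then obtain n where n: "I n < ennreal (e\<^sup>2)" unfolding eventually_sequentially by blast
    have "dist ((t - a) * g t) 0 < e" if t: "t \<noteq> a" "dist t a < min (d / 2) (1 / (2 * real (Suc n)))" for t
    proof -
      have "ennreal ((cmod ((t - a) * g t))\<^sup>2) < ennreal (e\<^sup>2)"
        using bound[of t n] t n by (auto simp: dist_commute field_simps intro: le_less_trans)
      then have "(cmod ((t - a) * g t))\<^sup>2 < e\<^sup>2" using ennreal_less_iff by (metis zero_le_power2)
      then show ?thesis using e by (simp add: power2_less_imp_less)
    qed
    then show "\<forall>\<^sub>F t in at a. dist ((t - a) * g t) 0 < e"
      unfolding eventually_at using d by (intro exI[of _ "min (d / 2) (1 / (2 * real (Suc n)))"]) auto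
  qed
  moreover have "a \<in> interior A" using A by (simp add: interior_open)
  ultimately show ?thesis using holomorphic_on_extend_lim[OF hol] by blast
qed

lemma square_integrable_removable_finite:
  fixes g :: "complex \<Rightarrow> complex"
  assumes "finite S" "open A" "g holomorphic_on A - S"
    and "(\<integral>\<^sup>+t. ennreal ((cmod (g t))\<^sup>2) * indicator A t \<partial>lborel) < \<infinity>"
  shows "\<exists>G. G holomorphic_on A \<and> (\<forall>t\<in>A - S. G t = g t)"
  using assms
proof (induction S arbitrary: g rule: finite_induct)
  case empty
  then show ?case by auto
next
  case (insert a S)
  let ?A' = "A - S"
  have openA': "open ?A'" using insert by (simp add: open_Diff finite_imp_closed)
  obtain G1 where G1: "G1 holomorphic_on ?A'" "\<forall>t\<in>?A' - {a}. G1 t = g t"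
  proof (cases "a \<in> ?A'")
    case True
    have "(\<integral>\<^sup>+t. ennreal ((cmod (g t))\<^sup>2) * indicator ?A' t \<partial>lborel) < \<infinity>"
      by (rule le_less_trans[OF nn_integral_mono insert.prems(3)]) (auto simp: indicator_def)
    moreover have "g holomorphic_on ?A' - {a}"
      using insert.prems(2) by (rule holomorphic_on_subset) auto
    ultimately have "\<exists>G. G holomorphic_on ?A' \<and> (\<forall>t\<in>?A' - {a}. G t = g t)"
      by (intro square_integrable_removable_singularity[OF openA' True])
    then show ?thesis using that by blast
  next
    case False
    then have "g holomorphic_on ?A'"
      using insert.prems(2) by (auto elim: holomorphic_on_subset)
    then show ?thesis using that by blast
  qed
  have "(\<integral>\<^sup>+t. ennreal ((cmod (G1 t))\<^sup>2) * indicator A t \<partial>lborel)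
      = (\<integral>\<^sup>+t. ennreal ((cmod (g t))\<^sup>2) * indicator A t \<partial>lborel)"
  proof (rule nn_integral_cong_AE)
    have "AE t in lborel. t \<notin> insert a S"
      using insert.hyps(1) by (intro AE_not_in finite_imp_null_set_lborel) simp
    then show "AE t in lborel. ennreal ((cmod (G1 t))\<^sup>2) * indicator A t = ennreal ((cmod (g t))\<^sup>2) * indicator A t"
      by eventually_elim (use G1(2) in \<open>auto simp: indicator_def\<close>)
  qed
  then have "(\<integral>\<^sup>+t. ennreal ((cmod (G1 t))\<^sup>2) * indicator A t \<partial>lborel) < \<infinity>"
    using insert.prems(3) by simp
  from insert.IH[OF insert.prems(1) G1(1) this]
  obtain G where "G holomorphic_on A" "\<forall>t\<in>A - S. G t = G1 t" by blast
  then show ?case using G1(2) by (intro exI[of _ G]) auto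
qed

text \<open>The \<open>N M\<close>-th roots of unity fall into \<open>N\<close> groups of \<open>M\<close> consecutive ones, each group following one of
the \<open>N\<close>-th roots of unity. So the two means differ by at most the oscillation of \<open>g\<close> on arcs of
length \<open>2\<pi>/N\<close>.\<close>

lemma root_mean_refine:
  assumes N: "N > 0" "M > 0"
    and osc: "\<And>x y. x \<in> {0..2*pi} \<Longrightarrow> y \<in> {0..2*pi} \<Longrightarrow> \<bar>x - y\<bar> \<le> 2 * pi / real N \<Longrightarrow>
      cmod (g (cis x) - g (cis y)) \<le> e"
  shows "cmod (root_mean N g - root_mean (N * M) g) \<le> e"
proof -
  let ?a = "\<lambda>i. 2 * pi * real i / real N" and ?b = "\<lambda>j. 2 * pi * real j / real (N * M)"
  have "(\<Sum>j<N * M. g (cis (?b j))) = (\<Sum>i<N. \<Sum>j\<in>{i * M..<i * M + M}. g (cis (?b j)))"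
    by (rule sum.nat_group[symmetric])
  moreover have "(\<Sum>i<N. g (cis (?a i))) * of_nat M = (\<Sum>i<N. \<Sum>j\<in>{i * M..<i * M + M}. g (cis (?a i)))"
    by (simp add: sum_distrib_right sum_distrib_left mult.commute)
  moreover have "root_mean N g = (\<Sum>i<N. g (cis (?a i))) * of_nat M / of_nat (N * M)"
    using N by (simp add: root_mean_def)
  ultimately have eq: "root_mean N g - root_mean (N * M) g =
      (\<Sum>i<N. \<Sum>j\<in>{i * M..<i * M + M}. g (cis (?a i)) - g (cis (?b j))) / of_nat (N * M)"
    by (simp add: root_mean_def diff_divide_distrib sum_subtractf)
  have "cmod (\<Sum>i<N. \<Sum>j\<in>{i * M..<i * M + M}. g (cis (?a i)) - g (cis (?b j))) \<le> real (N * M) * e"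
  proof -
    have "cmod (g (cis (?a i)) - g (cis (?b j))) \<le> e" if i: "i < N" and j: "j \<in> {i * M..<i * M + M}" for i j
    proof (rule osc)
      have iN: "real i + 1 \<le> real N" using i by linarith
      have j1: "real i * real M \<le> real j" "real j \<le> (real i + 1) * real M"
        using j by (auto simp: of_nat_mult[symmetric] algebra_simps simp del: of_nat_mult of_nat_add)
      have b1: "real i / real N \<le> real j / real (N * M)" "real j / real (N * M) \<le> (real i + 1) / real N"
        using j1 N by (simp_all add: field_simps)
      have a1: "(real i + 1) / real N \<le> 1" using iN N by simp
      have a0: "0 \<le> real i / real N" by simp
      define x y where "x = real i / real N" and "y = real j / real (N * M)"
      have xy: "0 \<le> x" "x \<le> y" "y \<le> x + 1 / real N" "x + 1 / real N \<le> 1"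
        using b1 a1 a0 by (simp_all add: x_def y_def add_divide_distrib)
      have p: "0 \<le> 1 / real N" by simp
      have ea: "?a i = 2 * pi * x" and eb: "?b j = 2 * pi * y" by (simp_all add: x_def y_def)
      show "?a i \<in> {0..2*pi}" unfolding ea using xy p by simp
      show "?b j \<in> {0..2*pi}" unfolding eb using xy p by simp
      have "\<bar>x - y\<bar> \<le> 1 / real N" using xy by simp
      then have "2 * pi * \<bar>x - y\<bar> \<le> 2 * pi * (1 / real N)" by (intro mult_left_mono) auto
      moreover have "\<bar>2 * pi * x - 2 * pi * y\<bar> = 2 * pi * \<bar>x - y\<bar>"
        by (simp add: abs_mult right_diff_distrib[symmetric])
      ultimately show "\<bar>?a i - ?b j\<bar> \<le> 2 * pi / real N" unfolding ea eb by simp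
    qed
    then have "cmod (\<Sum>i<N. \<Sum>j\<in>{i * M..<i * M + M}. g (cis (?a i)) - g (cis (?b j)))
        \<le> (\<Sum>i<N. \<Sum>j\<in>{i * M..<i * M + M}. e)"
      by (intro sum_norm_le) auto
    then show ?thesis by (simp add: mult.assoc)
  qed
  then have "cmod (root_mean N g - root_mean (N * M) g) \<le> real (N * M) * e / real (N * M)"
    unfolding eq norm_divide norm_of_nat using N by (intro divide_right_mono) auto
  then show ?thesis using N by simp
qed

lemma root_mean_translates_holomorphic:
  assumes sub: "\<And>u t. u \<in> B \<Longrightarrow> cmod t = 1 \<Longrightarrow> u + t *s w \<in> D" and h: "holomorphic_several h D"
  shows "holomorphic_several (\<lambda>u. root_mean N (\<lambda>t. h (u + t *s w))) B"
proof -
  have "holomorphic_several (\<lambda>u. h (u + t *s w)) B" if "cmod t = 1" for t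
    using h by (rule holomorphic_several_compose[where g' = "\<lambda>_ v. v"])
      (auto intro!: derivative_eq_intros simp: sub that)
  then have "holomorphic_several (\<lambda>u. (1 / of_nat N) * (\<Sum>k<N. h (u + cis (2 * pi * real k / real N) *s w))) B"
    by (intro holomorphic_several_cmult holomorphic_several_sum) auto
  then show ?thesis by (simp add: root_mean_def)
qed

text \<open>By uniform continuity the means over roots of unity form a uniform Cauchy sequence in \<open>u\<close>; their
limit is the integral mean of \<open>h\<close> over the circles \<open>u + t w\<close> with \<open>|t| = 1\<close>. The statement concerns
convergence of the means since on good lines they converge to \<open>h u\<close> as well.\<close>

lemma circle_mean_holomorphic:
  fixes h :: "complex^'d \<Rightarrow> complex"
  assumes D: "holomorphic_several h D" and sub: "\<And>u t. u \<in> cball u0 e \<Longrightarrow> cmod t = 1 \<Longrightarrow> u + t *s w \<in> D"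
  shows "\<exists>g. holomorphic_several g (ball u0 e) \<and>
    (\<forall>u\<in>ball u0 e. (\<lambda>N. root_mean N (\<lambda>t. h (u + t *s w))) \<longlonglongrightarrow> g u)"
proof -
  define F where "F N u = root_mean N (\<lambda>t. h (u + t *s w))" for N u
  let ?K = "cball u0 e \<times> {0..2*pi}"
  define k where "k p = h (fst p + cis (snd p) *s w)" for p
  have cont: "continuous_on ?K k"
  proof -
    have "continuous_on ?K (h \<circ> (\<lambda>p. fst p + cis (snd p) *s w))"
    proof (rule continuous_on_compose)
      show "continuous_on ?K (\<lambda>p. fst p + cis (snd p) *s w)"
        by (intro continuous_intros continuous_on_cis)
      show "continuous_on ((\<lambda>p. fst p + cis (snd p) *s w) ` ?K) h"
        by (rule continuous_on_subset[OF holomorphic_several_continuous_on[OF D]]) (use sub in auto)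
    qed
    then show ?thesis by (simp add: k_def[abs_def] o_def)
  qed
  have "compact ?K" by (intro compact_Times compact_cball compact_Icc)
  then have unif: "uniformly_continuous_on ?K k" by (rule compact_uniformly_continuous[OF cont])
  have refine: "\<exists>N0>0. \<forall>N\<ge>N0. \<forall>M>0. \<forall>u\<in>cball u0 e. cmod (F N u - F (N * M) u) \<le> \<epsilon>" if \<epsilon>: "\<epsilon> > 0" for \<epsilon>
  proof -
    obtain d where d: "d > 0" "\<And>p p'. p \<in> ?K \<Longrightarrow> p' \<in> ?K \<Longrightarrow> dist p' p < d \<Longrightarrow> dist (k p') (k p) < \<epsilon>"
      using unif \<epsilon> unfolding uniformly_continuous_on_def by metis
    obtain N0 where N0: "2 * pi / d < real N0" using reals_Archimedean2 by blast
    have N0p: "N0 > 0"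
    proof -
      have "0 < 2 * pi / d" using d by simp
      then have "0 < real N0" using N0 by linarith
      then show ?thesis by simp
    qed
    have "cmod (F N u - F (N * M) u) \<le> \<epsilon>" if N: "N \<ge> N0" and M: "M > 0" and u: "u \<in> cball u0 e" for N M u
      unfolding F_def
    proof (rule root_mean_refine)
      show "N > 0" using N N0p by simp
      fix x y assume xy: "x \<in> {0..2*pi}" "y \<in> {0..2*pi}" "\<bar>x - y\<bar> \<le> 2 * pi / real N"
      have "2 * pi / d < real N" using N0 N by simp
      then have "2 * pi / real N < d" using d \<open>N > 0\<close> by (simp add: field_simps)
      then have "dist (u, x) (u, y) < d" using xy by (simp add: dist_Pair_Pair dist_real_def)
      then have "dist (k (u, x)) (k (u, y)) < \<epsilon>" by (intro d(2)) (use u xy in auto)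
      then show "cmod (h (u + cis x *s w) - h (u + cis y *s w)) \<le> \<epsilon>"
        by (simp add: k_def dist_norm)
    qed (rule M)
    then show ?thesis using N0p by blast
  qed
  have cauchy: "uniformly_Cauchy_on (cball u0 e) F"
    unfolding uniformly_Cauchy_on_def
  proof (intro allI impI)
    fix \<epsilon> :: real assume "\<epsilon> > 0"
    then have "\<epsilon> / 3 > 0" by simp
    from refine[OF this] obtain N0 where N0: "N0 > 0"
      "\<forall>N\<ge>N0. \<forall>M>0. \<forall>u\<in>cball u0 e. cmod (F N u - F (N * M) u) \<le> \<epsilon> / 3" by blast
    have "dist (F m u) (F n u) < \<epsilon>" if u: "u \<in> cball u0 e" and mn: "m \<ge> N0" "n \<ge> N0" for u m n
    proof -
      have "m > 0" "n > 0" using mn N0(1) by auto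
      then have "cmod (F m u - F (m * n) u) \<le> \<epsilon> / 3" "cmod (F n u - F (n * m) u) \<le> \<epsilon> / 3"
        using N0(2) u mn by blast+
      then have "cmod (F m u - F (m * n) u) \<le> \<epsilon> / 3" "cmod (F n u - F (m * n) u) \<le> \<epsilon> / 3"
        by (simp_all add: mult.commute)
      then show ?thesis
        using \<open>\<epsilon> > 0\<close> norm_triangle_ineq4[of "F m u - F (m * n) u" "F n u - F (m * n) u"]
        by (simp add: dist_norm)
    qed
    then show "\<exists>N. \<forall>u\<in>cball u0 e. \<forall>m\<ge>N. \<forall>n\<ge>N. dist (F m u) (F n u) < \<epsilon>" by blast
  qed
  define g where "g u = lim (\<lambda>N. F N u)" for u
  have lim: "uniform_limit (cball u0 e) F g sequentially"
    using Cauchy_uniformly_convergent[OF cauchy] unfolding uniformly_convergent_uniform_limit_iff g_def .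
  have "holomorphic_several g (ball u0 e)"
  proof (rule holomorphic_several_uniform_limit[where f = F])
    show "holomorphic_several (F N) (ball u0 e)" for N
      unfolding F_def[abs_def] by (rule root_mean_translates_holomorphic[OF _ D]) (use sub in auto)
    fix z assume "z \<in> ball u0 e"
    then obtain r where r: "r > 0" "cball z r \<subseteq> ball u0 e" using open_contains_cball open_ball by blast
    then have "uniform_limit (cball z r) F g sequentially"
      using uniform_limit_on_subset[OF lim] ball_subset_cball by blast
    then show "\<exists>r>0. cball z r \<subseteq> ball u0 e \<and> uniform_limit (cball z r) F g sequentially" using r by blast
  qed
  moreover have "(\<lambda>N. F N u) \<longlonglongrightarrow> g u" if "u \<in> ball u0 e" for u
    by (rule tendsto_uniform_limitI[OF lim]) (use that in auto)
  ultimately show ?thesis unfolding F_def by blast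
qed

lemma nn_integral_lborel_translate:
  fixes f :: "'a::euclidean_space \<Rightarrow> ennreal"
  assumes [measurable]: "f \<in> borel_measurable borel"
  shows "(\<integral>\<^sup>+x. f (x + a) \<partial>lborel) = (\<integral>\<^sup>+x. f x \<partial>lborel)"
proof -
  have "(\<integral>\<^sup>+x. f x \<partial>lborel) = (\<integral>\<^sup>+x. f x \<partial>distr lborel borel ((+) a))"
    by (simp add: lborel_distr_plus)
  also have "\<dots> = (\<integral>\<^sup>+x. f (a + x) \<partial>lborel)" by (subst nn_integral_distr) auto
  finally show ?thesis by (simp add: add.commute)
qed

text \<open>Fubini's theorem and translation invariance: integrating over all \<open>u\<close> the integrals of the function over the discs
\<open>u + t w\<close> with \<open>|t| < 2\<close> gives its total integral times the area of one disc.\<close>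

lemma AE_slice_integrable:
  fixes \<Phi> :: "complex^'d \<Rightarrow> ennreal"
  assumes [measurable]: "\<Phi> \<in> borel_measurable borel" and fin: "(\<integral>\<^sup>+x. \<Phi> x \<partial>lborel) < \<infinity>"
  shows "AE u in lborel. (\<integral>\<^sup>+t. \<Phi> (u + t *s w) * indicator (ball (0::complex) 2) t \<partial>lborel) < \<infinity>"
proof -
  have "(\<lambda>p::(complex^'d) \<times> complex. fst p + snd p *s w) \<in> borel_measurable borel"
    by (intro borel_measurable_continuous_onI continuous_intros)
  then have shift [measurable]: "(\<lambda>p::(complex^'d) \<times> complex. fst p + snd p *s w) \<in> borel_measurable (lborel \<Otimes>\<^sub>M lborel)"
    by (simp add: borel_prod[symmetric] measurable_cong_sets[OF sets_pair_measure_cong[OF sets_lborel sets_lborel] refl])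
  have meas [measurable]: "(\<lambda>(u, t). \<Phi> (u + t *s w) * indicator (ball (0::complex) 2) t) \<in> borel_measurable (lborel \<Otimes>\<^sub>M lborel)"
  proof -
    have "(\<lambda>p. indicator (ball (0::complex) 2) (snd p) :: ennreal) \<in> borel_measurable (lborel \<Otimes>\<^sub>M lborel)"
      by (rule measurable_compose[OF measurable_snd]) (simp add: borel_measurable_indicator)
    moreover have "(\<lambda>p. \<Phi> (fst p + snd p *s w)) \<in> borel_measurable (lborel \<Otimes>\<^sub>M lborel)"
      by (rule measurable_compose[OF shift assms(1)])
    ultimately show ?thesis unfolding case_prod_beta by (rule borel_measurable_times_ennreal[rotated])
  qed
  have "(\<integral>\<^sup>+u. (\<integral>\<^sup>+t. \<Phi> (u + t *s w) * indicator (ball (0::complex) 2) t \<partial>lborel) \<partial>lborel)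
    = (\<integral>\<^sup>+t. (\<integral>\<^sup>+u. \<Phi> (u + t *s w) * indicator (ball (0::complex) 2) t \<partial>lborel) \<partial>lborel)"
    using lborel_pair.Fubini'[OF meas] by simp
  also have "\<dots> = (\<integral>\<^sup>+t. (\<integral>\<^sup>+x. \<Phi> x \<partial>lborel) * indicator (ball (0::complex) 2) t \<partial>lborel)"
  proof (rule nn_integral_cong)
    fix t :: complex
    have "(\<lambda>u. \<Phi> (u + t *s w)) \<in> borel_measurable lborel" by measurable
    then show "(\<integral>\<^sup>+u. \<Phi> (u + t *s w) * indicator (ball 0 2) t \<partial>lborel) = (\<integral>\<^sup>+x. \<Phi> x \<partial>lborel) * indicator (ball 0 2) t"
      by (simp add: nn_integral_multc nn_integral_lborel_translate)
  qed
  also have "\<dots> = (\<integral>\<^sup>+x. \<Phi> x \<partial>lborel) * emeasure lborel (ball (0::complex) 2)"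
    by (simp add: nn_integral_cmult_indicator)
  also have "\<dots> < \<infinity>"
    using fin emeasure_lborel_ball_finite[of "0::complex" 2] by (simp add: ennreal_mult_less_top)
  finally have "(\<integral>\<^sup>+u. (\<integral>\<^sup>+t. \<Phi> (u + t *s w) * indicator (ball (0::complex) 2) t \<partial>lborel) \<partial>lborel) \<noteq> \<infinity>"
    by simp
  moreover have "(\<lambda>u. \<integral>\<^sup>+t. \<Phi> (u + t *s w) * indicator (ball (0::complex) 2) t \<partial>lborel) \<in> borel_measurable lborel"
    using meas by (rule lborel.borel_measurable_nn_integral)
  ultimately have "AE u in lborel. (\<integral>\<^sup>+t. \<Phi> (u + t *s w) * indicator (ball (0::complex) 2) t \<partial>lborel) \<noteq> \<infinity>"
    by (intro nn_integral_PInf_AE)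
  then show ?thesis by eventually_elim (simp add: less_top)
qed

lemma continuous_agree_off_zeros:
  fixes f g :: "complex^'d \<Rightarrow> complex"
  assumes \<Delta>: "\<Delta> \<in> polyfun" "\<Delta> b \<noteq> 0" and S: "open S" "continuous_on S f" "continuous_on S g"
    and eq: "\<And>x. x \<in> S \<Longrightarrow> \<Delta> x \<noteq> 0 \<Longrightarrow> f x = g x" and u: "u \<in> S"
  shows "f u = g u"
proof (rule ccontr)
  assume "f u \<noteq> g u"
  have "open {x \<in> S. f x - g x \<in> - {0}}"
    using continuous_open_preimage[OF continuous_on_diff[OF S(2,3)] S(1), of "- {0}"]
    by (simp add: vimage_def Int_def open_Compl)
  moreover have "u \<in> {x \<in> S. f x - g x \<in> - {0}}" using u \<open>f u \<noteq> g u\<close> by simp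
  ultimately have "\<exists>x\<in>{x \<in> S. f x - g x \<in> - {0}}. \<Delta> x \<noteq> 0"
    by (rule polyfun_nonzero_near[OF \<Delta>])
  then show False using eq by auto
qed

text \<open>Choose a vector \<open>w\<close> such that \<open>\<Delta>\<close> has no zeros on the circle \<open>u0 + t w\<close>, \<open>|t| = 1\<close>, and therefore none on
the translated circles with centre \<open>u\<close> near \<open>u0\<close>. The extension is the mean of \<open>h\<close> over these
circles. On almost every line \<open>t \<mapsto> u + t w\<close> the function \<open>h\<close> is square integrable, so its finitely
many singularities in the disc are removable and the mean is \<open>h u\<close>. By continuity this holds for all
\<open>u\<close> with \<open>\<Delta> u \<noteq> 0\<close>.\<close>

lemma L2_extension_local:
  fixes h :: "complex^'d \<Rightarrow> complex"
  assumes \<Delta>: "\<Delta> \<in> polyfun" "\<Delta> b \<noteq> 0"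
    and hol: "holomorphic_several h (ball u0 \<rho> \<inter> {u. \<Delta> u \<noteq> 0})" and \<rho>: "\<rho> > 0"
    and fin: "(\<integral>\<^sup>+x. ennreal ((cmod (h x))\<^sup>2) * indicator (ball u0 \<rho> \<inter> {u. \<Delta> u \<noteq> 0}) x \<partial>lborel) < \<infinity>"
  shows "\<exists>e>0. \<exists>g. e \<le> \<rho> \<and> holomorphic_several g (ball u0 e) \<and> (\<forall>u\<in>ball u0 e. \<Delta> u \<noteq> 0 \<longrightarrow> g u = h u)"
proof -
  let ?W = "ball u0 \<rho> \<inter> {u. \<Delta> u \<noteq> 0}"
  have \<Delta>_cont: "continuous_on S \<Delta>" for S
    by (rule holomorphic_several_continuous_on[OF holomorphic_several_polyfun[OF \<Delta>(1)]])
  have openW: "open ?W"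
    by (intro open_Int open_ball open_Collect_neq \<Delta>_cont continuous_on_const)
  \<comment> \<open>The direction of the point \<open>b\<close>: on this line through \<open>u0\<close> the function \<open>\<Delta>\<close> has only finitely many zeros.\<close>
  define v where "v = b - u0"
  obtain q0 where q0: "\<And>t. \<Delta> (u0 + t *s v) = poly q0 t" using polyfun_on_line[OF \<Delta>(1)] by metis
  have "poly q0 1 \<noteq> 0" using q0[of 1] \<Delta>(2) by (simp add: v_def)
  then have "q0 \<noteq> 0" by auto
  then have finZ: "finite (cmod ` {t. poly q0 t = 0})" by (intro finite_imageI poly_roots_finite)
  define a where "a = norm v + 1"
  \<comment> \<open>This bound on the radius keeps the discs \<open>u + t w\<close> with \<open>|t| < 2\<close> inside \<open>ball u0 \<rho>\<close>.\<close>
  define r0 where "r0 = \<rho> / (4 * a)"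
  have nv: "a > 0" using norm_ge_zero[of v] unfolding a_def by linarith
  have r0: "r0 > 0" using \<rho> nv by (simp add: r0_def)
  have "infinite {0<..<r0}" using r0 by simp
  then have "\<not> {0<..<r0} \<subseteq> cmod ` {t. poly q0 t = 0}" using finZ finite_subset by blast
  then obtain r where "r \<in> {0<..<r0}" and r_notin: "r \<notin> cmod ` {t. poly q0 t = 0}" by blast
  then have r: "0 < r" "r < r0" by auto
  define w where "w = of_real r *s v"
  have norm_w: "2 * norm w < \<rho> / 2"
  proof -
    have "norm w = r * norm v" using r by (simp add: w_def norm_vector_smult)
    also have "\<dots> \<le> r * a" using r by (simp add: a_def)
    also have "\<dots> < r0 * a" using r nv by simp
    also have "\<dots> = \<rho> / 4" using nv by (simp add: r0_def)
    finally show ?thesis by simp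
  qed
  let ?C = "(\<lambda>t. u0 + t *s w) ` sphere 0 1"
  have "?C \<subseteq> ?W"
  proof
    fix x assume "x \<in> ?C"
    then obtain t where t: "cmod t = 1" "x = u0 + t *s w" by auto
    have "norm w < \<rho>" using norm_w norm_ge_zero[of w] by linarith
    then have "x \<in> ball u0 \<rho>" using t by (simp add: dist_norm norm_vector_smult)
    moreover have "x = u0 + (t * of_real r) *s v" using t by (simp add: w_def)
    then have "\<Delta> x = poly q0 (t * of_real r)" using q0 by simp
    moreover have "cmod (t * of_real r) = r" using t r by (simp add: norm_mult)
    ultimately show "x \<in> ?W" using r_notin by force
  qed
  moreover have "compact ?C" by (intro compact_continuous_image continuous_intros compact_sphere)
  ultimately obtain e0 where e0: "e0 > 0" "(\<Union>x\<in>?C. cball x e0) \<subseteq> ?W"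
    using compact_subset_open_imp_cball_epsilon_subset openW by metis
  define e where "e = min e0 (\<rho> / 2)"
  have e: "e > 0" "e \<le> \<rho> / 2" using e0 \<rho> by (auto simp: e_def)
  have circ: "u + t *s w \<in> ?W" if "u \<in> cball u0 e" "cmod t = 1" for u t
  proof -
    have "u + t *s w \<in> cball (u0 + t *s w) e0"
      using that(1) by (simp add: e_def)
    then show ?thesis using e0(2) that(2) by force
  qed
  have disc: "u + t *s w \<in> ball u0 \<rho>" if "u \<in> ball u0 e" "cmod t < 2" for u t
  proof -
    have "norm (u0 - (u + t *s w)) \<le> norm (u0 - u) + norm (t *s w)"
      using norm_triangle_ineq4[of "u0 - u" "t *s w"] by (simp add: algebra_simps)
    also have "norm (t *s w) \<le> 2 * norm w"
      using that(2) by (simp add: norm_vector_smult mult_right_mono)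
    finally show ?thesis using that(1) norm_w e by (simp add: dist_norm)
  qed
  obtain g where g: "holomorphic_several g (ball u0 e)"
    and g_lim: "\<forall>u\<in>ball u0 e. (\<lambda>N. root_mean N (\<lambda>t. h (u + t *s w))) \<longlonglongrightarrow> g u"
    using circle_mean_holomorphic[OF hol circ] by blast
  define \<Phi> where "\<Phi> x = ennreal ((cmod (h x))\<^sup>2) * indicator ?W x" for x
  have \<Phi>_meas: "\<Phi> \<in> borel_measurable borel"
  proof -
    have "(\<lambda>x. indicator ?W x *\<^sub>R h x) \<in> borel_measurable borel"
      using borel_measurable_continuous_on_indicator[of ?W h] openW holomorphic_several_continuous_on[OF hol]
      by simp
    then have "(\<lambda>x. ennreal ((cmod (indicator ?W x *\<^sub>R h x))\<^sup>2)) \<in> borel_measurable borel" by measurable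
    moreover have "(\<lambda>x. ennreal ((cmod (indicator ?W x *\<^sub>R h x))\<^sup>2)) = \<Phi>"
      by (auto simp: \<Phi>_def indicator_def)
    ultimately show ?thesis by (simp only:)
  qed
  have "AE u in lborel. (\<integral>\<^sup>+t. \<Phi> (u + t *s w) * indicator (ball (0::complex) 2) t \<partial>lborel) < \<infinity>"
    by (rule AE_slice_integrable[OF \<Phi>_meas]) (use fin in \<open>simp add: \<Phi>_def\<close>)
  then have ae: "AE u in lborel. u \<in> ball u0 e \<longrightarrow> \<Delta> u \<noteq> 0 \<longrightarrow> g u = h u"
  proof eventually_elim
    case (elim u)
    show ?case
    proof (intro impI)
      assume u: "u \<in> ball u0 e" "\<Delta> u \<noteq> 0"
      obtain q where q: "\<And>t. \<Delta> (u + t *s w) = poly q t" using polyfun_on_line[OF \<Delta>(1)] by metis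
      have "poly q 0 \<noteq> 0" using q[of 0] u by simp
      then have "q \<noteq> 0" by auto
      then have finS: "finite {t. poly q t = 0}" by (rule poly_roots_finite)
      define k where "k t = (if poly q t = 0 then 0 else h (u + t *s w))" for t
      have inW: "u + t *s w \<in> ?W" if "t \<in> ball 0 2 - {t. poly q t = 0}" for t
        using disc[OF u(1), of t] q that by simp
      have "(\<lambda>t. h (u + t *s w)) holomorphic_on ball 0 2 - {t. poly q t = 0}"
        using holomorphic_on_line[OF hol] by (rule holomorphic_on_subset) (use inW in auto)
      then have "k holomorphic_on ball 0 2 - {t. poly q t = 0}"
        by (rule holomorphic_transform) (simp add: k_def)
      moreover have "(\<integral>\<^sup>+t. ennreal ((cmod (k t))\<^sup>2) * indicator (ball 0 2) t \<partial>lborel) < \<infinity>"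
      proof (rule le_less_trans[OF nn_integral_mono elim])
        fix t
        show "ennreal ((cmod (k t))\<^sup>2) * indicator (ball 0 2) t \<le> \<Phi> (u + t *s w) * indicator (ball 0 2) t"
          using inW[of t] by (auto simp: k_def \<Phi>_def indicator_def)
      qed
      ultimately have "\<exists>G. G holomorphic_on ball 0 2 \<and> (\<forall>t\<in>ball 0 2 - {t. poly q t = 0}. G t = k t)"
        by (intro square_integrable_removable_finite[OF finS open_ball])
      then obtain G where G: "G holomorphic_on ball 0 2" "\<forall>t\<in>ball 0 2 - {t. poly q t = 0}. G t = k t" by blast
      have eqG: "h (u + t *s w) = G t" if "t \<in> ball 0 2" "poly q t \<noteq> 0" for t
        using G(2) that by (simp add: k_def)
      have "root_mean N (\<lambda>t. h (u + t *s w)) = root_mean N G" for N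
      proof -
        have "h (u + cis x *s w) = G (cis x)" for x
        proof (rule eqG)
          show "poly q (cis x) \<noteq> 0" using circ[of u "cis x"] u(1) q[of "cis x"] by auto
        qed simp
        then show ?thesis by (simp add: root_mean_def)
      qed
      then have "(\<lambda>N. root_mean N (\<lambda>t. h (u + t *s w))) \<longlonglongrightarrow> G 0"
        using root_mean_tendsto[OF G(1)] by simp
      then have "g u = G 0" using g_lim u(1) LIMSEQ_unique by blast
      also have "\<dots> = h u" using eqG[of 0] \<open>poly q 0 \<noteq> 0\<close> by simp
      finally show "g u = h u" .
    qed
  qed
  have "g u = h u" if u: "u \<in> ball u0 e" "\<Delta> u \<noteq> 0" for u
  proof (rule ccontr)
    assume ne: "g u \<noteq> h u"
    let ?S = "ball u0 e \<inter> {u. \<Delta> u \<noteq> 0}"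
    let ?T = "{x \<in> ?S. g x - h x \<in> - {0}}"
    have openS: "open ?S"
      by (intro open_Int open_ball open_Collect_neq \<Delta>_cont continuous_on_const)
    have "continuous_on ?S (\<lambda>x. g x - h x)"
      by (intro continuous_on_diff continuous_on_subset[OF holomorphic_several_continuous_on[OF g]]
          continuous_on_subset[OF holomorphic_several_continuous_on[OF hol]]) (use e in auto)
    then have openT: "open ?T"
      using continuous_open_preimage[OF _ openS, of "\<lambda>x. g x - h x" "- {0}"] by (simp add: vimage_def Int_def open_Compl)
    have uT: "u \<in> ?T" using u ne by simp
    have "AE x in lborel. x \<notin> ?T" using ae by eventually_elim auto
    then have "?T \<in> null_sets lborel"
      using openT AE_iff_null_sets[of ?T lborel] by simp
    then have "negligible ?T" by (simp add: negligible_iff_null_sets null_sets_completionI)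
    then show False using openT uT open_not_negligible by blast
  qed
  then show ?thesis using e g \<rho> by (intro exI[of _ e] conjI exI[of _ g]) auto
qed

text \<open>The local extensions fit together because they agree with \<open>h\<close> on the dense set where \<open>\<Delta>\<close> does not vanish.\<close>

lemma L2_extension:
  fixes h :: "complex^'d \<Rightarrow> complex"
  assumes \<Delta>: "\<Delta> \<in> polyfun" "\<Delta> b \<noteq> 0" and W: "open W"
    and hol: "holomorphic_several h (W \<inter> {u. \<Delta> u \<noteq> 0})"
    and fin: "\<And>u. u \<in> W \<Longrightarrow> \<exists>\<rho>>0. ball u \<rho> \<subseteq> W \<and>
      (\<integral>\<^sup>+x. ennreal ((cmod (h x))\<^sup>2) * indicator (ball u \<rho> \<inter> {u. \<Delta> u \<noteq> 0}) x \<partial>lborel) < \<infinity>"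
  shows "\<exists>g. holomorphic_several g W \<and> (\<forall>u\<in>W. \<Delta> u \<noteq> 0 \<longrightarrow> g u = h u)"
proof -
  have "\<exists>p. fst p > 0 \<and> ball u (fst p) \<subseteq> W \<and> holomorphic_several (snd p) (ball u (fst p)) \<and>
      (\<forall>x\<in>ball u (fst p). \<Delta> x \<noteq> 0 \<longrightarrow> snd p x = h x)" if u: "u \<in> W" for u
  proof -
    obtain \<rho> where \<rho>: "\<rho> > 0" "ball u \<rho> \<subseteq> W"
      "(\<integral>\<^sup>+x. ennreal ((cmod (h x))\<^sup>2) * indicator (ball u \<rho> \<inter> {u. \<Delta> u \<noteq> 0}) x \<partial>lborel) < \<infinity>"
      using fin[OF u] by blast
    have "holomorphic_several h (ball u \<rho> \<inter> {u. \<Delta> u \<noteq> 0})"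
      using hol by (rule holomorphic_several_subset) (use \<rho> in auto)
    from L2_extension_local[OF \<Delta> this \<rho>(1,3)]
    obtain e g where eg: "e > 0" "e \<le> \<rho>" "holomorphic_several g (ball u e)"
      "\<forall>x\<in>ball u e. \<Delta> x \<noteq> 0 \<longrightarrow> g x = h x" by blast
    have "ball u e \<subseteq> W" using \<rho>(2) eg(2) by (meson subset_ball order_trans)
    then show ?thesis using eg by (intro exI[of _ "(e, g)"]) simp
  qed
  then have "\<exists>p. \<forall>u\<in>W. fst (p u) > 0 \<and> ball u (fst (p u)) \<subseteq> W \<and> holomorphic_several (snd (p u)) (ball u (fst (p u))) \<and>
      (\<forall>x\<in>ball u (fst (p u)). \<Delta> x \<noteq> 0 \<longrightarrow> snd (p u) x = h x)"
    by (intro bchoice) blast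
  then obtain p where p: "\<forall>u\<in>W. fst (p u) > 0 \<and> ball u (fst (p u)) \<subseteq> W \<and> holomorphic_several (snd (p u)) (ball u (fst (p u))) \<and>
      (\<forall>x\<in>ball u (fst (p u)). \<Delta> x \<noteq> 0 \<longrightarrow> snd (p u) x = h x)" by blast
  \<comment> \<open>\<open>p u\<close> consists of the radius of a ball around \<open>u\<close> and a local extension on this ball.\<close>
  define g where "g u = snd (p u) u" for u
  have agree: "g x = snd (p u) x" if u: "u \<in> W" and x: "x \<in> ball u (fst (p u))" for u x
  proof -
    have xW: "x \<in> W" using p u x by blast
    let ?S = "ball x (fst (p x)) \<inter> ball u (fst (p u))"
    have "snd (p x) x = snd (p u) x"
    proof (rule continuous_agree_off_zeros[OF \<Delta>, where S = ?S and f = "snd (p x)" and g = "snd (p u)" and u = x])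
      show "continuous_on ?S (snd (p x))"
        using p xW by (meson Int_lower1 continuous_on_subset holomorphic_several_continuous_on)
      show "continuous_on ?S (snd (p u))"
        using p u by (meson Int_lower2 continuous_on_subset holomorphic_several_continuous_on)
      show "snd (p x) y = snd (p u) y" if "y \<in> ?S" "\<Delta> y \<noteq> 0" for y
        using p xW u that by simp
      show "x \<in> ?S" using p xW x by simp
    qed auto
    then show ?thesis by (simp add: g_def)
  qed
  have "holomorphic_several g W"
    unfolding holomorphic_several_def
  proof
    fix u assume u: "u \<in> W"
    let ?B = "ball u (fst (p u))"
    have "holomorphic_several g ?B"
      using holomorphic_several_cong[of ?B g "snd (p u)"] agree[OF u] p u by simp
    moreover have "u \<in> ?B" using p u by simp
    ultimately show "\<exists>f'. (g has_derivative f') (at u) \<and> (\<forall>c v. f' (c *s v) = c * f' v)"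
      unfolding holomorphic_several_def by blast
  qed
  moreover have "\<forall>u\<in>W. \<Delta> u \<noteq> 0 \<longrightarrow> g u = h u"
  proof (intro ballI impI)
    fix u assume "u \<in> W" "\<Delta> u \<noteq> 0"
    moreover have "u \<in> ball u (fst (p u))" using p \<open>u \<in> W\<close> by simp
    ultimately show "g u = h u" using p by (simp add: g_def)
  qed
  ultimately show ?thesis by blast
qed

section \<open>The push-forward of volume under a basic map\<close>

lemma emeasure_eq_from_local:
  fixes \<mu> \<nu> :: "'a::second_countable_topology measure"
  assumes sets: "sets \<mu> = sets borel" "sets \<nu> = sets borel"
    and loc: "\<And>x. x \<in> W \<Longrightarrow> \<exists>V. open V \<and> x \<in> V \<and> (\<forall>B\<in>sets borel. B \<subseteq> V \<longrightarrow> emeasure \<mu> B = emeasure \<nu> B)"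
    and B: "B \<in> sets borel" "B \<subseteq> W"
  shows "emeasure \<mu> B = emeasure \<nu> B"
proof -
  let ?F = "{V. open V \<and> (\<forall>B\<in>sets borel. B \<subseteq> V \<longrightarrow> emeasure \<mu> B = emeasure \<nu> B)}"
  obtain F' where F': "F' \<subseteq> ?F" "countable F'" "\<Union>F' = \<Union>?F"
    using Lindelof[of ?F] by auto
  have W: "W \<subseteq> \<Union>F'" unfolding F'(3) using loc by blast
  show ?thesis
  proof (cases "F' = {}")
    case True
    then have "B = {}" using W B by auto
    then show ?thesis by simp
  next
    case False
    define V where "V = from_nat_into F'"
    have V: "V n \<in> ?F" for n using F'(1) from_nat_into[OF False] by (auto simp: V_def)
    have UV: "(\<Union>n. V n) = \<Union>F'" using range_from_nat_into[OF False F'(2)] by (simp add: V_def)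
    have D_sets: "B \<inter> disjointed V n \<in> sets borel" for n
    proof -
      have "range V \<subseteq> sets borel" using V by auto
      then have "disjointed V n \<in> sets borel" using sets.range_disjointed_sets[of V borel] by auto
      then show ?thesis using B by simp
    qed
    then have rng: "range (\<lambda>n. B \<inter> disjointed V n) \<subseteq> sets borel" by blast
    have disj: "disjoint_family (\<lambda>n. B \<inter> disjointed V n)"
      using disjoint_family_disjointed[of V] by (auto simp: disjoint_family_on_def)
    have UB: "(\<Union>n. B \<inter> disjointed V n) = B"
      using W B UV UN_disjointed_eq[of V] by auto
    have eq: "emeasure \<mu> (B \<inter> disjointed V n) = emeasure \<nu> (B \<inter> disjointed V n)" for n
      using V[of n] D_sets[of n] disjointed_subset[of V n] by (simp add: le_infI2)
    have "emeasure \<mu> B = suminf (\<lambda>n. emeasure \<mu> (B \<inter> disjointed V n))"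
      using suminf_emeasure[OF _ disj, of \<mu>] rng unfolding UB sets by simp
    also have "\<dots> = suminf (\<lambda>n. emeasure \<nu> (B \<inter> disjointed V n))" by (simp add: eq)
    also have "\<dots> = emeasure \<nu> B"
      using suminf_emeasure[OF _ disj, of \<nu>] rng unfolding UB sets by simp
    finally show ?thesis .
  qed
qed

lemma emeasure_holomorphic_image:
  fixes f :: "complex^'d \<Rightarrow> complex^'d"
  assumes S: "S \<in> sets borel" and der: "\<And>x. (f has_derivative (*v) (A x)) (at x)"
    and inj: "inj_on f S" and meas: "(\<lambda>x. det (A x)) \<in> borel_measurable borel"
    and nz: "\<And>x. x \<in> S \<Longrightarrow> det (A x) \<noteq> 0"
  shows "emeasure lebesgue (f ` S) = (\<integral>\<^sup>+x. ennreal ((cmod (det (A x)))\<^sup>2) * indicator S x \<partial>lborel)"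
proof -
  obtain b :: "'d bit0 \<Rightarrow> complex^'d" where b: "bij_betw b UNIV Basis"
    using ex_bij_betw_complex_vec_Basis by blast
  have "emeasure lebesgue (f ` S) = (\<integral>\<^sup>+x. ennreal (indicator S x * (cmod (det (A x)))\<^sup>2) \<partial>lborel)"
  proof (rule emeasure_differentiable_image(2)[OF b S _ inj])
    show "(f has_derivative (*v) (A x)) (at x within S)" for x
      by (rule has_derivative_at_withinI[OF der])
    show "(\<lambda>x. (cmod (det (A x)))\<^sup>2) \<in> borel_measurable borel" using meas by measurable
    show "volume_factor b ((*v) (A x)) = (cmod (det (A x)))\<^sup>2" if "x \<in> S" for x
      by (rule volume_factor_matrix[OF b nz[OF that]])
  qed
  also have "\<dots> = (\<integral>\<^sup>+x. ennreal ((cmod (det (A x)))\<^sup>2) * indicator S x \<partial>lborel)"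
    by (rule nn_integral_cong) (simp add: indicator_def)
  finally show ?thesis .
qed

context basic_map
begin

text \<open>Right multiplication by \<open>A\<close> permutes \<open>G\<close>, so comparing the products of all determinants gives
\<open>det A ^ card G = 1\<close>.\<close>

lemma det_unimodular:
  assumes "A \<in> G"
  shows "cmod (det A) = 1"
proof -
  have "(\<Prod>B\<in>G. det B) = (\<Prod>B\<in>G. det (B ** A))"
    using prod.reindex_bij_betw[OF bij_betw_mult_right[OF assms], of det] by simp
  also have "\<dots> = (\<Prod>B\<in>G. det B) * det A ^ card G"
    by (simp add: det_mul prod.distrib)
  finally have "(\<Prod>B\<in>G. det B) * 1 = (\<Prod>B\<in>G. det B) * det A ^ card G" by simp
  moreover have "det B \<noteq> 0" if B: "B \<in> G" for B
  proof
    assume "det B = 0"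
    moreover obtain C where "B ** C = mat 1" using inverse_mem[OF B] by blast
    then have "det B * det C = 1" by (metis det_mul det_I)
    ultimately show False by simp
  qed
  then have "(\<Prod>B\<in>G. det B) \<noteq> 0" using finite_G by simp
  ultimately have "det A ^ card G = 1" by (metis mult_left_cancel)
  then have "cmod (det A) ^ card G = 1" by (metis norm_one norm_power)
  moreover have "card G > 0" using finite_G one_mem card_gt_0_iff by blast
  ultimately show ?thesis using power_eq_imp_eq_base[of "cmod (det A)" "card G" 1] by simp
qed

lemma norm_jacobian_invariant:
  assumes "A \<in> G"
  shows "cmod (complex_jacobian \<theta> (A *v z)) = cmod (complex_jacobian \<theta> z)"
  using complex_jacobian_equivariant[OF assms, of z] det_unimodular[OF assms] by (metis mult.right_neutral norm_mult)

lemma jacobian_measurable: "complex_jacobian \<theta> \<in> borel_measurable borel"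
  by (intro borel_measurable_continuous_onI holomorphic_several_continuous_on[OF holomorphic_several_polyfun]
      complex_jacobian_polyfun)

lemma theta_measurable: "\<theta> \<in> borel_measurable borel"
  by (intro borel_measurable_continuous_onI theta_continuous_on)

text \<open>If \<open>\<theta>\<close> is injective on \<open>U\<close> and \<open>B\<close> lies in \<open>\<theta>(U)\<close>, the preimage of \<open>B\<close> is the disjoint union of
the translates \<open>A S\<close>, \<open>A \<in> G\<close>, of one sheet \<open>S \<subseteq> U\<close>, since the points of \<open>U\<close> have trivial
stabilizers. Each translate is mapped bijectively onto \<open>B\<close> and contributes the volume of \<open>B\<close>.\<close>

lemma local_pushforward:
  assumes Om: "Om \<in> sets borel" "\<And>A z. A \<in> G \<Longrightarrow> z \<in> Om \<Longrightarrow> A *v z \<in> Om"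
    and free: "\<And>z A. z \<in> Om \<Longrightarrow> A \<in> G \<Longrightarrow> A *v z = z \<Longrightarrow> A = mat 1"
    and U: "U \<in> sets borel" "U \<subseteq> Om" "inj_on \<theta> U" and B: "B \<in> sets borel" "B \<subseteq> \<theta> ` U"
  shows "(\<integral>\<^sup>+z. ennreal ((cmod (complex_jacobian \<theta> z))\<^sup>2) * indicator (Om \<inter> \<theta> -` B) z \<partial>lborel)
    = of_nat (card G) * emeasure lborel B"
proof -
  define S where "S = U \<inter> \<theta> -` B"
  have S_sets: "S \<in> sets borel"
    using measurable_sets[OF theta_measurable B(1)] U by (simp add: S_def)
  have AS_sets: "(*v) A ` S \<in> sets borel" if A: "A \<in> G" for A
  proof -
    obtain C where C: "A ** C = mat 1" "C ** A = mat 1" using inverse_mem[OF A] by blast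
    have "(*v) A ` S = (*v) C -` S"
    proof (intro equalityI subsetI)
      fix x assume "x \<in> (*v) C -` S"
      moreover have "x = A *v (C *v x)" by (simp add: matrix_vector_mul_assoc C)
      ultimately show "x \<in> (*v) A ` S" by blast
    qed (auto simp: matrix_vector_mul_assoc C)
    moreover have "(*v) C \<in> borel_measurable borel"
      by (intro borel_measurable_continuous_onI linear_continuous_on bounded_linear_matrix)
    ultimately show ?thesis using measurable_sets[of "(*v) C" borel borel S] S_sets by simp
  qed
  have one: "(\<integral>\<^sup>+z. ennreal ((cmod (complex_jacobian \<theta> z))\<^sup>2) * indicator ((*v) A ` S) z \<partial>lborel) = emeasure lborel B"
    if A: "A \<in> G" for A
  proof -
    have "emeasure lebesgue (\<theta> ` ((*v) A ` S)) =
      (\<integral>\<^sup>+z. ennreal ((cmod (det (jacobian_matrix \<theta> z)))\<^sup>2) * indicator ((*v) A ` S) z \<partial>lborel)"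
    proof (rule emeasure_holomorphic_image[OF AS_sets[OF A] theta_has_derivative])
      show "inj_on \<theta> ((*v) A ` S)"
        using U(3) by (auto simp: inj_on_def S_def theta_invariant[OF A])
      show "(\<lambda>x. det (jacobian_matrix \<theta> x)) \<in> borel_measurable borel"
        using jacobian_measurable by (simp add: complex_jacobian_eq_det[abs_def])
      fix x assume "x \<in> (*v) A ` S"
      then have "x \<in> Om" using Om(2)[OF A] U(2) by (auto simp: S_def)
      then have "complex_jacobian \<theta> x \<noteq> 0" using free by (intro complex_jacobian_nonzero) blast
      then show "det (jacobian_matrix \<theta> x) \<noteq> 0" by (simp add: complex_jacobian_eq_det)
    qed
    moreover have "\<theta> ` ((*v) A ` S) = B"
      using B(2) by (auto simp: image_image theta_invariant[OF A] S_def)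
    ultimately show ?thesis using B(1) by (simp add: complex_jacobian_eq_det)
  qed
  have ind: "indicator (Om \<inter> \<theta> -` B) z = (\<Sum>A\<in>G. indicator ((*v) A ` S) z :: ennreal)" for z
  proof (cases "z \<in> Om \<inter> \<theta> -` B")
    case True
    then obtain s where s: "s \<in> U" "\<theta> z = \<theta> s" using B(2) by auto
    then have sS: "s \<in> S" using True by (simp add: S_def)
    obtain A where A: "A \<in> G" "z = A *v s" using s(2) theta_eq_iff[of s z] by auto
    have uniq: "A' = A" if A': "A' \<in> G" "z \<in> (*v) A' ` S" for A'
    proof -
      obtain s' where s': "s' \<in> S" "z = A' *v s'" using A'(2) by blast
      have "\<theta> s' = \<theta> s" using theta_invariant[OF A'(1), of s'] theta_invariant[OF A(1), of s] s'(2) A(2) by simp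
      then have "s' = s" using U(3) s' s(1) by (auto simp: S_def dest: inj_onD)
      obtain C where C: "C \<in> G" "C ** A = mat 1" "A ** C = mat 1" using inverse_mem[OF A(1)] by blast
      have "(C ** A') *v s = C *v (A *v s)"
        using s'(2) A(2) \<open>s' = s\<close> by (simp add: matrix_vector_mul_assoc[symmetric])
      then have "(C ** A') *v s = s" by (simp add: matrix_vector_mul_assoc C(2))
      moreover have "s \<in> Om" using s U(2) by blast
      ultimately have "C ** A' = mat 1" using free mult_mem[OF C(1) A'(1)] by blast
      then have "A ** (C ** A') = A" by simp
      then show ?thesis by (simp add: matrix_mul_assoc C(3))
    qed
    have "(\<Sum>A'\<in>G. indicator ((*v) A' ` S) z :: ennreal) = (\<Sum>A'\<in>{A}. indicator ((*v) A' ` S) z)"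
    proof (rule sum.mono_neutral_right[OF finite_G])
      show "\<forall>A'\<in>G - {A}. indicator ((*v) A' ` S) z = (0::ennreal)"
        using uniq by (auto simp: indicator_def)
    qed (use A in auto)
    also have "\<dots> = 1" using A(2) sS by (simp add: indicator_def)
    finally show ?thesis using True by simp
  next
    case False
    have "z \<notin> (*v) A ` S" if A: "A \<in> G" for A
    proof
      assume "z \<in> (*v) A ` S"
      then obtain s where s: "s \<in> S" "z = A *v s" by blast
      then have "z \<in> Om \<inter> \<theta> -` B" using Om(2)[OF A] U(2) by (auto simp: S_def theta_invariant[OF A])
      then show False using False by blast
    qed
    then show ?thesis using False by simp
  qed
  have "(\<integral>\<^sup>+z. ennreal ((cmod (complex_jacobian \<theta> z))\<^sup>2) * indicator (Om \<inter> \<theta> -` B) z \<partial>lborel)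
    = (\<integral>\<^sup>+z. (\<Sum>A\<in>G. ennreal ((cmod (complex_jacobian \<theta> z))\<^sup>2) * indicator ((*v) A ` S) z) \<partial>lborel)"
    by (simp add: ind sum_distrib_left)
  also have "\<dots> = (\<Sum>A\<in>G. \<integral>\<^sup>+z. ennreal ((cmod (complex_jacobian \<theta> z))\<^sup>2) * indicator ((*v) A ` S) z \<partial>lborel)"
  proof (rule nn_integral_sum)
    fix A assume "A \<in> G"
    then have [measurable]: "(*v) A ` S \<in> sets borel" by (rule AS_sets)
    show "(\<lambda>z. ennreal ((cmod (complex_jacobian \<theta> z))\<^sup>2) * indicator ((*v) A ` S) z) \<in> borel_measurable lborel"
      using jacobian_measurable by measurable
  qed
  also have "\<dots> = of_nat (card G) * emeasure lborel B" by (simp add: one)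
  finally show ?thesis .
qed

text \<open>Two measures which agree on the small Borel sets agree, and \<open>\<theta>\<close> is locally injective where
the stabilizers are trivial.\<close>

lemma theta_pushforward:
  assumes Om: "open Om" "\<And>A z. A \<in> G \<Longrightarrow> z \<in> Om \<Longrightarrow> A *v z \<in> Om"
    and free: "\<And>z A. z \<in> Om \<Longrightarrow> A \<in> G \<Longrightarrow> A *v z = z \<Longrightarrow> A = mat 1"
    and B: "B \<in> sets borel" "B \<subseteq> \<theta> ` Om"
  shows "(\<integral>\<^sup>+z. ennreal ((cmod (complex_jacobian \<theta> z))\<^sup>2) * indicator (Om \<inter> \<theta> -` B) z \<partial>lborel)
    = of_nat (card G) * emeasure lborel B"
proof -
  define j where "j z = ennreal ((cmod (complex_jacobian \<theta> z))\<^sup>2) * indicator Om z" for z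
  have Om_sets [measurable]: "Om \<in> sets borel" using Om by simp
  have j_meas [measurable]: "j \<in> borel_measurable borel"
    unfolding j_def[abs_def] using jacobian_measurable by measurable
  note theta_measurable [measurable]
  define \<mu> where "\<mu> = distr (density lborel j) borel \<theta>"
  define \<nu> where "\<nu> = density lborel (\<lambda>_::complex^'d. of_nat (card G) :: ennreal)"
  have \<mu>: "emeasure \<mu> X = (\<integral>\<^sup>+z. ennreal ((cmod (complex_jacobian \<theta> z))\<^sup>2) * indicator (Om \<inter> \<theta> -` X) z \<partial>lborel)"
    if X: "X \<in> sets borel" for X
  proof -
    have "\<theta> -` X \<in> sets borel" using measurable_sets[OF theta_measurable X] by simp
    then show ?thesis
      using X by (simp add: \<mu>_def emeasure_distr emeasure_density)
        (intro nn_integral_cong, auto simp: j_def indicator_def)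
  qed
  have \<nu>: "emeasure \<nu> X = of_nat (card G) * emeasure lborel X" if "X \<in> sets borel" for X
    using that by (simp add: \<nu>_def emeasure_density_const)
  have "emeasure \<mu> B = emeasure \<nu> B"
  proof (rule emeasure_eq_from_local[where W = "\<theta> ` Om"])
    fix u assume "u \<in> \<theta> ` Om"
    then obtain z where z: "z \<in> Om" "u = \<theta> z" by blast
    have J: "complex_jacobian \<theta> z \<noteq> 0" using free z(1) by (intro complex_jacobian_nonzero) blast
    obtain U V g where UV: "open U" "U \<subseteq> Om" "z \<in> U" "open V" "homeomorphism U V \<theta> g"
      using theta_local_inverse[OF J Om(1) z(1)] by blast
    have V: "V = \<theta> ` U" using UV(5) by (simp add: homeomorphism_def)
    have inj: "inj_on \<theta> U" using UV(5) by (metis homeomorphism_apply1 inj_on_inverseI)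
    show "\<exists>V. open V \<and> u \<in> V \<and> (\<forall>B\<in>sets borel. B \<subseteq> V \<longrightarrow> emeasure \<mu> B = emeasure \<nu> B)"
    proof (intro exI[of _ V] conjI ballI impI)
      show "u \<in> V" using V UV(3) z(2) by blast
      fix X :: "(complex^'d) set" assume X: "X \<in> sets borel" "X \<subseteq> V"
      have U_sets: "U \<in> sets borel" using UV(1) by simp
      show "emeasure \<mu> X = emeasure \<nu> X"
        unfolding \<mu>[OF X(1)] \<nu>[OF X(1)]
        by (rule local_pushforward[OF Om_sets Om(2) free U_sets UV(2) inj X(1)]) (use X V in auto)
    qed (rule UV)
  qed (use B in \<open>auto simp: \<mu>_def \<nu>_def\<close>)
  then show ?thesis using \<mu>[OF B(1)] \<nu>[OF B(1)] by simp
qed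

end

section \<open>Push-forwards between weighted domains\<close>

text \<open>A map \<open>T\<close> under which the measure with density \<open>j\<close> is pushed forward to \<open>N\<close> times Lebesgue measure, and
for which the weight on \<open>D\<close> is the pullback of the weight on \<open>E\<close>. It is used for \<open>\<theta>\<close> with
\<open>j = |J|\<^sup>2\<close> and \<open>N\<close> the order of \<open>G\<close>, and for the elements of \<open>G\<close> with \<open>j = 1\<close> and \<open>N = 1\<close>.
The hypothesis concerns Borel sets only; the conclusions are for Lebesgue measurable functions.\<close>

locale weighted_pushforward =
  dom: weighted_domain V D \<nu> c + cod: weighted_domain V E \<nu>' c
  for V :: "(complex^'d) measure" and D \<nu> c E \<nu>' +
  fixes T :: "complex^'d \<Rightarrow> complex^'d" and j :: "complex^'d \<Rightarrow> real" and D0 :: "(complex^'d) set" and N :: real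
  assumes T_cont: "continuous_on UNIV T" and T_maps: "z \<in> D \<Longrightarrow> T z \<in> E"
    and weight: "z \<in> D \<Longrightarrow> \<nu> z = \<nu>' (T z)"
    and j_meas: "j \<in> borel_measurable borel" and j_nonneg: "0 \<le> j z" and N_nonneg: "0 \<le> N"
    and D0: "D0 \<in> sets borel" "D0 \<subseteq> D" "negligible (D - D0)" and j_pos: "z \<in> D0 \<Longrightarrow> 0 < j z"
    and pushforward: "B \<in> sets borel \<Longrightarrow> B \<subseteq> E \<Longrightarrow>
      (\<integral>\<^sup>+z. ennreal (j z) * indicator (D0 \<inter> T -` B) z \<partial>lborel) = ennreal N * emeasure lborel B"
begin

lemma T_measurable_borel: "T \<in> borel_measurable borel"
  by (rule borel_measurable_continuous_onI[OF T_cont])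

lemma vimage_borel: "B \<in> sets borel \<Longrightarrow> T -` B \<in> sets borel"
  using measurable_sets[OF T_measurable_borel] by simp

lemma E_borel: "E \<in> sets borel" using cod.open_D by simp

text \<open>Lebesgue measurability does not pull back along arbitrary continuous maps. Here it does, because the
preimage of a null set has measure zero for the measure with density \<open>j\<close>, which is positive almost everywhere on \<open>D\<close>.\<close>

lemma negligible_vimage:
  assumes "negligible X" "X \<subseteq> E"
  shows "negligible (D \<inter> T -` X)"
proof -
  obtain N' where N': "N' \<in> null_sets lborel" "X \<subseteq> N'"
    using assms(1) by (auto simp: negligible_iff_null_sets null_sets_completion_iff2)
  define B where "B = N' \<inter> E"
  have B: "B \<in> sets borel" "B \<subseteq> E" "emeasure lborel B = 0"
  proof -
    show "B \<in> sets borel" using N' E_borel by (auto simp: B_def null_sets_def)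
    have "B \<in> null_sets lborel"
      using null_sets_subset[OF N'(1)] \<open>B \<in> sets borel\<close> by (auto simp: B_def)
    then show "emeasure lborel B = 0" by (simp add: null_sets_def)
  qed (simp add: B_def)
  let ?Y = "D0 \<inter> T -` B"
  have Y: "?Y \<in> sets borel" using D0(1) vimage_borel[OF B(1)] by simp
  have "(\<integral>\<^sup>+z. ennreal (j z) * indicator ?Y z \<partial>lborel) = 0"
    using pushforward[OF B(1,2)] B(3) by simp
  then have "AE z in lborel. ennreal (j z) * indicator ?Y z = 0"
    using Y j_meas by (subst (asm) nn_integral_0_iff_AE) auto
  then have "AE z in lborel. z \<notin> ?Y"
  proof eventually_elim
    case (elim z)
    show ?case
    proof
      assume z: "z \<in> ?Y"
      then have "0 < j z" using j_pos by blast
      then show False using elim z by simp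
    qed
  qed
  then have "?Y \<in> null_sets lborel" using Y AE_iff_null_sets[of ?Y lborel] by simp
  then have "negligible ?Y" by (simp add: negligible_iff_null_sets null_sets_completionI)
  then have "negligible ((D - D0) \<union> ?Y)" using D0(3) by simp
  then show ?thesis
    by (rule negligible_subset) (use N'(2) assms(2) in \<open>auto simp: B_def\<close>)
qed

lemma T_measurable: "T \<in> measurable (lebesgue_on D) (lebesgue_on E)"
proof (rule measurableI)
  fix z assume "z \<in> space (lebesgue_on D)"
  then show "T z \<in> space (lebesgue_on E)" using T_maps by simp
next
  fix X assume "X \<in> sets (lebesgue_on E)"
  then have X: "X \<in> sets lebesgue" "X \<subseteq> E" by (auto simp: sets_restrict_space_iff)
  obtain B Z where BZ: "B \<in> sets borel" "negligible Z" "B \<union> Z = X"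
    using sets_lebesgue_almost_borel[OF X(1)] by blast
  have "D \<inter> T -` Z \<in> sets lebesgue"
    using negligible_vimage[OF BZ(2)] BZ(3) X(2) by (intro negligible_imp_sets) blast
  moreover have "D \<inter> T -` B \<in> sets lebesgue"
    using vimage_borel[OF BZ(1)] dom.open_D by simp
  ultimately have "(D \<inter> T -` B) \<union> (D \<inter> T -` Z) \<in> sets lebesgue" by (rule sets.Un[rotated])
  moreover have "(D \<inter> T -` B) \<union> (D \<inter> T -` Z) = T -` X \<inter> space (lebesgue_on D)"
    using BZ(3) by auto
  ultimately show "T -` X \<inter> space (lebesgue_on D) \<in> sets (lebesgue_on D)"
    by (simp add: sets_restrict_space_iff)
qed

text \<open>For Borel functions this is the transformation of integrals under an image measure. A Lebesgue
measurable function agrees with a Borel function outside a null set, whose preimage is again null.\<close>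

lemma nn_integral_pushforward_lebesgue:
  fixes k :: "complex^'d \<Rightarrow> ennreal"
  assumes k: "k \<in> borel_measurable (lebesgue_on E)"
  shows "(\<integral>\<^sup>+z. ennreal (j z) * k (T z) * indicator D z \<partial>lebesgue)
    = ennreal N * (\<integral>\<^sup>+u. k u * indicator E u \<partial>lebesgue)"
proof -
  have "(\<lambda>u. k u * indicator E u) \<in> borel_measurable lebesgue"
    using k by (subst (asm) borel_measurable_restrict_space_iff_ennreal) auto
  then obtain k' where k': "k' \<in> borel_measurable lborel" "AE u in lborel. k u * indicator E u = k' u"
    using completion_ex_borel_measurable by blast
  note [measurable] = j_meas T_measurable_borel E_borel D0(1) k'(1)
  define \<mu> where "\<mu> = distr (density lborel (\<lambda>z. ennreal (j z) * indicator D0 z)) borel T"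
  have \<mu>: "\<mu> = density lborel (\<lambda>u. ennreal N * indicator E u)"
  proof (rule measure_eqI)
    fix X assume "X \<in> sets \<mu>"
    then have X: "X \<in> sets borel" by (simp add: \<mu>_def)
    have XE: "X \<inter> E \<in> sets borel" using X E_borel by simp
    have "emeasure \<mu> X = (\<integral>\<^sup>+z. ennreal (j z) * indicator (D0 \<inter> T -` (X \<inter> E)) z \<partial>lborel)"
      using X vimage_borel[OF X]
      by (simp add: \<mu>_def emeasure_distr emeasure_density)
        (intro nn_integral_cong, use D0(2) T_maps in \<open>auto simp: indicator_def\<close>)
    also have "\<dots> = ennreal N * emeasure lborel (X \<inter> E)" by (rule pushforward[OF XE]) simp
    also have "\<dots> = (\<integral>\<^sup>+u. ennreal N * indicator (X \<inter> E) u \<partial>lborel)"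
      using XE by (simp add: nn_integral_cmult_indicator)
    also have "\<dots> = (\<integral>\<^sup>+u. ennreal N * indicator E u * indicator X u \<partial>lborel)"
      by (intro nn_integral_cong) (auto simp: indicator_def)
    also have "\<dots> = emeasure (density lborel (\<lambda>u. ennreal N * indicator E u)) X"
      using X by (simp add: emeasure_density)
    finally show "emeasure \<mu> X = emeasure (density lborel (\<lambda>u. ennreal N * indicator E u)) X" .
  qed (simp add: \<mu>_def)
  obtain Z where Z: "Z \<in> null_sets lborel" "\<And>u. u \<notin> Z \<Longrightarrow> k u * indicator E u = k' u"
    using AE_E3[OF k'(2)] by auto
  have "negligible Z" using Z(1) by (simp add: negligible_iff_null_sets null_sets_completionI)
  then have "negligible {u. k u * indicator E u \<noteq> k' u}"
    by (rule negligible_subset) (use Z(2) in blast)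
  then have "negligible ({u. k u * indicator E u \<noteq> k' u} \<inter> E)" by (rule negligible_Int[OF disjI1])
  then have "negligible (D \<inter> T -` ({u. k u * indicator E u \<noteq> k' u} \<inter> E))"
    by (rule negligible_vimage) simp
  then have "negligible ((D - D0) \<union> (D \<inter> T -` ({u. k u * indicator E u \<noteq> k' u} \<inter> E)))"
    using D0(3) by simp
  then have ae: "AE z in lebesgue. z \<notin> (D - D0) \<union> (D \<inter> T -` ({u. k u * indicator E u \<noteq> k' u} \<inter> E))"
    unfolding negligible_iff_null_sets by (rule AE_not_in)
  have "(\<integral>\<^sup>+z. ennreal (j z) * k (T z) * indicator D z \<partial>lebesgue)
    = (\<integral>\<^sup>+z. ennreal (j z) * indicator D0 z * k' (T z) \<partial>lebesgue)"
    by (rule nn_integral_cong_AE, use ae in eventually_elim)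
      (use D0(2) T_maps in \<open>auto simp: indicator_def\<close>)
  also have "\<dots> = (\<integral>\<^sup>+z. ennreal (j z) * indicator D0 z * k' (T z) \<partial>lborel)"
    by (simp add: nn_integral_completion)
  also have "\<dots> = (\<integral>\<^sup>+u. k' u \<partial>\<mu>)"
    unfolding \<mu>_def by (subst nn_integral_distr) (auto simp: nn_integral_density)
  also have "\<dots> = (\<integral>\<^sup>+u. ennreal N * indicator E u * k' u \<partial>lborel)"
    unfolding \<mu> by (subst nn_integral_density) auto
  also have "\<dots> = (\<integral>\<^sup>+u. ennreal N * (k u * indicator E u) \<partial>lborel)"
    by (rule nn_integral_cong_AE, use k'(2) in eventually_elim) (auto simp: indicator_def)
  also have "\<dots> = (\<integral>\<^sup>+u. ennreal N * (k u * indicator E u) \<partial>lebesgue)"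
    by (simp add: nn_integral_completion)
  also have "\<dots> = ennreal N * (\<integral>\<^sup>+u. k u * indicator E u \<partial>lebesgue)"
    by (rule nn_integral_cmult) fact
  finally show ?thesis .
qed

lemma nn_integral_pushforward:
  fixes k :: "complex^'d \<Rightarrow> ennreal"
  assumes [measurable]: "k \<in> borel_measurable (lebesgue_on E)"
  shows "(\<integral>\<^sup>+z. ennreal (j z) * k (T z) \<partial>dom.M) = ennreal N * (\<integral>\<^sup>+u. k u \<partial>cod.M)"
proof -
  note [measurable] = T_measurable
  have [measurable]: "j \<in> borel_measurable (lebesgue_on D)"
    using j_meas by (intro measurable_restrict_space1) (simp add: measurable_completion)
  have "(\<integral>\<^sup>+z. ennreal (j z) * k (T z) \<partial>dom.M)
    = (\<integral>\<^sup>+z. ennreal (c * \<nu> z) * (ennreal (j z) * k (T z)) * indicator D z \<partial>lebesgue)"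
    by (rule dom.nn_integral_M) measurable
  also have "\<dots> = (\<integral>\<^sup>+z. ennreal (j z) * (ennreal (c * \<nu>' (T z)) * k (T z)) * indicator D z \<partial>lebesgue)"
    by (intro nn_integral_cong) (auto simp: weight indicator_def mult_ac)
  also have "\<dots> = ennreal N * (\<integral>\<^sup>+u. (ennreal (c * \<nu>' u) * k u) * indicator E u \<partial>lebesgue)"
    by (rule nn_integral_pushforward_lebesgue) measurable
  also have "\<dots> = ennreal N * (\<integral>\<^sup>+u. k u \<partial>cod.M)"
    by (simp add: cod.nn_integral_M)
  finally show ?thesis .
qed

lemma integral_pushforward:
  fixes F :: "complex^'d \<Rightarrow> complex"
  assumes F: "F \<in> borel_measurable (lebesgue_on E)"
  shows "(LINT z|dom.M. of_real (j z) * F (T z)) = of_real N * (LINT u|cod.M. F u)"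
proof -
  have j_M: "j \<in> borel_measurable dom.M"
    unfolding measurable_cong_sets[OF dom.sets_M refl]
    using j_meas by (intro measurable_restrict_space1) (simp add: measurable_completion)
  have T_M: "T \<in> measurable dom.M cod.M"
    unfolding measurable_cong_sets[OF dom.sets_M cod.sets_M] by (rule T_measurable)
  have F_M: "F \<in> borel_measurable cod.M"
    unfolding measurable_cong_sets[OF cod.sets_M refl] by (rule F)
  have T_M': "T \<in> measurable (density dom.M (\<lambda>z. ennreal (j z))) cod.M"
    using T_M by simp
  have eq: "distr (density dom.M (\<lambda>z. ennreal (j z))) cod.M T = density cod.M (\<lambda>_. ennreal N)"
  proof (rule measure_eqI)
    fix X assume "X \<in> sets (distr (density dom.M (\<lambda>z. ennreal (j z))) cod.M T)"
    then have X: "X \<in> sets cod.M" by simp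
    have TX: "T -` X \<inter> space dom.M \<in> sets dom.M" using T_M X by (rule measurable_sets)
    have "emeasure (distr (density dom.M (\<lambda>z. ennreal (j z))) cod.M T) X
      = emeasure (density dom.M (\<lambda>z. ennreal (j z))) (T -` X \<inter> space dom.M)"
      using T_M' X by (simp add: emeasure_distr)
    also have "\<dots> = (\<integral>\<^sup>+z. ennreal (j z) * indicator (T -` X \<inter> space dom.M) z \<partial>dom.M)"
      using TX j_M by (intro emeasure_density) auto
    also have "\<dots> = (\<integral>\<^sup>+z. ennreal (j z) * indicator X (T z) \<partial>dom.M)"
      by (intro nn_integral_cong) (auto simp: indicator_def)
    also have "\<dots> = ennreal N * (\<integral>\<^sup>+u. indicator X u \<partial>cod.M)"
      using X by (intro nn_integral_pushforward) (simp add: borel_measurable_indicator)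
    also have "\<dots> = emeasure (density cod.M (\<lambda>_. ennreal N)) X"
      using X by (simp add: emeasure_density_const)
    finally show "emeasure (distr (density dom.M (\<lambda>z. ennreal (j z))) cod.M T) X = emeasure (density cod.M (\<lambda>_. ennreal N)) X" .
  qed simp
  have "(LINT z|dom.M. of_real (j z) * F (T z)) = (LINT z|dom.M. j z *\<^sub>R F (T z))"
    by (simp add: scaleR_conv_of_real)
  also have "\<dots> = (LINT z|density dom.M (\<lambda>z. ennreal (j z)). F (T z))"
    using j_M measurable_compose[OF T_M F_M] by (subst integral_density) (auto simp: j_nonneg)
  also have "\<dots> = (LINT u|distr (density dom.M (\<lambda>z. ennreal (j z))) cod.M T. F u)"
    by (rule integral_distr[OF T_M' F_M, symmetric])
  also have "\<dots> = (LINT u|cod.M. N *\<^sub>R F u)"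
    unfolding eq using F_M N_nonneg by (subst integral_density) auto
  also have "\<dots> = of_real N * (LINT u|cod.M. F u)"
    by (simp add: scaleR_conv_of_real)
  finally show ?thesis .
qed

end

section \<open>Lifting functions from the quotient domain\<close>

locale quotient_domain = basic_map G \<theta>
  for G :: "(complex^'d^'d) set" and \<theta> :: "complex^'d \<Rightarrow> complex^'d" +
  fixes V :: "(complex^'d) measure" and \<Omega> :: "(complex^'d) set" and \<omega>' :: "complex^'d \<Rightarrow> real" and c :: real
  assumes open_\<Omega>: "open \<Omega>" and \<Omega>_invariant: "A \<in> G \<Longrightarrow> z \<in> \<Omega> \<Longrightarrow> A *v z \<in> \<Omega>"
    and weight_cont: "continuous_on (\<theta> ` \<Omega>) \<omega>'" and weight_pos: "u \<in> \<theta> ` \<Omega> \<Longrightarrow> 0 < \<omega>' u"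
    and measure_eq: "V = density lebesgue (\<lambda>_. ennreal c)" and c_gt_0: "0 < c"

sublocale quotient_domain \<subseteq> dom: weighted_domain V \<Omega> "\<omega>' \<circ> \<theta>" c
proof
  show "continuous_on \<Omega> (\<omega>' \<circ> \<theta>)"
    by (rule continuous_on_compose[OF theta_continuous_on weight_cont])
qed (use open_\<Omega> weight_pos measure_eq c_gt_0 in auto)

sublocale quotient_domain \<subseteq> cod: weighted_domain V "\<theta> ` \<Omega>" \<omega>' c
proof
  show "open (\<theta> ` \<Omega>)" by (rule open_theta_image[OF open_\<Omega> \<Omega>_invariant])
qed (use weight_cont weight_pos measure_eq c_gt_0 in auto)

context quotient_domain
begin

definition lift :: "(complex^'d \<Rightarrow> complex) \<Rightarrow> complex^'d \<Rightarrow> complex" where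
  "lift \<psi> z = complex_jacobian \<theta> z * \<psi> (\<theta> z)"

text \<open>The elements of \<open>G\<close> preserve volume because their determinants have modulus one.\<close>

lemma group_pushforward:
  assumes A: "A \<in> G"
  shows "weighted_pushforward V \<Omega> (\<omega>' \<circ> \<theta>) c \<Omega> (\<omega>' \<circ> \<theta>) ((*v) A) (\<lambda>_. 1) \<Omega> 1"
proof
  obtain C where C: "C \<in> G" "A ** C = mat 1" "C ** A = mat 1" using inverse_mem[OF A] by blast
  show "continuous_on UNIV ((*v) A)" by (rule linear_continuous_on[OF bounded_linear_matrix])
  show "A *v z \<in> \<Omega>" if "z \<in> \<Omega>" for z by (rule \<Omega>_invariant[OF A that])
  show "(\<omega>' \<circ> \<theta>) z = (\<omega>' \<circ> \<theta>) (A *v z)" for z by (simp add: theta_invariant[OF A])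
  show "\<Omega> \<in> sets borel" using open_\<Omega> by simp
  fix B :: "(complex^'d) set" assume B: "B \<in> sets borel" "B \<subseteq> \<Omega>"
  have A_meas: "(*v) A \<in> borel_measurable borel"
    by (intro borel_measurable_continuous_onI linear_continuous_on bounded_linear_matrix)
  let ?S = "\<Omega> \<inter> (*v) A -` B"
  have S: "?S \<in> sets borel" using measurable_sets[OF A_meas B(1)] open_\<Omega> by simp
  have "emeasure lebesgue ((*v) A ` ?S) = (\<integral>\<^sup>+x. ennreal ((cmod (det A))\<^sup>2) * indicator ?S x \<partial>lborel)"
  proof (rule emeasure_holomorphic_image[OF S])
    show "((*v) A has_derivative (*v) A) (at x)" for x
      by (rule bounded_linear_imp_has_derivative[OF bounded_linear_matrix])
    show "inj_on ((*v) A) ?S"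
    proof (rule inj_on_inverseI)
      show "C *v (A *v x) = x" for x by (simp add: matrix_vector_mul_assoc C)
    qed
    show "det A \<noteq> 0" using det_unimodular[OF A] by auto
  qed simp
  moreover have "(*v) A ` ?S = B"
  proof (intro equalityI subsetI)
    fix x assume x: "x \<in> B"
    have "x = A *v (C *v x)" by (simp add: matrix_vector_mul_assoc C)
    moreover have "C *v x \<in> ?S"
      using \<Omega>_invariant[OF C(1)] x B(2) by (auto simp: matrix_vector_mul_assoc C)
    ultimately show "x \<in> (*v) A ` ?S" by blast
  qed auto
  ultimately show "(\<integral>\<^sup>+z. ennreal 1 * indicator ?S z \<partial>lborel) = ennreal 1 * emeasure lborel B"
    using B(1) by (simp add: det_unimodular[OF A])
qed auto

text \<open>A polynomial whose zero set contains the branch values of \<open>\<theta>\<close>, the images of the points with nontrivial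
stabilizer, together with the measure-theoretic properties of \<open>\<theta>\<close> off this set. It need not be
the reduced equation of the branch locus.\<close>

definition branch_polynomial :: "(complex^'d \<Rightarrow> complex) \<Rightarrow> bool" where
  "branch_polynomial \<Delta> \<longleftrightarrow> \<Delta> \<in> polyfun \<and> (\<exists>u. \<Delta> u \<noteq> 0) \<and>
    (\<forall>z. \<forall>A\<in>G. \<Delta> (\<theta> z) \<noteq> 0 \<longrightarrow> A *v z = z \<longrightarrow> A = mat 1) \<and>
    weighted_pushforward V \<Omega> (\<omega>' \<circ> \<theta>) c (\<theta> ` \<Omega>) \<omega>' \<theta> (\<lambda>z. (cmod (complex_jacobian \<theta> z))\<^sup>2)
      {z \<in> \<Omega>. \<Delta> (\<theta> z) \<noteq> 0} (real (card G)) \<and> negligible {u. \<Delta> u = 0}"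

lemma ex_branch_polynomial: "\<exists>\<Delta>. branch_polynomial \<Delta>"
proof -
  obtain \<Delta> where \<Delta>: "\<Delta> \<in> polyfun" "\<exists>z. \<Delta> (\<theta> z) \<noteq> 0"
    and free: "\<forall>z. \<forall>A\<in>G. \<Delta> (\<theta> z) \<noteq> 0 \<longrightarrow> A *v z = z \<longrightarrow> A = mat 1"
    and negl: "negligible {z. \<Delta> (\<theta> z) = 0}"
    using ex_polynomial_detecting_stabilizers by blast
  let ?O = "{z \<in> \<Omega>. \<Delta> (\<theta> z) \<noteq> 0}"
  have \<Delta>_cont: "continuous_on S \<Delta>" for S
    by (rule holomorphic_several_continuous_on[OF holomorphic_several_polyfun[OF \<Delta>(1)]])
  have "continuous_on UNIV (\<lambda>z. \<Delta> (\<theta> z))"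
    using continuous_on_compose[OF theta_continuous_on \<Delta>_cont] by (simp add: o_def)
  then have "open {z. \<Delta> (\<theta> z) \<noteq> 0}" by (intro open_Collect_neq continuous_on_const)
  then have openO: "open ?O" using open_\<Omega> by (simp add: open_Int Collect_conj_eq)
  have negl': "negligible {u. \<Delta> u = 0}"
  proof -
    have "\<theta> differentiable_on {z. \<Delta> (\<theta> z) = 0}"
      using theta_has_derivative unfolding differentiable_on_def differentiable_def
      by (meson has_derivative_at_withinI)
    then have "negligible (\<theta> ` {z. \<Delta> (\<theta> z) = 0})"
      by (rule negligible_differentiable_image_negligible[OF order_refl negl])
    then show ?thesis
    proof (rule negligible_subset, intro subsetI)
      fix u assume "u \<in> {u. \<Delta> u = 0}"
      moreover obtain z where "\<theta> z = u" using theta_surj by blast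
      ultimately show "u \<in> \<theta> ` {z. \<Delta> (\<theta> z) = 0}" by blast
    qed
  qed
  have "weighted_pushforward V \<Omega> (\<omega>' \<circ> \<theta>) c (\<theta> ` \<Omega>) \<omega>' \<theta> (\<lambda>z. (cmod (complex_jacobian \<theta> z))\<^sup>2)
      ?O (real (card G))"
  proof
    show "continuous_on UNIV \<theta>" by (rule theta_continuous_on)
    show "(\<lambda>z. (cmod (complex_jacobian \<theta> z))\<^sup>2) \<in> borel_measurable borel"
      using jacobian_measurable by measurable
    show "?O \<in> sets borel" using openO by simp
    show "negligible (\<Omega> - ?O)" by (rule negligible_subset[OF negl]) auto
    show "0 < (cmod (complex_jacobian \<theta> z))\<^sup>2" if "z \<in> ?O" for z
    proof -
      have "complex_jacobian \<theta> z \<noteq> 0" using free that by (intro complex_jacobian_nonzero) blast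
      then show ?thesis by simp
    qed
    fix B :: "(complex^'d) set" assume B: "B \<in> sets borel" "B \<subseteq> \<theta> ` \<Omega>"
    let ?B = "B \<inter> {u. \<Delta> u \<noteq> 0}"
    have \<Delta>_sets: "{u. \<Delta> u \<noteq> 0} \<in> sets borel"
      by (intro borel_open open_Collect_neq \<Delta>_cont continuous_on_const)
    have B': "?B \<in> sets borel" using B(1) \<Delta>_sets by simp
    have "(\<integral>\<^sup>+z. ennreal ((cmod (complex_jacobian \<theta> z))\<^sup>2) * indicator (?O \<inter> \<theta> -` B) z \<partial>lborel)
      = (\<integral>\<^sup>+z. ennreal ((cmod (complex_jacobian \<theta> z))\<^sup>2) * indicator (?O \<inter> \<theta> -` ?B) z \<partial>lborel)"
      by (intro nn_integral_cong) (auto simp: indicator_def)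
    also have "\<dots> = of_nat (card G) * emeasure lborel ?B"
    proof (rule theta_pushforward[OF openO _ _ B'])
      show "A *v z \<in> ?O" if "A \<in> G" "z \<in> ?O" for A z
        using that \<Omega>_invariant by (simp add: theta_invariant)
      show "A = mat 1" if "z \<in> ?O" "A \<in> G" "A *v z = z" for z A
        using free that by blast
      show "?B \<subseteq> \<theta> ` ?O" using B(2) by auto
    qed
    also have "emeasure lborel ?B = emeasure lborel B"
    proof -
      have "{u. \<Delta> u = 0} \<in> sets borel"
        using \<Delta>_sets borel_closed[of "{u. \<Delta> u = 0}"] closed_Collect_eq[OF \<Delta>_cont continuous_on_const] by blast
      then have "{u. \<Delta> u = 0} \<in> null_sets lborel"
        using negl' by (simp add: negligible_iff_null_sets null_sets_completion_iff)
      moreover have "?B = B - {u. \<Delta> u = 0}" by auto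
      ultimately show ?thesis using B(1) by (simp add: emeasure_Diff_null_set)
    qed
    finally show "(\<integral>\<^sup>+z. ennreal ((cmod (complex_jacobian \<theta> z))\<^sup>2) * indicator (?O \<inter> \<theta> -` B) z \<partial>lborel)
      = ennreal (real (card G)) * emeasure lborel B"
      by (simp add: ennreal_of_nat_eq_real_of_nat)
  qed auto
  then show ?thesis using \<Delta> free negl' unfolding branch_polynomial_def by (intro exI[of _ \<Delta>]) auto
qed

lemma jacobian_measurable_M: "complex_jacobian \<theta> \<in> borel_measurable dom.M"
  unfolding measurable_cong_sets[OF dom.sets_M refl]
  using jacobian_measurable by (intro measurable_restrict_space1) (simp add: measurable_completion)

text \<open>By the change of variables the square of the norm of \<open>lift \<psi>\<close> is \<open>card G\<close> times that of \<open>\<psi>\<close>.\<close>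

lemma lift_l2:
  assumes \<psi>: "\<psi> \<in> l2 cod.M"
  shows "lift \<psi> \<in> l2 dom.M"
proof -
  obtain \<Delta> where "branch_polynomial \<Delta>" using ex_branch_polynomial by blast
  then interpret pf: weighted_pushforward V \<Omega> "\<omega>' \<circ> \<theta>" c "\<theta> ` \<Omega>" \<omega>' \<theta> "\<lambda>z. (cmod (complex_jacobian \<theta> z))\<^sup>2"
    "{z \<in> \<Omega>. \<Delta> (\<theta> z) \<noteq> 0}" "real (card G)" by (simp add: branch_polynomial_def)
  have \<psi>_meas: "\<psi> \<in> borel_measurable (lebesgue_on (\<theta> ` \<Omega>))"
    using l2_measurable[OF \<psi>] unfolding measurable_cong_sets[OF cod.sets_M refl] .
  have "(\<lambda>z. \<psi> (\<theta> z)) \<in> borel_measurable dom.M"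
    unfolding measurable_cong_sets[OF dom.sets_M refl]
    by (rule measurable_compose[OF pf.T_measurable \<psi>_meas])
  then have meas: "lift \<psi> \<in> borel_measurable dom.M"
    unfolding lift_def[abs_def] using jacobian_measurable_M by measurable
  have "(\<integral>\<^sup>+z. ennreal ((cmod (lift \<psi> z))\<^sup>2) \<partial>dom.M)
    = (\<integral>\<^sup>+z. ennreal ((cmod (complex_jacobian \<theta> z))\<^sup>2) * ennreal ((cmod (\<psi> (\<theta> z)))\<^sup>2) \<partial>dom.M)"
    by (simp add: lift_def norm_mult power_mult_distrib ennreal_mult)
  also have "\<dots> = ennreal (real (card G)) * (\<integral>\<^sup>+u. ennreal ((cmod (\<psi> u))\<^sup>2) \<partial>cod.M)"
    using \<psi>_meas by (intro pf.nn_integral_pushforward) measurable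
  also have "\<dots> < \<infinity>"
    by (simp add: sqnorm_eq_nn_integral[OF \<psi>] ennreal_mult_less_top)
  finally have "integrable dom.M (\<lambda>z. (cmod (lift \<psi> z))\<^sup>2)"
    using meas by (intro integrableI_nonneg) auto
  then show ?thesis using meas by (simp add: l2_def)
qed

lemma lift_bergman:
  assumes k: "k \<in> cod.H"
  shows "lift k \<in> dom.H"
proof (rule dom.bergmanI)
  show "lift k \<in> l2 dom.M" by (rule lift_l2[OF cod.bergman_l2[OF k]])
  have "holomorphic_several (\<lambda>z. k (\<theta> z)) \<Omega>"
    using cod.bergman_holomorphic[OF k]
    by (rule holomorphic_several_compose[where g' = "\<lambda>z. (*v) (jacobian_matrix \<theta> z)"])
      (auto intro: theta_has_derivative simp: matrix_vector_smult)
  then show "holomorphic_several (lift k) \<Omega>"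
    unfolding lift_def[abs_def]
    by (rule holomorphic_several_mult[OF holomorphic_several_polyfun[OF complex_jacobian_polyfun]])
qed

lemma group_measurable:
  assumes "A \<in> G"
  shows "(*v) A \<in> measurable dom.M dom.M"
proof -
  interpret pf: weighted_pushforward V \<Omega> "\<omega>' \<circ> \<theta>" c \<Omega> "\<omega>' \<circ> \<theta>" "(*v) A" "\<lambda>_. 1" \<Omega> 1
    by (rule group_pushforward[OF assms])
  show ?thesis
    unfolding measurable_cong_sets[OF dom.sets_M dom.sets_M] by (rule pf.T_measurable)
qed

lemma integral_group_invariant:
  fixes F :: "complex^'d \<Rightarrow> complex"
  assumes F: "F \<in> borel_measurable dom.M" and A: "A \<in> G"
  shows "(LINT z|dom.M. F (A *v z)) = (LINT z|dom.M. F z)"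
proof -
  interpret pf: weighted_pushforward V \<Omega> "\<omega>' \<circ> \<theta>" c \<Omega> "\<omega>' \<circ> \<theta>" "(*v) A" "\<lambda>_. 1" \<Omega> 1
    by (rule group_pushforward[OF A])
  have "F \<in> borel_measurable (lebesgue_on \<Omega>)"
    using F unfolding measurable_cong_sets[OF dom.sets_M refl] .
  from pf.integral_pushforward[OF this] show ?thesis by simp
qed

lemma nn_integral_group_invariant:
  fixes F :: "complex^'d \<Rightarrow> ennreal"
  assumes F: "F \<in> borel_measurable dom.M" and A: "A \<in> G"
  shows "(\<integral>\<^sup>+z. F (A *v z) \<partial>dom.M) = (\<integral>\<^sup>+z. F z \<partial>dom.M)"
proof -
  interpret pf: weighted_pushforward V \<Omega> "\<omega>' \<circ> \<theta>" c \<Omega> "\<omega>' \<circ> \<theta>" "(*v) A" "\<lambda>_. 1" \<Omega> 1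
    by (rule group_pushforward[OF A])
  have "F \<in> borel_measurable (lebesgue_on \<Omega>)"
    using F unfolding measurable_cong_sets[OF dom.sets_M refl] .
  from pf.nn_integral_pushforward[OF this] show ?thesis by simp
qed

end

context quotient_domain
begin

text \<open>Up to the factor \<open>card G\<close> the adjoint of \<open>lift\<close> maps the Bergman space of \<open>\<Omega>\<close> into that of \<open>\<theta>(\<Omega>)\<close>.
It takes \<open>f\<close> to the mean of \<open>f / J\<close> over the orbits. Since \<open>|J|\<close> is constant on
orbits, the integral of \<open>f cnj (lift \<psi>)\<close> equals that of \<open>|J|\<^sup>2 (h \<circ> \<theta>) cnj (\<psi> \<circ> \<theta>)\<close> after averaging
over \<open>G\<close>, and the change of variables moves it to \<open>\<theta>(\<Omega>)\<close>. Square integrability of \<open>h\<close> follows from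
the same formula and the Cauchy-Schwarz inequality for sums; it allows to extend \<open>h\<close> across the zero
set of \<open>\<Delta>\<close>.\<close>

lemma ex_bergman_adjoint_of_lift:
  assumes f: "f \<in> dom.H"
  shows "\<exists>g\<in>cod.H. \<forall>\<psi>\<in>l2 cod.M. ip dom.M f (lift \<psi>) = of_nat (card G) * ip cod.M g \<psi>"
proof -
  let ?J = "complex_jacobian \<theta>" and ?n = "card G"
  have n: "?n > 0" using finite_G one_mem card_gt_0_iff by blast
  obtain \<Delta> where disc: "branch_polynomial \<Delta>" using ex_branch_polynomial by blast
  then have \<Delta>: "\<Delta> \<in> polyfun" "\<exists>u. \<Delta> u \<noteq> 0"
    and free: "\<forall>z. \<forall>A\<in>G. \<Delta> (\<theta> z) \<noteq> 0 \<longrightarrow> A *v z = z \<longrightarrow> A = mat 1"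
    and negl: "negligible {u. \<Delta> u = 0}"
    by (simp_all add: branch_polynomial_def)
  interpret pf: weighted_pushforward V \<Omega> "\<omega>' \<circ> \<theta>" c "\<theta> ` \<Omega>" \<omega>' \<theta> "\<lambda>z. (cmod (complex_jacobian \<theta> z))\<^sup>2"
    "{z \<in> \<Omega>. \<Delta> (\<theta> z) \<noteq> 0}" "real (card G)" using disc by (simp add: branch_polynomial_def)
  let ?O = "{z \<in> \<Omega>. \<Delta> (\<theta> z) \<noteq> 0}" and ?W = "\<theta> ` \<Omega>"
  let ?W' = "?W \<inter> {u. \<Delta> u \<noteq> 0}"
  have \<Delta>_cont: "continuous_on S \<Delta>" for S
    by (rule holomorphic_several_continuous_on[OF holomorphic_several_polyfun[OF \<Delta>(1)]])
  have openO: "open ?O"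
  proof -
    have "continuous_on UNIV (\<lambda>z. \<Delta> (\<theta> z))"
      using continuous_on_compose[OF theta_continuous_on \<Delta>_cont] by (simp add: o_def)
    then have "open {z. \<Delta> (\<theta> z) \<noteq> 0}" by (intro open_Collect_neq continuous_on_const)
    then show ?thesis using open_\<Omega> by (simp add: open_Int Collect_conj_eq)
  qed
  have openW': "open ?W'"
    by (intro open_Int cod.open_D open_Collect_neq \<Delta>_cont continuous_on_const)
  have AO: "A *v z \<in> ?O" if "A \<in> G" "z \<in> ?O" for A z
    using that \<Omega>_invariant by (simp add: theta_invariant)
  have J_nz: "?J z \<noteq> 0" if "z \<in> ?O" for z
    using free that by (intro complex_jacobian_nonzero) blast
  have f_hol: "holomorphic_several f \<Omega>" by (rule dom.bergman_holomorphic[OF f])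
  \<comment> \<open>The pullback of \<open>h\<close> to \<open>\<Omega>\<close>; it is constant on orbits and holomorphic off the zeros of \<open>\<Delta> \<circ> \<theta>\<close>.\<close>
  define hh where "hh z = (1 / of_nat ?n) * (\<Sum>A\<in>G. f (A *v z) / ?J (A *v z))" for z
  have hh_inv: "hh (B *v z) = hh z" if "B \<in> G" for B z
    unfolding hh_def using sum_orbit[OF that, of "\<lambda>z. f z / ?J z"] by simp
  have hh_hol: "holomorphic_several hh ?O"
  proof -
    have "holomorphic_several (\<lambda>z. f z / ?J z) ?O"
      by (rule holomorphic_several_divide[OF holomorphic_several_subset[OF f_hol]
            holomorphic_several_polyfun[OF complex_jacobian_polyfun] J_nz]) auto
    then have "holomorphic_several (\<lambda>z. f (A *v z) / ?J (A *v z)) ?O" if "A \<in> G" for A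
      by (rule holomorphic_several_compose[where g = "(*v) A" and g' = "\<lambda>_. (*v) A"])
        (use AO[OF that] in \<open>auto simp: matrix_vector_smult intro: bounded_linear_imp_has_derivative bounded_linear_matrix\<close>)
    then show ?thesis
      unfolding hh_def[abs_def] by (intro holomorphic_several_cmult holomorphic_several_sum)
  qed
  define h where "h u = hh (SOME z. z \<in> ?O \<and> \<theta> z = u)" for u
  have h_theta: "h (\<theta> z) = hh z" if z: "z \<in> ?O" for z
  proof -
    let ?w = "SOME w. w \<in> ?O \<and> \<theta> w = \<theta> z"
    have "?w \<in> ?O \<and> \<theta> ?w = \<theta> z" by (rule someI[of _ z]) (use z in simp)
    then obtain A where "A \<in> G" "?w = A *v z" using theta_eq_iff[of z ?w] by auto
    then show ?thesis unfolding h_def using hh_inv by simp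
  qed
  have h_hol: "holomorphic_several h ?W'"
    unfolding holomorphic_several_def
  proof
    fix u assume "u \<in> ?W'"
    then obtain z where z: "z \<in> ?O" "u = \<theta> z" by auto
    from theta_local_inverse[OF J_nz[OF z(1)] openO z(1)]
    obtain U V' g g' where UV: "open U" "U \<subseteq> ?O" "z \<in> U" "open V'" "homeomorphism U V' \<theta> g"
      and g': "\<forall>y\<in>V'. (g has_derivative g' y) (at y) \<and> (\<forall>c v. g' y (c *s v) = c *s g' y v)"
      by blast
    have gV: "g ` V' = U" and tg: "\<And>y. y \<in> V' \<Longrightarrow> \<theta> (g y) = y" and uV: "u \<in> V'"
      using UV(3,5) z(2) by (auto simp: homeomorphism_def)
    have "holomorphic_several (\<lambda>y. hh (g y)) V'"
      by (rule holomorphic_several_compose[OF hh_hol, where g' = g'])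
        (use g' gV UV(2) in auto)
    moreover have "hh (g y) = h y" if y: "y \<in> V'" for y
      using h_theta[of "g y"] tg[OF y] gV UV(2) y by auto
    ultimately have "holomorphic_several h V'"
      using holomorphic_several_cong[OF UV(4), of "\<lambda>y. hh (g y)" h] by simp
    then show "\<exists>f'. (h has_derivative f') (at u) \<and> (\<forall>c v. f' (c *s v) = c * f' v)"
      using uV unfolding holomorphic_several_def by blast
  qed
  \<comment> \<open>Outside the set where \<open>h\<close> is defined by a fibre its values are arbitrary, so they are replaced by \<open>0\<close> to obtain a measurable function.\<close>
  define h0 where "h0 u = (if u \<in> ?W' then h u else 0)" for u
  have h0_meas: "h0 \<in> borel_measurable (lebesgue_on ?W)"
  proof -
    have "(\<lambda>u. indicator ?W' u *\<^sub>R h u) \<in> borel_measurable borel"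
      using borel_measurable_continuous_on_indicator[of ?W' h] openW' holomorphic_several_continuous_on[OF h_hol]
      by simp
    moreover have "(\<lambda>u. indicator ?W' u *\<^sub>R h u) = h0" by (auto simp: h0_def indicator_def)
    ultimately have "h0 \<in> borel_measurable borel" by (simp only:)
    then show ?thesis by (intro measurable_restrict_space1) (simp add: measurable_completion)
  qed
  have f_meas: "f \<in> borel_measurable dom.M" by (rule l2_measurable[OF dom.bergman_l2[OF f]])
  have pointwise: "(cmod (?J z))\<^sup>2 * (cmod (h0 (\<theta> z)))\<^sup>2 \<le> (1 / real ?n) * (\<Sum>A\<in>G. (cmod (f (A *v z)))\<^sup>2)"
    if z: "z \<in> \<Omega>" for z
  proof (cases "\<Delta> (\<theta> z) = 0")
    case True
    then show ?thesis by (simp add: h0_def sum_nonneg)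
  next
    case False
    then have zO: "z \<in> ?O" using z by simp
    have h0z: "h0 (\<theta> z) = hh z" using zO h_theta[OF zO] by (auto simp: h0_def)
    have "cmod (?J z) * cmod (hh z) = (1 / real ?n) * cmod (\<Sum>A\<in>G. ?J z * (f (A *v z) / ?J (A *v z)))"
    proof -
      have "?J z * hh z = (1 / of_nat ?n) * (\<Sum>A\<in>G. ?J z * (f (A *v z) / ?J (A *v z)))"
        unfolding hh_def sum_distrib_left[symmetric] by (rule mult.left_commute)
      then have "cmod (?J z * hh z) = cmod ((1 / of_nat ?n) * (\<Sum>A\<in>G. ?J z * (f (A *v z) / ?J (A *v z))))"
        by (rule arg_cong)
      then show ?thesis by (simp only: norm_mult norm_divide norm_one norm_of_nat)
    qed
    also have "\<dots> \<le> (1 / real ?n) * (\<Sum>A\<in>G. cmod (f (A *v z)))"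
    proof (intro mult_left_mono sum_norm_le)
      fix A assume A: "A \<in> G"
      have "?J z \<noteq> 0" by (rule J_nz[OF zO])
      then show "cmod (?J z * (f (A *v z) / ?J (A *v z))) \<le> cmod (f (A *v z))"
        by (simp add: norm_mult norm_divide norm_jacobian_invariant[OF A])
    qed simp
    finally have "cmod (?J z) * cmod (hh z) \<le> (1 / real ?n) * (\<Sum>A\<in>G. cmod (f (A *v z)))" .
    then have "(cmod (?J z) * cmod (hh z))\<^sup>2 \<le> ((1 / real ?n) * (\<Sum>A\<in>G. cmod (f (A *v z))))\<^sup>2"
      by (rule power_mono) simp
    also have "\<dots> = (1 / real ?n)\<^sup>2 * (\<Sum>A\<in>G. cmod (f (A *v z)))\<^sup>2" by (rule power_mult_distrib)
    also have "\<dots> \<le> (1 / real ?n)\<^sup>2 * ((\<Sum>A\<in>G. (cmod (f (A *v z)))\<^sup>2) * real ?n)"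
      using sum_squared_le_sum_of_squares[of "\<lambda>A. cmod (f (A *v z))" G] by (intro mult_left_mono) auto
    also have "\<dots> = (1 / real ?n) * (\<Sum>A\<in>G. (cmod (f (A *v z)))\<^sup>2)"
      using n by (simp add: power2_eq_square)
    finally show ?thesis by (simp add: h0z power_mult_distrib)
  qed
  have h0_fin: "(\<integral>\<^sup>+u. ennreal ((cmod (h0 u))\<^sup>2) \<partial>cod.M) < \<infinity>"
  proof -
    have k_meas: "(\<lambda>u. ennreal ((cmod (h0 u))\<^sup>2)) \<in> borel_measurable (lebesgue_on ?W)"
      using h0_meas by measurable
    have "ennreal (real ?n) * (\<integral>\<^sup>+u. ennreal ((cmod (h0 u))\<^sup>2) \<partial>cod.M)
      = (\<integral>\<^sup>+z. ennreal ((cmod (?J z))\<^sup>2) * ennreal ((cmod (h0 (\<theta> z)))\<^sup>2) \<partial>dom.M)"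
      by (rule pf.nn_integral_pushforward[OF k_meas, symmetric])
    also have "\<dots> \<le> (\<integral>\<^sup>+z. ennreal (1 / real ?n) * (\<Sum>A\<in>G. ennreal ((cmod (f (A *v z)))\<^sup>2)) \<partial>dom.M)"
    proof (rule nn_integral_mono)
      fix z assume "z \<in> space dom.M"
      then have "z \<in> \<Omega>" by simp
      from ennreal_leI[OF pointwise[OF this]]
      show "ennreal ((cmod (?J z))\<^sup>2) * ennreal ((cmod (h0 (\<theta> z)))\<^sup>2)
        \<le> ennreal (1 / real ?n) * (\<Sum>A\<in>G. ennreal ((cmod (f (A *v z)))\<^sup>2))"
        by (simp add: ennreal_mult sum_nonneg del: times_divide_eq_left mult_1_left)
    qed
    also have "\<dots> = ennreal (1 / real ?n) * (\<Sum>A\<in>G. \<integral>\<^sup>+z. ennreal ((cmod (f (A *v z)))\<^sup>2) \<partial>dom.M)"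
    proof -
      have m: "(\<lambda>z. ennreal ((cmod (f (A *v z)))\<^sup>2)) \<in> borel_measurable dom.M" if A: "A \<in> G" for A
        using measurable_compose[OF group_measurable[OF A] f_meas] by measurable
      have "(\<integral>\<^sup>+z. ennreal (1 / real ?n) * (\<Sum>A\<in>G. ennreal ((cmod (f (A *v z)))\<^sup>2)) \<partial>dom.M)
        = ennreal (1 / real ?n) * (\<integral>\<^sup>+z. (\<Sum>A\<in>G. ennreal ((cmod (f (A *v z)))\<^sup>2)) \<partial>dom.M)"
        by (rule nn_integral_cmult) (rule borel_measurable_sum[OF m])
      also have "(\<integral>\<^sup>+z. (\<Sum>A\<in>G. ennreal ((cmod (f (A *v z)))\<^sup>2)) \<partial>dom.M)
        = (\<Sum>A\<in>G. \<integral>\<^sup>+z. ennreal ((cmod (f (A *v z)))\<^sup>2) \<partial>dom.M)"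
        by (rule nn_integral_sum[OF m])
      finally show ?thesis .
    qed
    also have "(\<Sum>A\<in>G. \<integral>\<^sup>+z. ennreal ((cmod (f (A *v z)))\<^sup>2) \<partial>dom.M)
      = (\<Sum>A\<in>G. \<integral>\<^sup>+z. ennreal ((cmod (f z))\<^sup>2) \<partial>dom.M)"
      using f_meas by (intro sum.cong refl nn_integral_group_invariant) measurable
    also have "ennreal (1 / real ?n) * \<dots> < \<infinity>"
      by (simp add: sqnorm_eq_nn_integral[OF dom.bergman_l2[OF f]] ennreal_mult_less_top ennreal_of_nat_eq_real_of_nat)
    finally show ?thesis using n by (auto simp: ennreal_mult_less_top)
  qed
  obtain b where b: "\<Delta> b \<noteq> 0" using \<Delta>(2) by blast
  have "\<exists>g. holomorphic_several g ?W \<and> (\<forall>u\<in>?W. \<Delta> u \<noteq> 0 \<longrightarrow> g u = h u)"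
  proof (rule L2_extension[OF \<Delta>(1) b cod.open_D h_hol])
    fix u assume u: "u \<in> ?W"
    have "(\<lambda>u. ennreal ((cmod (h0 u))\<^sup>2)) \<in> borel_measurable (lebesgue_on ?W)"
      using h0_meas by measurable
    from cod.nn_integral_locally_finite[OF this h0_fin u]
    obtain \<rho> where \<rho>: "\<rho> > 0" "ball u \<rho> \<subseteq> ?W"
      "(\<integral>\<^sup>+x. ennreal ((cmod (h0 x))\<^sup>2) * indicator (ball u \<rho>) x \<partial>lborel) < \<infinity>" by blast
    have "(\<integral>\<^sup>+x. ennreal ((cmod (h x))\<^sup>2) * indicator (ball u \<rho> \<inter> {u. \<Delta> u \<noteq> 0}) x \<partial>lborel)
      \<le> (\<integral>\<^sup>+x. ennreal ((cmod (h0 x))\<^sup>2) * indicator (ball u \<rho>) x \<partial>lborel)"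
      by (rule nn_integral_mono) (use \<rho>(2) in \<open>auto simp: h0_def indicator_def\<close>)
    then show "\<exists>\<rho>>0. ball u \<rho> \<subseteq> ?W \<and>
      (\<integral>\<^sup>+x. ennreal ((cmod (h x))\<^sup>2) * indicator (ball u \<rho> \<inter> {u. \<Delta> u \<noteq> 0}) x \<partial>lborel) < \<infinity>"
      using \<rho> by (intro exI[of _ \<rho>]) (auto intro: le_less_trans)
  qed
  then obtain g where g: "holomorphic_several g ?W" "\<forall>u\<in>?W. \<Delta> u \<noteq> 0 \<longrightarrow> g u = h u" by blast
  have g_meas: "g \<in> borel_measurable cod.M"
    unfolding measurable_cong_sets[OF cod.sets_M refl] by (rule cod.holomorphic_measurable[OF g(1)])
  have "g \<in> l2 cod.M"
  proof -
    have "(\<integral>\<^sup>+u. ennreal ((cmod (g u))\<^sup>2) \<partial>cod.M) = (\<integral>\<^sup>+u. ennreal ((cmod (h0 u))\<^sup>2) \<partial>cod.M)"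
    proof (rule nn_integral_cong_AE)
      have "AE u in cod.M. u \<in> ?W" using AE_space[of cod.M] by simp
      with cod.AE_not_in_negligible[OF negl]
      show "AE u in cod.M. ennreal ((cmod (g u))\<^sup>2) = ennreal ((cmod (h0 u))\<^sup>2)"
        by eventually_elim (use g(2) in \<open>auto simp: h0_def\<close>)
    qed
    then have "integrable cod.M (\<lambda>u. (cmod (g u))\<^sup>2)"
      using h0_fin g_meas by (intro integrableI_nonneg) auto
    then show ?thesis using g_meas by (simp add: l2_def)
  qed
  then have gH: "g \<in> cod.H" using g(1) by (rule cod.bergmanI)
  have "ip dom.M f (lift \<psi>) = of_nat ?n * ip cod.M g \<psi>" if \<psi>: "\<psi> \<in> l2 cod.M" for \<psi>
  proof -
    define F where "F z = f z * cnj (lift \<psi> z)" for z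
    have F_int: "integrable dom.M F"
      unfolding F_def by (rule l2_integrable_mult[OF dom.bergman_l2[OF f] lift_l2[OF \<psi>]])
    have F_meas: "F \<in> borel_measurable dom.M" using F_int by (rule borel_measurable_integrable)
    have FA_int: "integrable dom.M (\<lambda>z. F (A *v z))" if A: "A \<in> G" for A
    proof (rule integrableI_bounded)
      show "(\<lambda>z. F (A *v z)) \<in> borel_measurable dom.M"
        by (rule measurable_compose[OF group_measurable[OF A] F_meas])
      have "(\<integral>\<^sup>+z. ennreal (norm (F (A *v z))) \<partial>dom.M) = (\<integral>\<^sup>+z. ennreal (norm (F z)) \<partial>dom.M)"
        using F_meas by (intro nn_integral_group_invariant[OF _ A, where F = "\<lambda>z. ennreal (norm (F z))"]) measurable
      then show "(\<integral>\<^sup>+z. ennreal (norm (F (A *v z))) \<partial>dom.M) < \<infinity>"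
        using F_int by (simp add: integrable_iff_bounded)
    qed
    have "of_nat ?n * ip dom.M f (lift \<psi>) = (\<Sum>A\<in>G. LINT z|dom.M. F z)"
      by (simp add: ip_def F_def)
    also have "\<dots> = (\<Sum>A\<in>G. LINT z|dom.M. F (A *v z))"
      by (intro sum.cong refl integral_group_invariant[symmetric] F_meas)
    also have "\<dots> = (LINT z|dom.M. (\<Sum>A\<in>G. F (A *v z)))"
      by (rule Bochner_Integration.integral_sum[symmetric]) (rule FA_int)
    also have "\<dots> = (LINT z|dom.M. of_nat ?n * (of_real ((cmod (?J z))\<^sup>2) * (g (\<theta> z) * cnj (\<psi> (\<theta> z)))))"
    proof (rule integral_cong_AE)
      show "(\<lambda>z. \<Sum>A\<in>G. F (A *v z)) \<in> borel_measurable dom.M"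
        using FA_int by (intro borel_measurable_sum borel_measurable_integrable)
      have t: "\<theta> \<in> measurable dom.M cod.M"
        unfolding measurable_cong_sets[OF dom.sets_M cod.sets_M] by (rule pf.T_measurable)
      have "(\<lambda>z. g (\<theta> z)) \<in> borel_measurable dom.M" "(\<lambda>z. \<psi> (\<theta> z)) \<in> borel_measurable dom.M"
        using measurable_compose[OF t g_meas] measurable_compose[OF t l2_measurable[OF \<psi>]] by auto
      then show "(\<lambda>z. of_nat ?n * (of_real ((cmod (?J z))\<^sup>2) * (g (\<theta> z) * cnj (\<psi> (\<theta> z))))) \<in> borel_measurable dom.M"
        using jacobian_measurable_M by measurable
      have "AE z in dom.M. z \<in> \<Omega>" using AE_space[of dom.M] by simp
      with dom.AE_not_in_negligible[OF pf.D0(3)]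
      show "AE z in dom.M. (\<Sum>A\<in>G. F (A *v z)) = of_nat ?n * (of_real ((cmod (?J z))\<^sup>2) * (g (\<theta> z) * cnj (\<psi> (\<theta> z))))"
      proof eventually_elim
        case (elim z)
        then have zO: "z \<in> ?O" by blast
        have gz: "g (\<theta> z) = hh z" using g(2) zO h_theta[OF zO] by simp
        have "F (A *v z) = of_real ((cmod (?J z))\<^sup>2) * cnj (\<psi> (\<theta> z)) * (f (A *v z) / ?J (A *v z))" if A: "A \<in> G" for A
        proof -
          have "?J (A *v z) \<noteq> 0" using J_nz[OF AO[OF A zO]] .
          moreover have "of_real ((cmod (?J z))\<^sup>2) = ?J (A *v z) * cnj (?J (A *v z))"
            using complex_norm_square[of "?J (A *v z)"] norm_jacobian_invariant[OF A, of z] by simp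
          ultimately show ?thesis
            by (simp add: F_def lift_def theta_invariant[OF A])
        qed
        then have "(\<Sum>A\<in>G. F (A *v z)) = of_real ((cmod (?J z))\<^sup>2) * cnj (\<psi> (\<theta> z)) * (\<Sum>A\<in>G. f (A *v z) / ?J (A *v z))"
          by (simp add: sum_distrib_left)
        also have "(\<Sum>A\<in>G. f (A *v z) / ?J (A *v z)) = of_nat ?n * g (\<theta> z)"
          using n by (simp add: gz hh_def)
        finally show ?case by (simp add: mult_ac)
      qed
    qed
    also have "\<dots> = of_nat ?n * (LINT z|dom.M. of_real ((cmod (?J z))\<^sup>2) * (g (\<theta> z) * cnj (\<psi> (\<theta> z))))"
      by (rule integral_mult_right_zero)
    also have "(LINT z|dom.M. of_real ((cmod (?J z))\<^sup>2) * (g (\<theta> z) * cnj (\<psi> (\<theta> z))))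
      = of_real (real ?n) * (LINT u|cod.M. g u * cnj (\<psi> u))"
    proof (rule pf.integral_pushforward)
      have "(\<lambda>u. g u * cnj (\<psi> u)) \<in> borel_measurable cod.M"
        using g_meas l2_measurable[OF \<psi>] by measurable
      then show "(\<lambda>u. g u * cnj (\<psi> u)) \<in> borel_measurable (lebesgue_on ?W)"
        unfolding measurable_cong_sets[OF cod.sets_M refl] .
    qed
    also have "of_real (real ?n) * (LINT u|cod.M. g u * cnj (\<psi> u)) = of_nat ?n * ip cod.M g \<psi>"
      by (simp add: ip_def)
    finally have "of_nat ?n * ip dom.M f (lift \<psi>) = of_nat ?n * (of_nat ?n * ip cod.M g \<psi>)" .
    then show ?thesis using n by simp
  qed
  then show ?thesis using gH by blast
qed

text \<open>If \<open>k\<close> is the projection of \<open>\<phi>\<close>, then \<open>\<phi>\<close> and \<open>k\<close> have the same inner products with the Bergman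
space of \<open>\<theta>(\<Omega>)\<close>. By the adjoint relation \<open>lift \<phi>\<close> and \<open>lift k\<close> have the same inner products with the Bergman
space of \<open>\<Omega>\<close>, to which \<open>lift k\<close> belongs.\<close>

lemma projection_formula:
  assumes \<phi>: "\<phi> \<in> l2 cod.M" and z: "z \<in> \<Omega>"
  shows "bergman_projection V \<Omega> (\<omega>' \<circ> \<theta>) (lift \<phi>) z
    = complex_jacobian \<theta> z * bergman_projection V (\<theta> ` \<Omega>) \<omega>' \<phi> (\<theta> z)"
proof -
  obtain k where k: "k \<in> cod.H" "\<forall>f\<in>cod.H. ip cod.M f \<phi> = ip cod.M f k"
    using cod.ex_bergman_projection[OF \<phi>] by blast
  have "ip dom.M f (lift \<phi>) = ip dom.M f (lift k)" if f: "f \<in> dom.H" for f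
  proof -
    obtain g where "g \<in> cod.H" "\<forall>\<psi>\<in>l2 cod.M. ip dom.M f (lift \<psi>) = of_nat (card G) * ip cod.M g \<psi>"
      using ex_bergman_adjoint_of_lift[OF f] by blast
    then show ?thesis using k \<phi> cod.bergman_l2[OF k(1)] by simp
  qed
  then have "bergman_projection V \<Omega> (\<omega>' \<circ> \<theta>) (lift \<phi>) z = lift k z"
    by (intro dom.bergman_projection_unique lift_bergman k z)
  moreover have "bergman_projection V (\<theta> ` \<Omega>) \<omega>' \<phi> (\<theta> z) = k (\<theta> z)"
    by (rule cod.bergman_projection_unique[OF k(1)]) (use k z in auto)
  ultimately show ?thesis by (simp add: lift_def)
qed

end

theorem corollary3p7:
  fixes G :: "(complex^'d^'d) set"
    and \<Omega> :: "(complex^'d) set"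
    and \<theta> :: "complex^'d \<Rightarrow> complex^'d"
    and \<omega> \<omega>' :: "complex^'d \<Rightarrow> real"
    and \<phi> :: "complex^'d \<Rightarrow> complex"
  assumes "finite_complex_reflection_group G"
    and "open \<Omega>" and "connected \<Omega>" and "\<Omega> \<noteq> {}" and "bounded \<Omega>"
    and "group_invariant G \<Omega>"
    and "basic_polynomial_map G \<theta>"
    and "continuous_on (\<theta> ` \<Omega>) \<omega>'" and "\<forall>u\<in>\<theta> ` \<Omega>. 0 < \<omega>' u"
    and "\<omega> = \<omega>' \<circ> \<theta>"
    and "\<phi> \<in> L2 (normalized_lebesgue \<Omega>) (\<theta> ` \<Omega>) \<omega>'"
  shows "(\<lambda>z. complex_jacobian \<theta> z * (\<phi> \<circ> \<theta>) z) \<in> L2 (normalized_lebesgue \<Omega>) \<Omega> \<omega> \<and>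
    (\<forall>z\<in>\<Omega>.
       bergman_projection (normalized_lebesgue \<Omega>) \<Omega> \<omega>
         (\<lambda>z. complex_jacobian \<theta> z * (\<phi> \<circ> \<theta>) z) z =
       complex_jacobian \<theta> z *
         (bergman_projection (normalized_lebesgue \<Omega>) (\<theta> ` \<Omega>) \<omega>' \<phi> \<circ> \<theta>) z)"
proof -
  have fm: "\<Omega> \<in> lmeasurable" using assms(2,5) by (simp add: lmeasurable_open)
  have pos: "0 < measure lebesgue \<Omega>"
    using assms(2,4) fm open_not_negligible[of \<Omega>] negligible_iff_measure[of \<Omega>] measure_nonneg[of lebesgue \<Omega>]
    by (metis less_eq_real_def)
  interpret bm: basic_map G \<theta> by (rule basic_map_of_reflection_group[OF assms(1,7)])
  interpret q: quotient_domain G \<theta> "normalized_lebesgue \<Omega>" \<Omega> \<omega>' "1 / measure lebesgue \<Omega>"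
  proof
    show "A *v z \<in> \<Omega>" if "A \<in> G" "z \<in> \<Omega>" for A z
      by (rule group_invariant_mult_mem[OF assms(1,6) that])
    show "normalized_lebesgue \<Omega> = density lebesgue (\<lambda>_. ennreal (1 / measure lebesgue \<Omega>))"
    proof -
      have "1 / emeasure lebesgue \<Omega> = ennreal (1 / measure lebesgue \<Omega>)"
        using pos fm divide_ennreal[of 1 "measure lebesgue \<Omega>"] by (simp add: emeasure_eq_measure2)
      then show ?thesis by (simp add: normalized_lebesgue_def)
    qed
  qed (use assms pos in auto)
  have lift: "(\<lambda>z. complex_jacobian \<theta> z * (\<phi> \<circ> \<theta>) z) = q.lift \<phi>"
    by (simp add: q.lift_def[abs_def])
  have \<phi>: "\<phi> \<in> l2 q.cod.M" using assms(11) by (simp add: q.cod.L2_eq)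
  show ?thesis
    using q.lift_l2[OF \<phi>] q.projection_formula[OF \<phi>] unfolding lift assms(10) q.dom.L2_eq by simp
qed

end
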